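(* Let $n\ge3$ and $1\le p<q\le n$, let $\mathcal{H}$ be a Hilbert space, and let $T=(T_1,\ldots,T_n)\in\mathcal{T}^n_{p,q}(\mathcal{H})$ be a finite rank tuple. Then there exist an isometry $\Pi:\mathcal{H}\to H^2_{\mathcal{D}_{\hat{T}_p}}(\mathbb{D}^{n-1})$ and an inner function $\varphi\in H^\infty_{\mathcal{B}(\mathcal{D}_{\hat{T}_p})}(\mathbb{D})$ such that \[ \Pi T_i^*=\begin{cases} M_{z_i}^*\Pi & \text{if } 1\le i<p,\\ M_{\Phi_p}^*\Pi & \text{if } i=p,\\ M_{z_{i-1}}^*\Pi & \text{if } p<i\le n,\end{cases} \] where $\Phi_p(\boldsymbol{z})=\varphi(z_{q-1})$ for all $\boldsymbol{z}=(z_1,\ldots,z_{n-1})\in\mathbb{D}^{n-1}$. In particular, $T$ on $\mathcal{H}$ dilates to the $n$-tuple of commuting isometries \[ (M_{z_1},\dots,M_{z_{p-1}},M_{\Phi_p},M_{z_p},\dots,M_{z_{n-1}}) \] on $H^2_{\mathcal{D}_{\hat{T}_p}}(\mathbb{D}^{n-1})$.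
   Context: $\mathcal{B}(\mathcal{H})$ is the algebra of bounded operators on the Hilbert space $\mathcal{H}$. $\mathcal{T}^m(\mathcal{H})$ is the set of $m$-tuples $(T_1,\ldots,T_m)$ of pairwise commuting contractions ($\|T_i\|\le1$) on $\mathcal{H}$. For $T\in\mathcal{T}^m(\mathcal{H})$ and $\boldsymbol{k}\in\mathbb{Z}_+^m$ write $T^{\boldsymbol{k}}=T_1^{k_1}\cdots T_m^{k_m}$, $T^{*\boldsymbol{k}}=T_1^{*k_1}\cdots T_m^{*k_m}$, $|\boldsymbol{k}|=\sum_i k_i$, and \[ \mathbb{S}_m^{-1}(T,T^* )=\sum_{\boldsymbol{k}\in\{0,1\}^m}(-1)^{|\boldsymbol{k}|}T^{\boldsymbol{k}}T^{*\boldsymbol{k}}. \] Let $\mathbb{S}_m(\mathcal{H})=\{T\in\mathcal{T}^m(\mathcal{H}):\mathbb{S}_m^{-1}(T,T^* )\ge0\}$; for $T\in\mathbb{S}_m(\mathcal{H})$ let $\mathcal{D}_T=\overline{\mathrm{ran}}\,\mathbb{S}_m^{-1}(T,T^* )$. A tuple $T\in\mathcal{T}^m(\mathcal{H})$ is pure if $\|T_i^{*r}h\|\to0$ as $r\to\infty$ for all $h\in\mathcal{H}$ and all $i$. For $T\in\mathcal{T}^n(\mathcal{H})$, $\hat{T}_i\in\mathcal{T}^{n-1}(\mathcal{H})$ denotes the $(n-1)$-tuple obtained from $T$ by removing $T_i$. For $n\ge3$ and $1\le p<q\le n$, \[ \mathcal{T}^n_{p,q}(\mathcal{H})=\{T\in\mathcal{T}^n(\mathcal{H}):\hat{T}_p,\hat{T}_q\in\mathbb{S}_{n-1}(\mathcal{H})\text{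 and }\hat{T}_p\text{ is pure}\}. \] $T\in\mathcal{T}^n_{p,q}(\mathcal{H})$ is of finite rank if $\dim\mathcal{D}_{\hat{T}_i}<\infty$ for $i=p,q$. For a Hilbert space $\mathcal{E}$, $H^2_{\mathcal{E}}(\mathbb{D}^m)$ is the $\mathcal{E}$-valued Hardy space on the polydisc $\mathbb{D}^m$: analytic $f=\sum_{\boldsymbol{k}\in\mathbb{Z}_+^m}a_{\boldsymbol{k}}\boldsymbol{z}^{\boldsymbol{k}}$, $a_{\boldsymbol{k}}\in\mathcal{E}$, with $\|f\|^2=\sum\|a_{\boldsymbol{k}}\|^2<\infty$. $M_{z_i}$ is multiplication by $z_i$ on it. $H^\infty_{\mathcal{B}(\mathcal{E})}(\mathbb{D}^m)$ is the set of bounded $\mathcal{B}(\mathcal{E})$-valued analytic functions on $\mathbb{D}^m$; for $\Phi$ in it, $M_\Phi$ is multiplication by $\Phi$ on $H^2_{\mathcal{E}}(\mathbb{D}^m)$, and $\Phi$ is inner if $M_\Phi$ is an isometry. A tuple $T\in\mathcal{T}^n(\mathcal{H})$ dilates to an $n$-tuple of commuting isometries $V\in\mathcal{T}^n(\mathcal{K})$ if there is an isometry $\Pi:\mathcal{H}\to\mathcal{K}$ with $\Pi T_i^*=V_i^*\Pi$ for all $i=1,\ldots,n$. *)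

theory Defs
  imports "HOL-Analysis.Analysis" "HOL-Library.Function_Algebras"
begin

subsection \<open>Complex Hilbert spaces\<close>

class complex_vector = ab_group_add +
  fixes scaleC :: "complex \<Rightarrow> 'a \<Rightarrow> 'a"  (infixr "*\<^sub>C" 75)
  assumes scaleC_add_right: "c *\<^sub>C (x + y) = c *\<^sub>C x + c *\<^sub>C y"
    and scaleC_add_left: "(c + d) *\<^sub>C x = c *\<^sub>C x + d *\<^sub>C x"
    and scaleC_scaleC: "c *\<^sub>C (d *\<^sub>C x) = (c * d) *\<^sub>C x"
    and scaleC_one: "1 *\<^sub>C x = x"

global_interpretation complex_vector: vector_space "scaleC :: complex \<Rightarrow> 'a::complex_vector \<Rightarrow> 'a"
  by unfold_locales (simp_all add: scaleC_add_right scaleC_add_left scaleC_scaleC scaleC_one)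

instantiation "fun" :: (type, complex_vector) complex_vector
begin

definition scaleC_fun :: "complex \<Rightarrow> ('a \<Rightarrow> 'b) \<Rightarrow> 'a \<Rightarrow> 'b"
  where "scaleC_fun c f = (\<lambda>x. c *\<^sub>C f x)"

instance
  by standard
    (simp_all add: scaleC_fun_def fun_eq_iff scaleC_add_right scaleC_add_left scaleC_scaleC scaleC_one)

end

text \<open>The inner product is linear in its first argument. The norm and the topology are those of
  the underlying real inner product space, whose inner product is the real part of the complex one.\<close>

class complex_hilbert = complex_vector + real_inner + banach +
  fixes cinner :: "'a \<Rightarrow> 'a \<Rightarrow> complex"
  assumes scaleR_scaleC: "r *\<^sub>R x = complex_of_real r *\<^sub>C x"
    and cinner_add_left: "cinner (x + y) z = cinner x z + cinner y z"
    and cinner_scaleC_left: "cinner (c *\<^sub>C x) y = c * cinner x y"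
    and cinner_commute: "cinner y x = cnj (cinner x y)"
    and inner_eq_Re_cinner: "inner x y = Re (cinner x y)"

lemma norm_scaleC: "norm (c *\<^sub>C x) = cmod c * norm (x :: 'a::complex_hilbert)"
proof -
  have "cinner (c *\<^sub>C x) (c *\<^sub>C x) = c * cnj c * cinner x x"
    by (metis cinner_commute cinner_scaleC_left complex_cnj_mult mult.assoc)
  then have "inner (c *\<^sub>C x) (c *\<^sub>C x) = (cmod c)\<^sup>2 * inner x x"
    unfolding inner_eq_Re_cinner complex_norm_square[symmetric] by (simp add: Re_complex_of_real)
  then show ?thesis
    by (simp add: norm_eq_sqrt_inner real_sqrt_mult)
qed

lemma bounded_linear_scaleC: "bounded_linear (\<lambda>x :: 'a::complex_hilbert. c *\<^sub>C x)"
proof (rule bounded_linear_intro[where K = "cmod c"])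
  show "c *\<^sub>C (r *\<^sub>R x) = r *\<^sub>R (c *\<^sub>C x)" for r and x :: 'a
    by (simp add: scaleR_scaleC scaleC_scaleC mult.commute)
qed (simp_all add: scaleC_add_right norm_scaleC mult.commute)

instantiation blinfun :: (real_normed_vector, complex_hilbert) complex_vector
begin

lift_definition scaleC_blinfun :: "complex \<Rightarrow> ('a \<Rightarrow>\<^sub>L 'b) \<Rightarrow> 'a \<Rightarrow>\<^sub>L 'b"
  is "\<lambda>c A x. c *\<^sub>C A x"
  by (rule bounded_linear_compose[OF bounded_linear_scaleC])

instance
  by standard
    (transfer; simp add: fun_eq_iff scaleC_add_right scaleC_add_left scaleC_scaleC scaleC_one)+

end

text \<open>Hilbert spaces given by a carrier inside a complex vector space together with an inner
  product on it. The Hardy spaces below depend on terms (the number of variables and the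
  coefficient space), so they cannot be types.\<close>

record 'a hspace =
  pts :: "'a set"
  ip :: "'a \<Rightarrow> 'a \<Rightarrow> complex"

definition hnorm :: "'a hspace \<Rightarrow> 'a \<Rightarrow> real"
  where "hnorm K x = sqrt (Re (ip K x x))"

definition hilbert_space :: "'a::complex_vector hspace \<Rightarrow> bool"
  where "hilbert_space K \<longleftrightarrow>
    complex_vector.subspace (pts K) \<and>
    (\<forall>x\<in>pts K. \<forall>y\<in>pts K. \<forall>z\<in>pts K. ip K (x + y) z = ip K x z + ip K y z) \<and>
    (\<forall>c. \<forall>x\<in>pts K. \<forall>y\<in>pts K. ip K (c *\<^sub>C x) y = c * ip K x y) \<and>
    (\<forall>x\<in>pts K. \<forall>y\<in>pts K. ip K y x = cnj (ip K x y)) \<and>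
    (\<forall>x\<in>pts K. Re (ip K x x) \<ge> 0 \<and> (ip K x x = 0 \<longrightarrow> x = 0)) \<and>
    (\<forall>\<sigma>. range \<sigma> \<subseteq> pts K \<and> (\<forall>e>0. \<exists>N::nat. \<forall>i\<ge>N. \<forall>j\<ge>N. hnorm K (\<sigma> i - \<sigma> j) < e) \<longrightarrow>
      (\<exists>x\<in>pts K. (\<lambda>i. hnorm K (\<sigma> i - x)) \<longlonglongrightarrow> 0))"

definition whole :: "'a::complex_hilbert hspace"
  where "whole = \<lparr>pts = UNIV, ip = cinner\<rparr>"

definition linear_between ::
    "'a::complex_vector hspace \<Rightarrow> 'b::complex_vector hspace \<Rightarrow> ('a \<Rightarrow> 'b) \<Rightarrow> bool"
  where "linear_between K L A \<longleftrightarrow>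
    A \<in> pts K \<rightarrow> pts L \<and>
    (\<forall>x\<in>pts K. \<forall>y\<in>pts K. A (x + y) = A x + A y) \<and>
    (\<forall>c. \<forall>x\<in>pts K. A (c *\<^sub>C x) = c *\<^sub>C A x)"

definition hisometry ::
    "'a::complex_vector hspace \<Rightarrow> 'b::complex_vector hspace \<Rightarrow> ('a \<Rightarrow> 'b) \<Rightarrow> bool"
  where "hisometry K L A \<longleftrightarrow>
    linear_between K L A \<and> (\<forall>x\<in>pts K. hnorm L (A x) = hnorm K x)"

definition hadj :: "'a hspace \<Rightarrow> ('a \<Rightarrow> 'a) \<Rightarrow> 'a \<Rightarrow> 'a"
  where "hadj K A y = (THE x. x \<in> pts K \<and> (\<forall>u\<in>pts K. ip K (A u) y = ip K u x))"

subsection \<open>Commuting contractions\<close>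

text \<open>An \<open>m\<close>-tuple is a function on \<open>nat\<close> of which only the values at \<open>1, \<dots>, m\<close> matter.\<close>

definition commuting_contractions :: "nat \<Rightarrow> 'a::complex_vector hspace \<Rightarrow> (nat \<Rightarrow> 'a \<Rightarrow> 'a) set"
  where "commuting_contractions m K = {T.
    (\<forall>i\<in>{1..m}. linear_between K K (T i) \<and> (\<forall>x\<in>pts K. hnorm K (T i x) \<le> hnorm K x)) \<and>
    (\<forall>i\<in>{1..m}. \<forall>j\<in>{1..m}. \<forall>x\<in>pts K. T i (T j x) = T j (T i x))}"

definition dilates ::
    "nat \<Rightarrow> (nat \<Rightarrow> 'a::complex_hilbert \<Rightarrow> 'a) \<Rightarrow> 'b::complex_vector hspace \<Rightarrow> (nat \<Rightarrow> 'b \<Rightarrow> 'b) \<Rightarrow> bool"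
  where "dilates n T K V \<longleftrightarrow>
    hilbert_space K \<and>
    V \<in> commuting_contractions n K \<and> (\<forall>i\<in>{1..n}. hisometry K K (V i)) \<and>
    (\<exists>\<Psi>. hisometry whole K \<Psi> \<and>
      (\<forall>i\<in>{1..n}. \<forall>h. \<Psi> (hadj whole (T i) h) = hadj K (V i) (\<Psi> h)))"

primrec tuple_power :: "nat \<Rightarrow> (nat \<Rightarrow> 'a \<Rightarrow> 'a) \<Rightarrow> (nat \<Rightarrow> nat) \<Rightarrow> 'a \<Rightarrow> 'a"
  where
    "tuple_power 0 T k = id"
  | "tuple_power (Suc m) T k = tuple_power m T k \<circ> (T (Suc m) ^^ k (Suc m))"

definition szego_inv :: "nat \<Rightarrow> (nat \<Rightarrow> 'a::complex_hilbert \<Rightarrow> 'a) \<Rightarrow> 'a \<Rightarrow> 'a"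
  where "szego_inv m T x =
    (\<Sum>k\<in>{1..m} \<rightarrow>\<^sub>E {0, 1}.
      (-1) ^ (\<Sum>i=1..m. k i) *\<^sub>C tuple_power m T k (tuple_power m (\<lambda>i. hadj whole (T i)) k x))"

definition positive_op :: "('a::complex_hilbert \<Rightarrow> 'a) \<Rightarrow> bool"
  where "positive_op A \<longleftrightarrow> (\<forall>x. cinner (A x) x \<in> \<real>\<^sub>\<ge>\<^sub>0)"

definition szego_tuples :: "nat \<Rightarrow> (nat \<Rightarrow> 'a::complex_hilbert \<Rightarrow> 'a) set"
  where "szego_tuples m = {T \<in> commuting_contractions m whole. positive_op (szego_inv m T)}"

definition defect_space :: "nat \<Rightarrow> (nat \<Rightarrow> 'a::complex_hilbert \<Rightarrow> 'a) \<Rightarrow> 'a set"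
  where "defect_space m T = closure (range (szego_inv m T))"

definition pure_tuple :: "nat \<Rightarrow> (nat \<Rightarrow> 'a::complex_hilbert \<Rightarrow> 'a) \<Rightarrow> bool"
  where "pure_tuple m T \<longleftrightarrow>
    (\<forall>i\<in>{1..m}. \<forall>h. (\<lambda>r. norm ((hadj whole (T i) ^^ r) h)) \<longlonglongrightarrow> 0)"

definition remove_entry :: "nat \<Rightarrow> (nat \<Rightarrow> 'a) \<Rightarrow> nat \<Rightarrow> 'a"
  where "remove_entry i T = (\<lambda>j. if j < i then T j else T (Suc j))"

definition tuples_pq :: "nat \<Rightarrow> nat \<Rightarrow> nat \<Rightarrow> (nat \<Rightarrow> 'a::complex_hilbert \<Rightarrow> 'a) set"
  where "tuples_pq n p q = {T \<in> commuting_contractions n whole.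
    remove_entry p T \<in> szego_tuples (n - 1) \<and>
    remove_entry q T \<in> szego_tuples (n - 1) \<and>
    pure_tuple (n - 1) (remove_entry p T)}"

definition finite_cdim :: "'a::complex_vector set \<Rightarrow> bool"
  where "finite_cdim E \<longleftrightarrow> (\<exists>B. finite B \<and> E \<subseteq> complex_vector.span B)"

definition finite_rank :: "nat \<Rightarrow> nat \<Rightarrow> nat \<Rightarrow> (nat \<Rightarrow> 'a::complex_hilbert \<Rightarrow> 'a) \<Rightarrow> bool"
  where "finite_rank n p q T \<longleftrightarrow>
    (\<forall>i\<in>{p, q}. finite_cdim (defect_space (n - 1) (remove_entry i T)))"

subsection \<open>Hardy spaces on the polydisc\<close>

definition polydisc :: "nat \<Rightarrow> (nat \<Rightarrow> complex) set"
  where "polydisc m = {1..m} \<rightarrow>\<^sub>E ball 0 1"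

definition multi_indices :: "nat \<Rightarrow> (nat \<Rightarrow> nat) set"
  where "multi_indices m = {1..m} \<rightarrow>\<^sub>E UNIV"

definition multi_power :: "nat \<Rightarrow> (nat \<Rightarrow> complex) \<Rightarrow> (nat \<Rightarrow> nat) \<Rightarrow> complex"
  where "multi_power m z k = (\<Prod>i=1..m. z i ^ k i)"

definition power_series ::
    "nat \<Rightarrow> ((nat \<Rightarrow> nat) \<Rightarrow> 'a) \<Rightarrow> ((nat \<Rightarrow> complex) \<Rightarrow> 'a::{complex_vector, topological_space}) \<Rightarrow> bool"
  where "power_series m a f \<longleftrightarrow>
    (\<forall>z\<in>polydisc m. ((\<lambda>k. multi_power m z k *\<^sub>C a k) has_sum f z) (multi_indices m))"

text \<open>Functions on the polydisc are extended by \<open>0\<close>, so that equality and the vector space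
  operations of the function type are those of functions on the polydisc. Likewise the
  coefficient family is extensional, hence unique.\<close>

definition hardy_set :: "nat \<Rightarrow> 'a::complex_hilbert set \<Rightarrow> ((nat \<Rightarrow> complex) \<Rightarrow> 'a) set"
  where "hardy_set m E = {f.
    (\<forall>z. z \<notin> polydisc m \<longrightarrow> f z = 0) \<and>
    (\<exists>a \<in> multi_indices m \<rightarrow>\<^sub>E E.
      power_series m a f \<and> (\<lambda>k. (norm (a k))\<^sup>2) summable_on multi_indices m)}"

definition taylor_coeff ::
    "nat \<Rightarrow> ((nat \<Rightarrow> complex) \<Rightarrow> 'a::complex_hilbert) \<Rightarrow> (nat \<Rightarrow> nat) \<Rightarrow> 'a"
  where "taylor_coeff m f = (THE a. a \<in> multi_indices m \<rightarrow>\<^sub>E UNIV \<and> power_series m a f)"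

definition hardy :: "nat \<Rightarrow> 'a::complex_hilbert set \<Rightarrow> ((nat \<Rightarrow> complex) \<Rightarrow> 'a) hspace"
  where "hardy m E = \<lparr>pts = hardy_set m E,
    ip = (\<lambda>f g. \<Sum>\<^sub>\<infinity>k\<in>multi_indices m. cinner (taylor_coeff m f k) (taylor_coeff m g k))\<rparr>"

definition mult_coord :: "nat \<Rightarrow> ((nat \<Rightarrow> complex) \<Rightarrow> 'a::complex_vector) \<Rightarrow> (nat \<Rightarrow> complex) \<Rightarrow> 'a"
  where "mult_coord i f = (\<lambda>z. z i *\<^sub>C f z)"

definition mult_op ::
    "((nat \<Rightarrow> complex) \<Rightarrow> 'a \<Rightarrow>\<^sub>L 'a) \<Rightarrow> ((nat \<Rightarrow> complex) \<Rightarrow> 'a::real_normed_vector) \<Rightarrow> (nat \<Rightarrow> complex) \<Rightarrow> 'a"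
  where "mult_op \<Phi> f = (\<lambda>z. blinfun_apply (\<Phi> z) (f z))"

text \<open>For a closed subspace \<open>E\<close>, bounded operators on \<open>E\<close> are identified, with equal norms,
  with the bounded operators on the whole space that map into \<open>E\<close> and vanish on its
  orthogonal complement.\<close>

definition bounded_ops :: "'a::complex_hilbert set \<Rightarrow> ('a \<Rightarrow>\<^sub>L 'a) set"
  where "bounded_ops E = {A.
    (\<forall>c x. blinfun_apply A (c *\<^sub>C x) = c *\<^sub>C blinfun_apply A x) \<and>
    range (blinfun_apply A) \<subseteq> E \<and>
    (\<forall>x. (\<forall>y\<in>E. cinner x y = 0) \<longrightarrow> blinfun_apply A x = 0)}"

text \<open>Analyticity is expansion into a power series on the polydisc, convergent in operator norm.\<close>

definition H_infty :: "nat \<Rightarrow> 'a::complex_hilbert set \<Rightarrow> ((nat \<Rightarrow> complex) \<Rightarrow> 'a \<Rightarrow>\<^sub>L 'a) set"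
  where "H_infty m E = {\<Phi>.
    \<Phi> \<in> polydisc m \<rightarrow> bounded_ops E \<and>
    (\<exists>A \<in> multi_indices m \<rightarrow> bounded_ops E. power_series m A \<Phi>) \<and>
    bounded (\<Phi> ` polydisc m)}"

definition inner_function :: "nat \<Rightarrow> 'a::complex_hilbert set \<Rightarrow> ((nat \<Rightarrow> complex) \<Rightarrow> 'a \<Rightarrow>\<^sub>L 'a) \<Rightarrow> bool"
  where "inner_function m E \<Phi> \<longleftrightarrow>
    \<Phi> \<in> H_infty m E \<and> hisometry (hardy m E) (hardy m E) (mult_op \<Phi>)"

text \<open>\<open>at_coord 1\<close> identifies functions on the unit disc with functions on \<open>polydisc 1\<close>.\<close>

definition at_coord :: "nat \<Rightarrow> (complex \<Rightarrow> 'b) \<Rightarrow> (nat \<Rightarrow> complex) \<Rightarrow> 'b"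
  where "at_coord j \<phi> = (\<lambda>z. \<phi> (z j))"

end

theory Submission
  imports Defs "HOL-Complex_Analysis.Cauchy_Integral_Formula"
begin

text \<open>Write \<open>S\<close> and \<open>S'\<close> for the inverse Szego kernels of the tuple without its \<open>p\<close>-th and without its
  \<open>q\<close>-th entry. Both are positive of finite rank, so \<open>S = D\<^sup>* D\<close> and \<open>S' = D'\<^sup>* D'\<close> with \<open>D\<close> and \<open>D'\<close>
  mapping into the two defect spaces \<open>E\<close> and \<open>F\<close> (\<open>finite_rank_factorization\<close>). The series
  \<open>\<Psi> h = (\<Sum>k. z\<^sup>k D R\<^sup>*\<^sup>k h)\<close>, where \<open>R\<close> is the tuple without the \<open>p\<close>-th entry, defines an isometry into
  the Hardy space, because summing \<open>\<langle>S R\<^sup>*\<^sup>k h, R\<^sup>*\<^sup>k h\<rangle>\<close> over one coordinate of \<open>k\<close> after the other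
  telescopes, with remainders killed by purity (\<open>szego_inv_has_sum\<close>).

  The missing entry \<open>T\<^sub>p\<close> is recovered from an exchange of energy between the two defects
  (\<open>defect_exchange\<close>):
  \<open>\<parallel>D h\<parallel>\<^sup>2 + \<parallel>D' T\<^sub>q\<^sup>* h\<parallel>\<^sup>2 = \<parallel>D' h\<parallel>\<^sup>2 + \<parallel>D T\<^sub>p\<^sup>* h\<parallel>\<^sup>2\<close>. It says that
  \<open>(D T\<^sub>p\<^sup>* h, D' h) \<mapsto> (D h, D' T\<^sub>q\<^sup>* h)\<close> is isometric between subspaces of \<open>E \<times> F\<close>. As these are
  finite-dimensional, it extends to an isometry \<open>V\<close> of \<open>E \<times> F\<close> (\<open>isometry_extension\<close>). Read \<open>V\<close> as one time
  step of a linear system with input and output in \<open>E\<close> and state in \<open>F\<close>; \<open>\<phi>\<close> is its transfer function.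

  The system preserves energy, so the energy of the output is that of the input unless some of it
  stays in the state forever. In finite dimension this cannot happen (\<open>state_tendsto_0\<close>), and hence
  \<open>\<phi>\<close> is inner. Running the system along the orbit \<open>T\<^sub>q\<^sup>*\<^sup>j h\<close> shows that the adjoint of multiplication by
  \<open>\<phi>(z\<^sub>q\<^sub>-\<^sub>1)\<close> carries \<open>\<Psi> h\<close> to \<open>\<Psi> T\<^sub>p\<^sup>* h\<close> (\<open>response_pairing\<close>, \<open>dilation_intertwines\<close>). A coordinate function
  \<open>z\<^sub>i\<close> is itself such a transfer function, namely that of the system which interchanges input and
  state, so the coordinate multipliers are covered by the same lemmas.\<close>

section \<open>Complex inner products and adjoints\<close>

lemma cinner_add_right: "cinner x (y + z) = cinner x y + cinner x (z :: 'a::complex_hilbert)"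
  by (metis cinner_add_left cinner_commute complex_cnj_add)

lemma cinner_scaleC_right: "cinner x (c *\<^sub>C y) = cnj c * cinner x (y :: 'a::complex_hilbert)"
  by (metis cinner_commute cinner_scaleC_left complex_cnj_mult)

lemma cinner_zero [simp]: "cinner 0 x = 0" "cinner x (0 :: 'a::complex_hilbert) = 0"
  using cinner_add_left[of 0 0 x] cinner_add_right[of x 0 0] by simp_all

lemma scaleC_minus1: "(-1) *\<^sub>C x = - (x :: 'a::complex_vector)"
  using complex_vector.scale_minus_left[of 1 x] by (simp add: scaleC_one)

lemma cinner_minus: "cinner (- x) y = - cinner x y" "cinner x (- y) = - cinner x (y :: 'a::complex_hilbert)"
  using cinner_scaleC_left[of "-1" x y] cinner_scaleC_right[of x "-1" y]
  by (simp_all add: scaleC_minus1)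

lemma cinner_diff: "cinner (x - z) y = cinner x y - cinner z y"
    "cinner x (y - z) = cinner x y - cinner x (z :: 'a::complex_hilbert)"
  using cinner_add_left[of x "- z" y] cinner_add_right[of x y "- z"] by (simp_all add: cinner_minus)

lemma cinner_sum_left: "cinner (\<Sum>i\<in>I. f i) y = (\<Sum>i\<in>I. cinner (f i) (y :: 'a::complex_hilbert))"
  by (induction I rule: infinite_finite_induct) (simp_all add: cinner_add_left)

lemma cinner_sum_right: "cinner y (\<Sum>i\<in>I. f i) = (\<Sum>i\<in>I. cinner y (f i :: 'a::complex_hilbert))"
  by (induction I rule: infinite_finite_induct) (simp_all add: cinner_add_right)

lemmas cinner_simps = cinner_add_left cinner_add_right cinner_scaleC_left cinner_scaleC_right
  cinner_minus cinner_diff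

lemma Re_cinner_self: "Re (cinner x x) = (norm (x :: 'a::complex_hilbert))\<^sup>2"
  by (simp add: inner_eq_Re_cinner[symmetric] power2_norm_eq_inner)

lemma cinner_self: "cinner x x = of_real ((norm (x :: 'a::complex_hilbert))\<^sup>2)"
proof (rule complex_eqI)
  have "cinner x x = cnj (cinner x x)"
    by (rule cinner_commute)
  from arg_cong[OF this, of Im] show "Im (cinner x x) = Im (of_real ((norm x)\<^sup>2))"
    by simp
qed (simp add: Re_cinner_self)

lemma cinner_cauchy_schwarz: "cmod (cinner x y) \<le> norm x * norm (y :: 'a::complex_hilbert)"
proof (cases "cinner x y = 0")
  case False
  \<comment> \<open>Rotating \<open>x\<close> by a phase makes the inner product real, and the real inequality applies.\<close>
  define u where "u = cnj (sgn (cinner x y))"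
  have u: "cmod u = 1"
    using False by (simp add: u_def norm_sgn)
  have "u * cinner x y = of_real (cmod (cinner x y))"
  proof -
    have "u * cinner x y = of_real ((cmod (cinner x y))\<^sup>2) / of_real (cmod (cinner x y))"
      unfolding complex_norm_square by (simp add: u_def sgn_eq mult.commute)
    then show ?thesis
      using False by (simp add: power2_eq_square)
  qed
  then have "cmod (cinner x y) = Re (cinner (u *\<^sub>C x) y)"
    by (metis Re_complex_of_real cinner_scaleC_left)
  also have "\<dots> \<le> norm (u *\<^sub>C x) * norm y"
    by (metis inner_eq_Re_cinner norm_cauchy_schwarz)
  finally show ?thesis
    by (simp add: norm_scaleC u)
qed simp

lemma bounded_linear_cinner_left: "bounded_linear (\<lambda>x :: 'a::complex_hilbert. cinner x y)"
  by (rule bounded_linear_intro[where K = "norm y"])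
     (simp_all add: cinner_simps scaleR_scaleC scaleR_conv_of_real cinner_cauchy_schwarz)

lemma tendsto_cinner [tendsto_intros]:
  assumes "(f \<longlongrightarrow> a) F" "(g \<longlongrightarrow> b) F"
  shows "((\<lambda>n. cinner (f n) (g n)) \<longlongrightarrow> cinner a (b :: 'a::complex_hilbert)) F"
proof -
  have "bounded_bilinear (cinner :: 'a \<Rightarrow> 'a \<Rightarrow> complex)"
    by standard (auto simp: cinner_simps scaleR_scaleC scaleR_conv_of_real
        intro!: exI[of _ 1] cinner_cauchy_schwarz)
  then show ?thesis
    by (rule bounded_bilinear.tendsto[OF _ assms])
qed

lemma cinner_eqI:
  assumes "\<And>u. cinner u x = cinner u y"
  shows "x = (y :: 'a::complex_hilbert)"
proof -
  have "cinner (x - y) (x - y) = 0"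
    using assms[of "x - y"] by (simp add: cinner_simps)
  then show ?thesis
    by (simp add: cinner_self)
qed

lemma polarization_identity:
  "4 * cinner x y = of_real ((norm (x + y))\<^sup>2) - of_real ((norm (x - y))\<^sup>2)
    + \<i> * (of_real ((norm (x + \<i> *\<^sub>C y))\<^sup>2) - of_real ((norm (x - \<i> *\<^sub>C (y :: 'a::complex_hilbert)))\<^sup>2))"
  unfolding cinner_self[symmetric] by (simp add: cinner_simps algebra_simps)

text \<open>Completeness enters through the parallelogram law: for \<open>J x = \<parallel>x\<parallel>\<^sup>2 - 2 f x\<close> it reads
  \<open>\<parallel>x - y\<parallel>\<^sup>2 = 2 J x + 2 J y - 4 J ((x + y) / 2)\<close>, so a minimising sequence of \<open>J\<close> is Cauchy. The
  derivative of \<open>J\<close> vanishes at the limit, which therefore represents \<open>f\<close>.\<close>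

lemma riesz_representation:
  fixes f :: "'a::{real_inner, banach} \<Rightarrow> real"
  assumes "bounded_linear f"
  obtains x where "\<And>v. f v = inner v x"
proof -
  interpret bounded_linear f by fact
  define J where "J x = (norm x)\<^sup>2 - 2 * f x" for x
  obtain K where K: "\<And>x. \<bar>f x\<bar> \<le> norm x * K"
    using bounded by auto
  have lower: "- K\<^sup>2 \<le> J x" for x
  proof -
    have "0 \<le> (norm x - K)\<^sup>2" by simp
    then show ?thesis
      using K[of x] by (simp add: J_def power2_eq_square algebra_simps)
  qed
  define \<mu> where "\<mu> = Inf (range J)"
  have \<mu>: "\<mu> \<le> J x" for x
    unfolding \<mu>_def by (rule cInf_lower) (auto intro!: bdd_belowI[of _ "- K\<^sup>2"] lower)
  have "\<exists>x. J x < \<mu> + 1 / real (Suc n)" for n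
    using cInf_lessD[of "range J" "\<mu> + 1 / real (Suc n)"] unfolding \<mu>_def by auto
  then obtain X where X: "\<And>n. J (X n) < \<mu> + 1 / real (Suc n)"
    by metis
  have par: "(norm (x - y))\<^sup>2 = 2 * J x + 2 * J y - 4 * J ((1/2) *\<^sub>R (x + y))" for x y
    by (simp add: J_def power2_norm_eq_inner inner_simps add scaleR algebra_simps inner_commute)
  have dist2: "(norm (X m - X n))\<^sup>2 < 2 / real (Suc m) + 2 / real (Suc n)" for m n
    using par[of "X m" "X n"] X[of m] X[of n] \<mu>[of "(1/2) *\<^sub>R (X m + X n)"] by simp
  have "Cauchy X"
  proof (rule CauchyI)
    fix e :: real assume "0 < e"
    then obtain N where N: "inverse (real (Suc N)) < e\<^sup>2 / 4"
      using reals_Archimedean[of "e\<^sup>2 / 4"] by auto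
    have "norm (X m - X n) < e" if "m \<ge> N" "n \<ge> N" for m n
    proof -
      have "2 / real (Suc m) \<le> 2 / real (Suc N)" "2 / real (Suc n) \<le> 2 / real (Suc N)"
        using that by (auto intro!: divide_left_mono)
      then have "(norm (X m - X n))\<^sup>2 < e\<^sup>2"
        using dist2[of m n] N by (simp add: inverse_eq_divide)
      then show ?thesis
        using \<open>0 < e\<close> by (simp add: power2_less_imp_less)
    qed
    then show "\<exists>M. \<forall>m\<ge>M. \<forall>n\<ge>M. norm (X m - X n) < e" by blast
  qed
  then obtain x where x: "X \<longlonglongrightarrow> x"
    using Cauchy_convergent_iff convergent_def by blast
  have "(\<lambda>n. J (X n)) \<longlonglongrightarrow> J x"
    unfolding J_def by (intro tendsto_intros x tendsto)
  moreover have "(\<lambda>n. \<mu> + 1 / real (Suc n)) \<longlonglongrightarrow> \<mu> + 0"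
    by (intro tendsto_intros LIMSEQ_inverse_real_of_nat[unfolded inverse_eq_divide])
  ultimately have Jx: "J x \<le> \<mu>"
    by (intro LIMSEQ_le[of "\<lambda>n. J (X n)" _ "\<lambda>n. \<mu> + 1 / real (Suc n)"])
       (auto intro!: exI[of _ 0] less_imp_le X simp del: of_nat_Suc)
  have "f v = inner v x" for v
  proof (rule ccontr)
    define d where "d = f v - inner v x"
    assume "f v \<noteq> inner v x"
    then have d: "d \<noteq> 0" by (simp add: d_def)
    have "J (x + t *\<^sub>R v) = J x - 2 * t * d + t\<^sup>2 * (norm v)\<^sup>2" for t
      unfolding J_def d_def power2_norm_eq_inner add scaleR
      by (simp add: inner_simps algebra_simps inner_commute power2_eq_square)
    then have *: "2 * t * d \<le> t\<^sup>2 * (norm v)\<^sup>2" for t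
      using \<mu>[of "x + t *\<^sub>R v"] Jx by (smt (verit))
    have "v \<noteq> 0"
      using d by (auto simp: d_def zero)
    then have nz: "(norm v)\<^sup>2 > 0"
      by simp
    have "2 * (d / (norm v)\<^sup>2) * d \<le> (d / (norm v)\<^sup>2)\<^sup>2 * (norm v)\<^sup>2"
      by (rule *)
    also have "\<dots> = (d / (norm v)\<^sup>2) * d"
      using nz by (simp add: power2_eq_square)
    finally have "d * d / (norm v)\<^sup>2 \<le> 0"
      by simp
    moreover have "0 < d * d / (norm v)\<^sup>2"
      using d nz by (intro divide_pos_pos) (auto simp: zero_less_mult_iff)
    ultimately show False
      by simp
  qed
  then show ?thesis using that by blast
qed

definition contraction_op :: "('a::complex_hilbert \<Rightarrow> 'a) \<Rightarrow> bool"
  where "contraction_op A \<longleftrightarrow> (\<forall>x y. A (x + y) = A x + A y) \<and> (\<forall>c x. A (c *\<^sub>C x) = c *\<^sub>C A x) \<and>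
    (\<forall>x. norm (A x) \<le> norm x)"

lemma contraction_opD:
  assumes "contraction_op A"
  shows "A (x + y) = A x + A y" "A (c *\<^sub>C x) = c *\<^sub>C A x" "norm (A x) \<le> norm x" "A 0 = 0"
    "A (x - y) = A x - A y"
proof -
  show 1: "A (x + y) = A x + A y" and 2: "A (c *\<^sub>C x) = c *\<^sub>C A x" and "norm (A x) \<le> norm x" for x y c
    using assms by (auto simp: contraction_op_def)
  show "A 0 = 0" using 1[of 0 0] by simp
  show "A (x - y) = A x - A y"
    using 1[of x "(-1) *\<^sub>C y"] 2[of "-1" y] by (simp add: scaleC_minus1)
qed

lemma contraction_op_bounded_linear: "contraction_op A \<Longrightarrow> bounded_linear A"
  by (rule bounded_linear_intro[where K = 1])
     (auto simp: contraction_opD scaleR_scaleC)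

text \<open>The real functional \<open>u \<mapsto> Re \<langle>A u, y\<rangle>\<close> is represented by a vector; replacing \<open>u\<close> by \<open>\<i> u\<close> shows that
  the imaginary parts agree as well.\<close>

lemma adjoint_exists:
  fixes A :: "'a::complex_hilbert \<Rightarrow> 'a"
  assumes "contraction_op A"
  obtains z where "\<And>u. cinner (A u) y = cinner u z"
proof -
  have "bounded_linear (\<lambda>u. inner (A u) y)"
    by (rule bounded_linear_compose[OF bounded_linear_inner_left contraction_op_bounded_linear[OF assms]])
  then obtain z where z: "\<And>u. inner (A u) y = inner u z"
    using riesz_representation by blast
  have re: "Re (cinner (A u) y) = Re (cinner u z)" for u
    using z[of u] by (simp add: inner_eq_Re_cinner)
  have "cinner (A u) y = cinner u z" for u
    using re[of u] re[of "\<i> *\<^sub>C u"]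
    by (intro complex_eqI) (auto simp: contraction_opD[OF assms] cinner_simps)
  then show ?thesis using that by blast
qed

lemma cinner_hadj:
  assumes "contraction_op A"
  shows "cinner (A u) y = cinner u (hadj whole A y)"
proof -
  obtain z where z: "\<And>u. cinner (A u) y = cinner u z"
    using adjoint_exists[OF assms] by blast
  have "hadj whole A y = z"
    unfolding hadj_def whole_def
  proof (rule the_equality)
    fix x assume "x \<in> pts \<lparr>pts = UNIV, ip = cinner\<rparr> \<and>
      (\<forall>u\<in>pts \<lparr>pts = UNIV, ip = cinner\<rparr>. ip \<lparr>pts = UNIV, ip = cinner\<rparr> (A u) y
        = ip \<lparr>pts = UNIV, ip = cinner\<rparr> u x)"
    then show "x = z"
      by (intro cinner_eqI) (simp add: z)
  qed (simp add: z)
  then show ?thesis by (simp add: z)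
qed

lemma cinner_hadj_left:
  assumes "contraction_op A"
  shows "cinner (hadj whole A y) u = cinner y (A u)"
  by (metis assms cinner_commute cinner_hadj)

lemma contraction_op_hadj:
  assumes "contraction_op A"
  shows "contraction_op (hadj whole A)"
  unfolding contraction_op_def
proof (intro conjI allI)
  let ?B = "hadj whole A"
  show "?B (x + y) = ?B x + ?B y" for x y
    by (rule cinner_eqI) (simp add: cinner_simps cinner_hadj[OF assms, symmetric])
  show "?B (c *\<^sub>C x) = c *\<^sub>C ?B x" for c x
    by (rule cinner_eqI) (simp add: cinner_simps cinner_hadj[OF assms, symmetric])
  show "norm (?B x) \<le> norm x" for x
  proof (rule ccontr)
    assume *: "\<not> norm (?B x) \<le> norm x"
    have "(norm (?B x))\<^sup>2 = cmod (cinner (?B x) (?B x))"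
      by (simp add: cinner_self norm_power)
    also have "\<dots> = cmod (cinner (A (?B x)) x)"
      by (simp add: cinner_hadj[OF assms])
    also have "\<dots> \<le> norm (A (?B x)) * norm x"
      by (rule cinner_cauchy_schwarz)
    also have "\<dots> \<le> norm (?B x) * norm x"
      by (intro mult_right_mono contraction_opD[OF assms]) auto
    finally have "norm (?B x) * norm (?B x) \<le> norm (?B x) * norm x"
      by (simp add: power2_eq_square)
    moreover have "norm (?B x) * norm x < norm (?B x) * norm (?B x)"
      using * by (intro mult_strict_left_mono) (auto simp: not_le intro: le_less_trans[OF norm_ge_zero])
    ultimately show False
      by simp
  qed
qed

lemma hadj_commute:
  assumes "contraction_op A" "contraction_op B" "\<And>x. A (B x) = B (A x)"
  shows "hadj whole A (hadj whole B x) = hadj whole B (hadj whole A x)"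
  by (rule cinner_eqI) (metis assms cinner_hadj)

section \<open>Commuting contractions and the inverse Szego kernel\<close>

lemma contraction_op_id: "contraction_op id"
  by (simp add: contraction_op_def)

lemma contraction_op_comp: "contraction_op A \<Longrightarrow> contraction_op B \<Longrightarrow> contraction_op (A \<circ> B)"
  by (auto simp: contraction_op_def intro: order_trans)

lemma contraction_op_funpow: "contraction_op A \<Longrightarrow> contraction_op (A ^^ n)"
  by (induction n) (auto intro: contraction_op_comp contraction_op_id)

lemma commuting_contractions_whole:
  "T \<in> commuting_contractions m whole \<longleftrightarrow>
    (\<forall>i\<in>{1..m}. contraction_op (T i)) \<and> (\<forall>i\<in>{1..m}. \<forall>j\<in>{1..m}. \<forall>x. T i (T j x) = T j (T i x))"
  by (simp add: commuting_contractions_def contraction_op_def linear_between_def whole_def hnorm_def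
      Re_cinner_self)

lemma tuple_power_commute:
  assumes "\<And>i x. i \<in> {1..m} \<Longrightarrow> T i (A x) = A (T i x)"
  shows "tuple_power m T k (A x) = A (tuple_power m T k x)"
  using assms
proof (induction m arbitrary: x)
  case (Suc m)
  have "(T (Suc m) ^^ n) (A x) = A ((T (Suc m) ^^ n) x)" for n x
    by (induction n) (simp_all add: Suc.prems)
  then show ?case
    using Suc by simp
qed simp

lemma contraction_op_tuple_power:
  assumes "\<And>i. i \<in> {1..m} \<Longrightarrow> contraction_op (T i)"
  shows "contraction_op (tuple_power m T k)"
  using assms
  by (induction m) (auto intro!: contraction_op_comp contraction_op_id contraction_op_funpow)

lemma tuple_power_cong:
  assumes "\<And>i. i \<in> {1..m} \<Longrightarrow> T i = T' i" "\<And>i. i \<in> {1..m} \<Longrightarrow> k i = k' i"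
  shows "tuple_power m T k = tuple_power m T' k'"
  using assms by (induction m) auto

lemma szego_inv_cong:
  assumes "\<And>i. i \<in> {1..m} \<Longrightarrow> T i = T' i"
  shows "szego_inv m T = szego_inv m T'"
proof -
  have "tuple_power m T k = tuple_power m T' k"
    "tuple_power m (\<lambda>i. hadj whole (T i)) k = tuple_power m (\<lambda>i. hadj whole (T' i)) k" for k
    by (auto intro!: tuple_power_cong simp: assms)
  then show ?thesis
    by (simp add: szego_inv_def fun_eq_iff)
qed

lemma szego_inv_0: "szego_inv 0 T x = x"
  by (simp add: szego_inv_def scaleC_one)

lemma contraction_op_sum:
  assumes "contraction_op A"
  shows "A (\<Sum>i\<in>I. f i) = (\<Sum>i\<in>I. A (f i))"
  by (induction I rule: infinite_finite_induct) (simp_all add: contraction_opD[OF assms])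

text \<open>Split \<open>{0, 1}\<^sup>m\<^sup>+\<^sup>1\<close> by the last exponent. The terms with exponent \<open>1\<close> carry one more sign and one more
  \<open>T\<^sub>m\<^sub>+\<^sub>1\<close>, which commutes past the other entries to the outside.\<close>

lemma szego_inv_Suc:
  assumes T: "T \<in> commuting_contractions (Suc m) whole"
  shows "szego_inv (Suc m) T x =
    szego_inv m T x - T (Suc m) (szego_inv m T (hadj whole (T (Suc m)) x))"
proof -
  let ?A = "T (Suc m)" and ?S = "\<lambda>i. hadj whole (T i)"
  let ?P = "{1..m} \<rightarrow>\<^sub>E {0, 1::nat}"
  define F where "F k = (-1) ^ (\<Sum>i=1..Suc m. k i) *\<^sub>C
      tuple_power (Suc m) T k (tuple_power (Suc m) ?S k x)" for k
  define G where "G g y = (-1) ^ (\<Sum>i=1..m. g i) *\<^sub>C tuple_power m T g (tuple_power m ?S g y)" for g y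
  have A: "contraction_op ?A"
    using T by (auto simp: commuting_contractions_whole)
  have upd: "tuple_power m U (g(Suc m := j)) = tuple_power m U g" for U :: "nat \<Rightarrow> 'a \<Rightarrow> 'a" and g j
    by (rule tuple_power_cong) auto
  have sumupd: "(\<Sum>i=1..Suc m. (g(Suc m := j)) i) = (\<Sum>i=1..m. g i) + j" for j :: nat and g :: "nat \<Rightarrow> nat"
    by (simp add: sum.cl_ivl_Suc)
  have F0: "F (g(Suc m := 0)) = G g x" for g
    unfolding F_def G_def sumupd by (simp add: upd)
  have F1: "F (g(Suc m := 1)) = - ?A (G g (hadj whole ?A x))" for g
  proof -
    have "tuple_power m T g (?A y) = ?A (tuple_power m T g y)" for y
      by (rule tuple_power_commute) (use T in \<open>auto simp: commuting_contractions_whole\<close>)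
    then show ?thesis
      unfolding F_def G_def sumupd
      by (simp add: upd contraction_opD[OF A])
  qed
  have "{1..Suc m} = insert (Suc m) {1..m}" by auto
  then have P: "({1..Suc m} \<rightarrow>\<^sub>E {0, 1::nat}) = (\<lambda>(j, g). g(Suc m := j)) ` ({0, 1} \<times> ?P)"
    by (simp add: PiE_insert_eq)
  have "szego_inv (Suc m) T x = (\<Sum>k\<in>{1..Suc m} \<rightarrow>\<^sub>E {0, 1}. F k)"
    by (simp add: szego_inv_def F_def)
  also have "\<dots> = (\<Sum>(j, g)\<in>{0, 1} \<times> ?P. F (g(Suc m := j)))"
    unfolding P by (subst sum.reindex[OF inj_combinator]) (auto simp: case_prod_unfold)
  also have "\<dots> = (\<Sum>j\<in>{0, 1}. \<Sum>g\<in>?P. F (g(Suc m := j)))"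
    by (simp add: sum.cartesian_product)
  also have "\<dots> = (\<Sum>g\<in>?P. F (g(Suc m := 0))) + (\<Sum>g\<in>?P. F (g(Suc m := 1)))"
    by simp
  also have "\<dots> = (\<Sum>g\<in>?P. G g x) - ?A (\<Sum>g\<in>?P. G g (hadj whole ?A x))"
    unfolding F0 F1 by (simp add: sum_negf contraction_op_sum[OF A])
  finally show ?thesis
    by (simp add: szego_inv_def G_def)
qed

definition selfadjoint_op :: "('a::complex_hilbert \<Rightarrow> 'a) \<Rightarrow> bool"
  where "selfadjoint_op S \<longleftrightarrow> (\<forall>x y. S (x + y) = S x + S y) \<and> (\<forall>c x. S (c *\<^sub>C x) = c *\<^sub>C S x) \<and>
    (\<exists>K. \<forall>x. norm (S x) \<le> norm x * K) \<and> (\<forall>x y. cinner (S x) y = cinner x (S y))"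

lemma selfadjoint_opD:
  assumes "selfadjoint_op S"
  shows "S (x + y) = S x + S y" "S (c *\<^sub>C x) = c *\<^sub>C S x" "cinner (S x) y = cinner x (S y)"
    "S (x - y) = S x - S y" "S 0 = 0"
proof -
  show 1: "S (x + y) = S x + S y" and 2: "S (c *\<^sub>C x) = c *\<^sub>C S x" and "cinner (S x) y = cinner x (S y)"
    for x y c
    using assms by (auto simp: selfadjoint_op_def)
  show "S (x - y) = S x - S y"
    using 1[of x "(-1) *\<^sub>C y"] 2[of "-1" y] by (simp add: scaleC_minus1)
  show "S 0 = 0" using 1[of 0 0] by simp
qed

lemma selfadjoint_op_conjugate:
  assumes S: "selfadjoint_op S" and A: "contraction_op A"
  shows "selfadjoint_op (\<lambda>x. A (S (hadj whole A x)))"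
proof -
  note A' = contraction_op_hadj[OF A]
  obtain K where K: "\<And>x. norm (S x) \<le> norm x * K"
    using S by (auto simp: selfadjoint_op_def)
  have "norm (A (S (hadj whole A x))) \<le> norm x * \<bar>K\<bar>" for x
  proof -
    have "norm (A (S (hadj whole A x))) \<le> norm (S (hadj whole A x))"
      by (rule contraction_opD[OF A])
    also have "\<dots> \<le> norm (hadj whole A x) * K"
      by (rule K)
    also have "\<dots> \<le> norm (hadj whole A x) * \<bar>K\<bar>"
      by (intro mult_left_mono) auto
    also have "\<dots> \<le> norm x * \<bar>K\<bar>"
      by (intro mult_right_mono contraction_opD[OF A']) auto
    finally show ?thesis .
  qed
  then show ?thesis
    unfolding selfadjoint_op_def
    by (auto simp: contraction_opD[OF A] contraction_opD[OF A'] selfadjoint_opD[OF S] cinner_hadj[OF A]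
        cinner_hadj_left[OF A, symmetric])
qed

lemma selfadjoint_op_diff:
  assumes "selfadjoint_op S" "selfadjoint_op R"
  shows "selfadjoint_op (\<lambda>x. S x - R x)"
proof -
  obtain K L where "\<And>x. norm (S x) \<le> norm x * K" "\<And>x. norm (R x) \<le> norm x * L"
    using assms by (auto simp: selfadjoint_op_def)
  then have "norm (S x - R x) \<le> norm x * (K + L)" for x
    using norm_triangle_le_diff[of "S x" "R x" "norm x * K + norm x * L"]
    by (simp add: add_mono distrib_left)
  then show ?thesis
    unfolding selfadjoint_op_def
    by (auto simp: selfadjoint_opD[OF assms(1)] selfadjoint_opD[OF assms(2)] cinner_simps
        complex_vector.scale_right_diff_distrib)
qed

lemma selfadjoint_op_szego_inv:
  assumes "T \<in> commuting_contractions m whole"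
  shows "selfadjoint_op (szego_inv m T)"
  using assms
proof (induction m)
  case 0
  then show ?case
    by (auto simp: selfadjoint_op_def szego_inv_0 intro!: exI[of _ 1])
next
  case (Suc m)
  have eq: "szego_inv (Suc m) T =
      (\<lambda>x. szego_inv m T x - T (Suc m) (szego_inv m T (hadj whole (T (Suc m)) x)))"
    using szego_inv_Suc[OF Suc.prems] by blast
  have "T \<in> commuting_contractions m whole" "contraction_op (T (Suc m))"
    using Suc.prems by (auto simp: commuting_contractions_whole)
  then show ?case
    unfolding eq by (intro selfadjoint_op_diff selfadjoint_op_conjugate Suc.IH)
qed

lemma remove_entry_commuting_contractions:
  assumes "T \<in> commuting_contractions (Suc m) whole" "l \<in> {1..Suc m}"
  shows "remove_entry l T \<in> commuting_contractions m whole"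
  using assms by (auto simp: commuting_contractions_whole remove_entry_def)

text \<open>Since the conjugations \<open>X \<mapsto> T\<^sub>i X T\<^sub>i\<^sup>*\<close> commute, the inverse Szego kernel does not depend on the
  order of the entries, and any of them may be split off.\<close>

lemma szego_inv_remove_entry:
  assumes T: "T \<in> commuting_contractions (Suc m) whole" and l: "l \<in> {1..Suc m}"
  shows "szego_inv (Suc m) T x = szego_inv m (remove_entry l T) x
    - T l (szego_inv m (remove_entry l T) (hadj whole (T l) x))"
  using assms
proof (induction m arbitrary: x l)
  case 0
  then show ?case
    using szego_inv_Suc[OF 0(1), of x] by (simp add: szego_inv_0)
next
  case (Suc m)
  show ?case
  proof (cases "l = Suc (Suc m)")
    case True
    have "szego_inv (Suc m) (remove_entry l T) = szego_inv (Suc m) T"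
      by (rule szego_inv_cong) (auto simp: True remove_entry_def)
    then show ?thesis
      using szego_inv_Suc[OF Suc.prems(1)] True by simp
  next
    case False
    then have l: "l \<in> {1..Suc m}" using Suc.prems by auto
    define A where "A = T l"
    define B where "B = T (Suc (Suc m))"
    define X where "X = szego_inv m (remove_entry l T)"
    have A: "contraction_op A" and B: "contraction_op B" and AB: "\<And>x. A (B x) = B (A x)"
      using Suc.prems by (auto simp: A_def B_def commuting_contractions_whole)
    have T': "T \<in> commuting_contractions (Suc m) whole"
      using Suc.prems by (auto simp: commuting_contractions_whole)
    have R: "remove_entry l T \<in> commuting_contractions (Suc m) whole"
      by (rule remove_entry_commuting_contractions[OF Suc.prems])
    have rB: "remove_entry l T (Suc m) = B"
      using l by (simp add: remove_entry_def B_def)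
    have SR: "szego_inv (Suc m) (remove_entry l T) y = X y - B (X (hadj whole B y))" for y
      using szego_inv_Suc[OF R, of y] by (simp add: rB X_def)
    have IH: "szego_inv (Suc m) T y = X y - A (X (hadj whole A y))" for y
      using Suc.IH[OF T' l, of y] by (simp add: X_def A_def)
    have "szego_inv (Suc (Suc m)) T x =
        X x - A (X (hadj whole A x)) - B (X (hadj whole B x) - A (X (hadj whole A (hadj whole B x))))"
      using szego_inv_Suc[OF Suc.prems(1), of x] by (simp add: IH B_def)
    also have "\<dots> = X x - B (X (hadj whole B x)) - A (X (hadj whole A x) - B (X (hadj whole B (hadj whole A x))))"
      by (simp add: contraction_opD[OF A] contraction_opD[OF B] AB hadj_commute[OF A B AB])
    finally show ?thesis
      by (simp add: SR A_def)
  qed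
qed

section \<open>Sums over multi-indices\<close>

text \<open>All sums over multi-indices are taken along one distinguished coordinate \<open>l\<close> first; \<open>g\<close> collects the
  remaining exponents.\<close>

lemma has_sum_fibres:
  assumes "l \<in> {1..m}"
  shows "(f has_sum s) (multi_indices m) \<longleftrightarrow>
    ((\<lambda>(g, j). f (g(l := j))) has_sum s) ((({1..m} - {l}) \<rightarrow>\<^sub>E UNIV) \<times> UNIV)"
proof -
  have "multi_indices m = insert l ({1..m} - {l}) \<rightarrow>\<^sub>E UNIV"
    using assms by (simp add: multi_indices_def insert_absorb)
  also have "\<dots> = (\<lambda>(g, j). g(l := j)) ` ((({1..m} - {l}) \<rightarrow>\<^sub>E UNIV) \<times> UNIV)"
    unfolding PiE_insert_eq by force
  finally have eq: "multi_indices m = (\<lambda>(g, j). g(l := j)) ` ((({1..m} - {l}) \<rightarrow>\<^sub>E UNIV) \<times> UNIV)" .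
  show ?thesis
    unfolding eq by (subst has_sum_reindex[OF inj_combinator']) (auto simp: o_def case_prod_unfold)
qed

lemma has_sum_Sigma_nonneg:
  fixes f :: "'b \<times> 'c \<Rightarrow> real"
  assumes "\<And>x. x \<in> A \<Longrightarrow> ((\<lambda>y. f (x, y)) has_sum g x) B" "(g has_sum s) A"
    and "\<And>x y. x \<in> A \<Longrightarrow> y \<in> B \<Longrightarrow> f (x, y) \<ge> 0"
  shows "(f has_sum s) (A \<times> B)"
  using assms by (intro has_sum_SigmaI[where g = g] summable_on_SigmaI[where g = g])
    (auto dest: has_sum_imp_summable)

lemma has_sum_telescope:
  fixes a b :: "nat \<Rightarrow> real"
  assumes "\<And>j. a j = b j - b (Suc j)" "\<And>j. a j \<ge> 0" "b \<longlonglongrightarrow> 0"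
  shows "(a has_sum b 0) UNIV"
proof (rule sums_nonneg_imp_has_sum)
  have "(\<Sum>j<n. a j) = b 0 - b n" for n
    by (induction n) (simp_all add: assms(1))
  then show "a sums b 0"
    unfolding sums_def using tendsto_diff[OF tendsto_const[of "b 0"] assms(3)] by simp
qed (use assms in auto)

text \<open>The inverse Szego kernel is \<open>(1 - C\<^sub>1) \<dots> (1 - C\<^sub>m) 1\<close> with \<open>C\<^sub>i X = T\<^sub>i X T\<^sub>i\<^sup>*\<close>. Summing over the powers of
  \<open>C\<^sub>m\<close> telescopes and undoes the factor \<open>1 - C\<^sub>m\<close>, since purity makes the remainder vanish. The result is
  the kernel of the first \<open>m - 1\<close> entries, which is positive as a sum of nonnegative terms, and the
  induction ends with \<open>\<parallel>h\<parallel>\<^sup>2\<close>.\<close>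

lemma szego_inv_has_sum:
  assumes "T \<in> commuting_contractions m whole" "pure_tuple m T" "positive_op (szego_inv m T)"
  defines "P \<equiv> tuple_power m (\<lambda>i. hadj whole (T i))"
  shows "((\<lambda>k. Re (cinner (szego_inv m T (P k h)) (P k h))) has_sum (norm h)\<^sup>2) (multi_indices m)"
  using assms(1-3) unfolding P_def
proof (induction m)
  case 0
  then show ?case
    by (intro has_sum_finiteI) (auto simp: szego_inv_0 multi_indices_def Re_cinner_self)
next
  case (Suc m)
  define A where "A = T (Suc m)"
  let ?B = "hadj whole A"
  let ?P = "tuple_power m (\<lambda>i. hadj whole (T i))"
  let ?S = "szego_inv m T" and ?S' = "szego_inv (Suc m) T"
  have T: "T \<in> commuting_contractions m whole" and A: "contraction_op A"
    and Ti: "\<And>i. i \<in> {1..m} \<Longrightarrow> contraction_op (T i)"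
    and AT: "\<And>i x. i \<in> {1..m} \<Longrightarrow> T i (A x) = A (T i x)"
    using Suc.prems(1) by (auto simp: commuting_contractions_whole A_def)
  have pure: "pure_tuple m T" "(\<lambda>r. norm ((?B ^^ r) h)) \<longlonglongrightarrow> 0" for h
    using Suc.prems(2) by (auto simp: pure_tuple_def A_def)
  have S: "selfadjoint_op ?S"
    by (rule selfadjoint_op_szego_inv[OF T])
  then obtain K where K: "\<And>x. norm (?S x) \<le> norm x * K"
    by (auto simp: selfadjoint_op_def)
  have PB: "?P k ((?B ^^ j) x) = (?B ^^ j) (?P k x)" for k j x
  proof (rule tuple_power_commute)
    fix i y assume "i \<in> {1..m}"
    then have "hadj whole (T i) (?B y) = ?B (hadj whole (T i) y)" for y
      by (intro hadj_commute Ti A AT)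
    then show "hadj whole (T i) ((?B ^^ j) y) = (?B ^^ j) (hadj whole (T i) y)"
      by (induction j) simp_all
  qed
  have pos: "Re (cinner (?S' x) x) \<ge> 0" for x
    using Suc.prems(3) by (auto simp: positive_op_def nonneg_Reals_def complex_eq_iff)
  have row: "((\<lambda>j. Re (cinner (?S' ((?B ^^ j) x)) ((?B ^^ j) x))) has_sum Re (cinner (?S x) x)) UNIV" for x
  proof -
    define b where "b j = Re (cinner (?S ((?B ^^ j) x)) ((?B ^^ j) x))" for j
    have "b \<longlonglongrightarrow> 0"
    proof (rule Lim_null_comparison)
      have "norm (b j) \<le> (norm ((?B ^^ j) x))\<^sup>2 * K" for j
      proof -
        have "norm (b j) \<le> cmod (cinner (?S ((?B ^^ j) x)) ((?B ^^ j) x))"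
          by (simp add: b_def abs_Re_le_cmod)
        also have "\<dots> \<le> norm (?S ((?B ^^ j) x)) * norm ((?B ^^ j) x)"
          by (rule cinner_cauchy_schwarz)
        also have "\<dots> \<le> (norm ((?B ^^ j) x) * K) * norm ((?B ^^ j) x)"
          by (intro mult_right_mono K) auto
        finally show ?thesis by (simp add: power2_eq_square mult_ac)
      qed
      then show "\<forall>\<^sub>F j in sequentially. norm (b j) \<le> (norm ((?B ^^ j) x))\<^sup>2 * K"
        by simp
      show "(\<lambda>j. (norm ((?B ^^ j) x))\<^sup>2 * K) \<longlonglongrightarrow> 0"
        by (rule tendsto_eq_intros pure refl | simp)+
    qed
    moreover have "Re (cinner (?S' ((?B ^^ j) x)) ((?B ^^ j) x)) = b j - b (Suc j)" for j
      unfolding szego_inv_Suc[OF Suc.prems(1)] A_def[symmetric] b_def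
      by (simp add: cinner_simps cinner_hadj[OF A])
    ultimately have "((\<lambda>j. Re (cinner (?S' ((?B ^^ j) x)) ((?B ^^ j) x))) has_sum b 0) UNIV"
      by (intro has_sum_telescope pos)
    then show ?thesis by (simp add: b_def)
  qed
  have "positive_op ?S"
    unfolding positive_op_def
  proof
    fix x
    have "Re (cinner (?S x) x) \<ge> 0"
      by (rule has_sum_nonneg[OF row]) (rule pos)
    moreover have "cinner (?S x) x \<in> \<real>"
      using cinner_commute[of "?S x" x] by (simp add: Reals_cnj_iff selfadjoint_opD(3)[OF S])
    ultimately show "cinner (?S x) x \<in> \<real>\<^sub>\<ge>\<^sub>0"
      by (auto simp: complex_nonneg_Reals_iff complex_is_Real_iff)
  qed
  note IH = Suc.IH[OF T pure(1) this]
  have upd: "tuple_power (Suc m) (\<lambda>i. hadj whole (T i)) (g(Suc m := j)) h = (?B ^^ j) (?P g h)" for g j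
  proof -
    have "tuple_power m (\<lambda>i. hadj whole (T i)) (g(Suc m := j)) = ?P g"
      by (rule tuple_power_cong) auto
    then show ?thesis using PB[of g j h] by (simp add: A_def)
  qed
  have "((\<lambda>(g, j). Re (cinner (?S' ((?B ^^ j) (?P g h))) ((?B ^^ j) (?P g h)))) has_sum (norm h)\<^sup>2)
      (multi_indices m \<times> UNIV)"
    by (rule has_sum_Sigma_nonneg[where g = "\<lambda>g. Re (cinner (?S (?P g h)) (?P g h))"])
       (auto intro: row IH pos)
  moreover have "{1..Suc m} - {Suc m} = {1..m}" by auto
  ultimately show ?case
    using has_sum_fibres[of "Suc m" "Suc m"
        "\<lambda>k. Re (cinner (?S' (tuple_power (Suc m) (\<lambda>i. hadj whole (T i)) k h))
          (tuple_power (Suc m) (\<lambda>i. hadj whole (T i)) k h))" "(norm h)\<^sup>2"]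
    unfolding upd by (simp add: multi_indices_def case_prod_unfold)
qed

section \<open>Finite-dimensional subspaces\<close>

abbreviation cspan :: "'a::complex_vector set \<Rightarrow> 'a set"
  where "cspan \<equiv> complex_vector.span"

definition orthonormal :: "'a::complex_hilbert set \<Rightarrow> bool"
  where "orthonormal B \<longleftrightarrow> (\<forall>x\<in>B. \<forall>y\<in>B. cinner x y = (if x = y then 1 else 0))"

text \<open>For an orthonormal \<open>B\<close> this is the orthogonal projection onto the span of \<open>B\<close>.\<close>

definition fourier_sum :: "'a::complex_hilbert set \<Rightarrow> 'a \<Rightarrow> 'a"
  where "fourier_sum B x = (\<Sum>e\<in>B. cinner x e *\<^sub>C e)"

lemma fourier_sum_in_span: "fourier_sum B x \<in> cspan B"
  unfolding fourier_sum_def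
  by (intro complex_vector.span_sum complex_vector.span_scale complex_vector.span_base)

lemma cinner_fourier_sum:
  assumes "finite B" "orthonormal B" "e \<in> B"
  shows "cinner (fourier_sum B x) e = cinner x e"
proof -
  have "cinner (fourier_sum B x) e = (\<Sum>b\<in>B. cinner x b * (if b = e then 1 else 0))"
    unfolding fourier_sum_def cinner_sum_left using assms
    by (intro sum.cong) (auto simp: cinner_simps orthonormal_def)
  also have "\<dots> = cinner x e"
    using assms(1,3) by (simp add: if_distrib[of "(*) _"] sum.delta' cong: if_cong)
  finally show ?thesis .
qed

lemma cinner_span_zero:
  assumes "\<And>e. e \<in> B \<Longrightarrow> cinner x e = 0" "w \<in> cspan B"
  shows "cinner x w = 0"
  using assms(2)
  by (induction rule: complex_vector.span_induct_alt) (auto simp: assms(1) cinner_simps)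

lemma fourier_sum_eq:
  assumes "finite B" "orthonormal B" "x \<in> cspan B"
  shows "fourier_sum B x = x"
proof -
  let ?y = "x - fourier_sum B x"
  have "?y \<in> cspan B"
    by (intro complex_vector.span_diff assms fourier_sum_in_span)
  moreover have "cinner ?y e = 0" if "e \<in> B" for e
    using cinner_fourier_sum[OF assms(1,2) that, of x] by (simp add: cinner_simps)
  ultimately have "cinner ?y ?y = 0"
    using cinner_span_zero by blast
  then show ?thesis
    by (simp add: cinner_self)
qed

lemma norm_fourier_sum_le:
  assumes "finite B" "orthonormal B"
  shows "norm (fourier_sum B x) \<le> norm x"
proof -
  define p where "p = fourier_sum B x"
  define r where "r = x - p"
  have "cinner r e = 0" if "e \<in> B" for e
    using cinner_fourier_sum[OF assms that, of x] by (simp add: cinner_simps r_def p_def)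
  then have "cinner r p = 0"
    unfolding p_def by (rule cinner_span_zero) (auto intro: fourier_sum_in_span)
  then have "inner r p = 0"
    by (simp add: inner_eq_Re_cinner)
  then have "(norm (r + p))\<^sup>2 = (norm r)\<^sup>2 + (norm p)\<^sup>2"
    unfolding power2_norm_eq_inner by (simp add: inner_add_left inner_add_right inner_commute[of p r])
  then have "(norm p)\<^sup>2 \<le> (norm x)\<^sup>2" by (simp add: r_def)
  then show ?thesis
    unfolding p_def by (rule power2_le_imp_le) simp
qed

lemma orthonormal_basis_of_span:
  fixes B :: "'a::complex_hilbert set"
  assumes "finite B"
  shows "\<exists>C. finite C \<and> orthonormal C \<and> cspan C = cspan B"
  using assms
proof (induction B)
  case empty
  show ?case by (intro exI[of _ "{}"]) (simp add: orthonormal_def)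
next
  case (insert b B)
  then obtain C where C: "finite C" "orthonormal C" "cspan C = cspan B"
    by blast
  define r where "r = b - fourier_sum C b"
  have p: "fourier_sum C b \<in> cspan C"
    by (rule fourier_sum_in_span)
  have r: "cinner r e = 0" if "e \<in> C" for e
    using cinner_fourier_sum[OF C(1,2) that, of b] by (simp add: r_def cinner_simps)
  show ?case
  proof (cases "r = 0")
    case True
    then have "b \<in> cspan B"
      using p C(3) by (simp add: r_def)
    then have "cspan (insert b B) = cspan B"
      by (rule complex_vector.span_redundant)
    then show ?thesis
      using C by auto
  next
    case False
    define u where "u = of_real (1 / norm r) *\<^sub>C r"
    have b: "b = of_real (norm r) *\<^sub>C u + fourier_sum C b"
      using False by (simp add: u_def scaleC_scaleC scaleC_one) (simp add: r_def)
    have "cinner u u = 1"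
      using False unfolding cinner_self by (simp add: u_def norm_scaleC norm_divide)
    moreover have ue: "cinner u e = 0" "cinner e u = 0" if "e \<in> C" for e
      using r[OF that] cinner_commute[of e u] by (auto simp: u_def cinner_simps)
    ultimately have "orthonormal (insert u C)"
      using C(2) by (auto simp: orthonormal_def)
    moreover have "cspan (insert u C) = cspan (insert b B)"
    proof -
      have sub: "cspan B \<subseteq> cspan (insert b B)" "cspan C \<subseteq> cspan (insert u C)"
        by (auto intro!: complex_vector.span_mono)
      have "r \<in> cspan (insert b B)"
        unfolding r_def using p sub(1) C(3)
        by (intro complex_vector.span_diff) (auto intro: complex_vector.span_base)
      then have "u \<in> cspan (insert b B)"
        unfolding u_def by (rule complex_vector.span_scale)
      moreover have "b \<in> cspan (insert u C)"
        by (subst b) (use p sub(2) in \<open>auto intro!: complex_vector.span_add complex_vector.span_scale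
          intro: complex_vector.span_base\<close>)
      ultimately show ?thesis
        using C(3) sub complex_vector.span_superset[of B] complex_vector.span_superset[of C]
        by (subst complex_vector.span_eq) auto
    qed
    ultimately show ?thesis
      using C(1) by (intro exI[of _ "insert u C"]) auto
  qed
qed

lemma finite_cdim_basis:
  assumes "complex_vector.subspace E" "finite_cdim E"
  obtains B where "finite B" "B \<subseteq> E" "cspan B = E"
proof -
  obtain C where C: "finite C" "E \<subseteq> cspan C"
    using assms(2) by (auto simp: finite_cdim_def)
  obtain B where B: "B \<subseteq> E" "\<not> complex_vector.dependent B" "E \<subseteq> cspan B"
    using complex_vector.maximal_independent_subset[of E] by blast
  have "finite B"
    using complex_vector.independent_span_bound[OF C(1) B(2)] B(1) C(2) by auto
  moreover have "cspan B = E"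
    using B assms(1) complex_vector.span_minimal by blast
  ultimately show ?thesis
    using that B by blast
qed

lemma finite_cdim_orthonormal_basis:
  assumes "complex_vector.subspace E" "finite_cdim E"
  obtains B where "finite B" "orthonormal B" "cspan B = (E :: 'a::complex_hilbert set)"
  using finite_cdim_basis[OF assms] orthonormal_basis_of_span by metis

lemma compact_bounded_combinations:
  fixes B :: "'a::complex_hilbert set"
  assumes "finite B"
  shows "compact {\<Sum>e\<in>B. c e *\<^sub>C e | c. \<forall>e\<in>B. cmod (c e) \<le> R}"
  using assms
proof (induction B)
  case (insert b B)
  let ?K = "\<lambda>B. {\<Sum>e\<in>B. c e *\<^sub>C e | c. \<forall>e\<in>B. cmod (c e) \<le> R}"
  have "?K (insert b B) = (\<lambda>(t, x). t *\<^sub>C b + x) ` (cball 0 R \<times> ?K B)" (is "_ = ?r")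
  proof
    show "?K (insert b B) \<subseteq> ?r"
      using insert.hyps by (force simp: image_iff)
    show "?r \<subseteq> ?K (insert b B)"
    proof clarify
      fix t :: complex and c :: "'a \<Rightarrow> complex"
      assume "t \<in> cball 0 R" "\<forall>e\<in>B. cmod (c e) \<le> R"
      moreover have "(\<Sum>e\<in>B. (if e = b then t else c e) *\<^sub>C e) = (\<Sum>e\<in>B. c e *\<^sub>C e)"
        using insert.hyps by (intro sum.cong) auto
      ultimately show "\<exists>c'. t *\<^sub>C b + (\<Sum>e\<in>B. c e *\<^sub>C e) = (\<Sum>e\<in>insert b B. c' e *\<^sub>C e)
          \<and> (\<forall>e\<in>insert b B. cmod (c' e) \<le> R)"
        using insert.hyps by (intro exI[of _ "\<lambda>e. if e = b then t else c e"]) auto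
    qed
  qed
  moreover have "bounded_linear (\<lambda>t. t *\<^sub>C b)"
    by (rule bounded_linear_intro[where K = "norm b"])
      (simp_all add: scaleC_add_left scaleR_scaleC scaleC_scaleC scaleR_conv_of_real norm_scaleC)
  then have "continuous_on A (\<lambda>p. fst p *\<^sub>C b + snd p)" for A :: "(complex \<times> 'a) set"
    by (intro continuous_on_add bounded_linear.continuous_on[of "\<lambda>t. t *\<^sub>C b"]
        continuous_on_fst continuous_on_snd continuous_on_id)
  ultimately show ?case
    using insert.IH by (auto intro!: compact_continuous_image compact_Times simp: case_prod_unfold)
qed simp

lemma bounded_sequence_has_limit_point:
  fixes s :: "nat \<Rightarrow> 'a::complex_hilbert"
  assumes "finite_cdim E" "\<And>n. s n \<in> E" "\<And>n. norm (s n) \<le> R"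
  obtains r l where "strict_mono r" "(s \<circ> r) \<longlonglongrightarrow> l"
proof -
  obtain C where C: "finite C" "E \<subseteq> cspan C"
    using assms(1) by (auto simp: finite_cdim_def)
  obtain B where B: "finite B" "orthonormal B" "cspan B = cspan C"
    using orthonormal_basis_of_span[OF C(1)] by blast
  let ?K = "{\<Sum>e\<in>B. c e *\<^sub>C e | c. \<forall>e\<in>B. cmod (c e) \<le> R}"
  have "s n \<in> ?K" for n
  proof -
    have "s n = fourier_sum B (s n)"
      using assms(2) C(2) B by (intro fourier_sum_eq[symmetric]) auto
    moreover have "cmod (cinner (s n) e) \<le> R" if "e \<in> B" for e
    proof -
      have "cinner e e = 1" using B(2) that by (simp add: orthonormal_def)
      then have "(norm e)\<^sup>2 = 1"
        using Re_cinner_self[of e] by simp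
      then have "norm e = 1"
        by (metis abs_norm_cancel abs_square_eq_1)
      then show ?thesis
        using cinner_cauchy_schwarz[of "s n" e] assms(3)[of n] by simp
    qed
    ultimately show ?thesis
      unfolding fourier_sum_def by blast
  qed
  then have "\<forall>n. s n \<in> ?K" by blast
  moreover have "seq_compact ?K"
    by (intro compact_imp_seq_compact compact_bounded_combinations B(1))
  ultimately show ?thesis
    using that by (meson seq_compactE)
qed

section \<open>Factorising positive operators of finite rank\<close>

lemma positive_op_Re: "positive_op S \<Longrightarrow> 0 \<le> Re (cinner (S x) x)"
  by (auto simp: positive_op_def complex_nonneg_Reals_iff)

lemma positive_op_iff:
  assumes "selfadjoint_op S"
  shows "positive_op S \<longleftrightarrow> (\<forall>x. 0 \<le> Re (cinner (S x) x))"
proof -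
  have "Im (cinner (S x) x) = 0" for x
    using cinner_commute[of "S x" x] selfadjoint_opD(3)[OF assms, of x x]
    by (metis complex_cnj_cancel_iff complex_is_Real_iff Reals_cnj_iff)
  then show ?thesis
    by (auto simp: positive_op_def complex_nonneg_Reals_iff)
qed

text \<open>The usual discriminant argument: the form is nonnegative at \<open>x - c a\<close> for every complex \<open>c\<close>.\<close>

lemma positive_op_cauchy_schwarz:
  assumes S: "selfadjoint_op S" and "positive_op S"
  shows "(cmod (cinner (S x) a))\<^sup>2 \<le> Re (cinner (S a) a) * Re (cinner (S x) x)"
proof -
  define r where "r = Re (cinner (S a) a)"
  define z where "z = cinner x (S a)"
  have z: "cinner (S x) a = z"
    by (simp add: z_def selfadjoint_opD(3)[OF S])
  have "cinner (S a) a = of_real r"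
    using assms(2) by (auto simp: positive_op_def r_def complex_nonneg_Reals_iff complex_eq_iff)
  then have aa: "cinner a (S a) = of_real r"
    by (simp add: selfadjoint_opD(3)[OF S])
  have ax: "cinner a (S x) = cnj z"
    using cinner_commute[of a "S x"] by (simp add: z)
  have q: "0 \<le> Re (cinner (S x) x) - 2 * Re (cnj c * z) + (cmod c)\<^sup>2 * r" for c
  proof -
    have "cinner (S (x - c *\<^sub>C a)) (x - c *\<^sub>C a)
        = cinner (S x) x - (cnj c * z + cnj (cnj c * z)) + c * cnj c * of_real r"
      by (simp add: selfadjoint_opD[OF S] cinner_simps aa ax z_def[symmetric] algebra_simps)
    then have "cinner (S (x - c *\<^sub>C a)) (x - c *\<^sub>C a)
        = cinner (S x) x - of_real (2 * Re (cnj c * z)) + of_real ((cmod c)\<^sup>2 * r)"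
      by (simp only: complex_add_cnj complex_norm_square[symmetric] of_real_mult of_real_power)
    then have "Re (cinner (S (x - c *\<^sub>C a)) (x - c *\<^sub>C a))
        = Re (cinner (S x) x) - 2 * Re (cnj c * z) + (cmod c)\<^sup>2 * r"
      by (simp del: of_real_mult of_real_power)
    then show ?thesis
      using positive_op_Re[OF assms(2)] by metis
  qed
  have zz: "Re (cnj (of_real t * z) * z) = t * (cmod z)\<^sup>2" for t
    unfolding cmod_power2 by (simp add: power2_eq_square algebra_simps)
  show ?thesis
  proof (cases "r = 0")
    case True
    have "z = 0"
    proof (rule ccontr)
      assume "z \<noteq> 0"
      then have n: "(cmod z)\<^sup>2 > 0" by simp
      \<comment> \<open>Without a quadratic term the form is affine in \<open>t\<close>; this \<open>t\<close> gives it the value \<open>-1\<close>.\<close>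
      define t where "t = (Re (cinner (S x) x) + 1) / (2 * (cmod z)\<^sup>2)"
      have "0 \<le> Re (cinner (S x) x) - 2 * (t * (cmod z)\<^sup>2)"
        using q[of "of_real t * z"] zz[of t] True by simp
      also have "2 * (t * (cmod z)\<^sup>2) = Re (cinner (S x) x) + 1"
        using n by (simp add: t_def)
      finally show False by simp
    qed
    then show ?thesis
      by (simp add: z r_def[symmetric] True)
  next
    case False
    then have r: "r > 0"
      using positive_op_Re[OF assms(2), of a] by (simp add: r_def)
    have "0 \<le> Re (cinner (S x) x) - 2 * ((1/r) * (cmod z)\<^sup>2) + (cmod (of_real (1/r) * z))\<^sup>2 * r"
      using q[of "of_real (1/r) * z"] unfolding zz .
    also have "(cmod (of_real (1/r) * z))\<^sup>2 * r = (1/r) * (cmod z)\<^sup>2"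
      using r by (simp add: norm_mult norm_divide power_mult_distrib power_divide power2_eq_square)
    finally have "(cmod z)\<^sup>2 / r \<le> Re (cinner (S x) x)" by simp
    then show ?thesis
      using r by (simp add: z r_def[symmetric] pos_divide_le_eq mult.commute)
  qed
qed

lemma selfadjoint_op_rank_one: "selfadjoint_op (\<lambda>x. cinner x v *\<^sub>C (v :: 'a::complex_hilbert))"
proof -
  have "norm (cinner x v *\<^sub>C v) \<le> norm x * (norm v * norm v)" for x
    using mult_right_mono[OF cinner_cauchy_schwarz[of x v], of "norm v"]
    by (simp add: norm_scaleC mult_ac)
  then show ?thesis
    unfolding selfadjoint_op_def
    by (auto simp: cinner_simps scaleC_add_left scaleC_scaleC cinner_commute[of v, symmetric])
qed

text \<open>One step of a Cholesky decomposition: subtracting the rank-one operator built from \<open>S a\<close> makes \<open>a\<close>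
  a null vector. The Cauchy-Schwarz inequality for the form of \<open>S\<close> says that this keeps \<open>S\<close>
  positive.\<close>

lemma cholesky_step:
  assumes S: "selfadjoint_op S" and pos: "positive_op S"
  obtains c where "positive_op (\<lambda>x. S x - cinner x (c *\<^sub>C S a) *\<^sub>C c *\<^sub>C S a)"
    and "S a = cinner a (c *\<^sub>C S a) *\<^sub>C c *\<^sub>C S a"
proof -
  define r where "r = Re (cinner (S a) a)"
  have aa: "cinner (S a) a = of_real r"
    using pos by (auto simp: positive_op_def r_def complex_nonneg_Reals_iff complex_eq_iff)
  show ?thesis
  proof (cases "r = 0")
    case True
    have "(cmod (cinner (S (S a)) a))\<^sup>2 \<le> 0"
      using positive_op_cauchy_schwarz[OF S pos, of "S a" a] True by (simp add: r_def)
    then have "S a = 0"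
      by (simp add: selfadjoint_opD(3)[OF S] cinner_self)
    then show ?thesis
      using that[of 0] pos by simp
  next
    case False
    then have r: "r > 0"
      using positive_op_Re[OF pos, of a] by (simp add: r_def)
    have rr: "Re (cinner a (S a)) = r"
      by (simp add: r_def selfadjoint_opD(3)[OF S])
    define c :: complex where "c = of_real (1 / sqrt r)"
    have "cnj c * c = of_real ((1 / sqrt r) * (1 / sqrt r))"
      unfolding c_def by (simp only: complex_cnj_complex_of_real of_real_mult)
    also have "(1 / sqrt r) * (1 / sqrt r) = 1 / r"
      using r by simp
    finally have cc: "cnj c * c = of_real (1 / r)" .
    show ?thesis
    proof (rule that[of c])
      have "selfadjoint_op (\<lambda>x. S x - cinner x (c *\<^sub>C S a) *\<^sub>C c *\<^sub>C S a)"
        by (intro selfadjoint_op_diff S selfadjoint_op_rank_one)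
      moreover have "0 \<le> Re (cinner (S x - cinner x (c *\<^sub>C S a) *\<^sub>C c *\<^sub>C S a) x)" for x
      proof -
        have "cinner (S x - cinner x (c *\<^sub>C S a) *\<^sub>C c *\<^sub>C S a) x
            = cinner (S x) x - (cnj c * c) * (cinner x (S a) * cnj (cinner x (S a)))"
          by (simp add: cinner_simps cinner_commute[of "S a" x, symmetric] mult_ac)
        also have "\<dots> = cinner (S x) x - of_real ((cmod (cinner x (S a)))\<^sup>2 / r)"
          unfolding cc complex_norm_square[symmetric] by simp
        finally have "Re (cinner (S x - cinner x (c *\<^sub>C S a) *\<^sub>C c *\<^sub>C S a) x)
            = Re (cinner (S x) x) - (cmod (cinner x (S a)))\<^sup>2 / r"
          by (simp del: of_real_divide of_real_power)
        also have "\<dots> \<ge> 0"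
          using positive_op_cauchy_schwarz[OF S pos, of x a] r
          by (simp add: selfadjoint_opD(3)[OF S] rr pos_divide_le_eq mult.commute)
        finally show ?thesis .
      qed
      ultimately show "positive_op (\<lambda>x. S x - cinner x (c *\<^sub>C S a) *\<^sub>C c *\<^sub>C S a)"
        by (simp add: positive_op_iff)
      have "cinner a (c *\<^sub>C S a) * c = (cnj c * c) * cinner (S a) a"
        by (simp add: cinner_simps selfadjoint_opD(3)[OF S])
      also have "\<dots> = 1"
        using r unfolding cc aa by simp
      finally show "S a = cinner a (c *\<^sub>C S a) *\<^sub>C c *\<^sub>C S a"
        by (simp add: scaleC_scaleC scaleC_one)
    qed
  qed
qed

lemma cholesky_along_family:
  fixes S :: "'a::complex_hilbert \<Rightarrow> 'a"
  assumes S: "selfadjoint_op S" "positive_op S" and "finite A"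
  shows "\<exists>v. selfadjoint_op (\<lambda>x. S x - (\<Sum>e\<in>A. cinner x (v e) *\<^sub>C v e)) \<and>
    positive_op (\<lambda>x. S x - (\<Sum>e\<in>A. cinner x (v e) *\<^sub>C v e)) \<and>
    (\<forall>a\<in>A. S a - (\<Sum>e\<in>A. cinner a (v e) *\<^sub>C v e) = 0) \<and>
    (\<forall>e\<in>A. v e \<in> cspan (range S))"
  using assms(3)
proof (induction A)
  case empty
  then show ?case using S by simp
next
  case (insert a A)
  then obtain v where v: "selfadjoint_op (\<lambda>x. S x - (\<Sum>e\<in>A. cinner x (v e) *\<^sub>C v e))"
      "positive_op (\<lambda>x. S x - (\<Sum>e\<in>A. cinner x (v e) *\<^sub>C v e))"
      "\<And>b. b \<in> A \<Longrightarrow> S b - (\<Sum>e\<in>A. cinner b (v e) *\<^sub>C v e) = 0"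
      "\<And>e. e \<in> A \<Longrightarrow> v e \<in> cspan (range S)"
    by blast
  define R where "R x = S x - (\<Sum>e\<in>A. cinner x (v e) *\<^sub>C v e)" for x
  have R: "selfadjoint_op R" "positive_op R"
    using v(1,2) by (auto simp: R_def[abs_def])
  obtain c where c: "positive_op (\<lambda>x. R x - cinner x (c *\<^sub>C R a) *\<^sub>C c *\<^sub>C R a)"
      "R a = cinner a (c *\<^sub>C R a) *\<^sub>C c *\<^sub>C R a"
    using cholesky_step[OF R] by blast
  define v' where "v' = v(a := c *\<^sub>C R a)"
  have "(\<Sum>e\<in>A. cinner x (v' e) *\<^sub>C v' e) = (\<Sum>e\<in>A. cinner x (v e) *\<^sub>C v e)" for x
    using insert.hyps by (intro sum.cong) (auto simp: v'_def)
  then have eq: "S x - (\<Sum>e\<in>insert a A. cinner x (v' e) *\<^sub>C v' e) = R x - cinner x (c *\<^sub>C R a) *\<^sub>C c *\<^sub>C R a" for x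
    using insert.hyps by (simp add: R_def v'_def)
  have null: "R b - cinner b (c *\<^sub>C R a) *\<^sub>C c *\<^sub>C R a = 0" if "b \<in> insert a A" for b
  proof (cases "b = a")
    case True
    show ?thesis
      unfolding True by (rule right_minus_eq[THEN iffD2]) (rule c(2))
  next
    case False
    then have "R b = 0"
      using that v(3)[of b] by (simp add: R_def)
    moreover have "cinner b (R a) = 0"
      using selfadjoint_opD(3)[OF R(1), of b a] \<open>R b = 0\<close> by simp
    ultimately show ?thesis
      by (simp add: cinner_simps)
  qed
  have "R a \<in> cspan (range S)"
    unfolding R_def
    by (intro complex_vector.span_diff complex_vector.span_sum complex_vector.span_scale v(4))
       (auto intro: complex_vector.span_base)
  then have "c *\<^sub>C R a \<in> cspan (range S)"
    by (rule complex_vector.span_scale)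
  then have ran: "v' e \<in> cspan (range S)" if "e \<in> insert a A" for e
    using that v(4) by (auto simp: v'_def)
  have "selfadjoint_op (\<lambda>x. R x - cinner x (c *\<^sub>C R a) *\<^sub>C c *\<^sub>C R a)"
    by (intro selfadjoint_op_diff R selfadjoint_op_rank_one)
  with c(1) null ran show ?case
    by (intro exI[of _ v'] conjI ballI) (simp_all only: eq)
qed

definition clinear_map :: "('a::complex_vector \<Rightarrow> 'b::complex_vector) \<Rightarrow> bool"
  where "clinear_map A \<longleftrightarrow> (\<forall>x y. A (x + y) = A x + A y) \<and> (\<forall>c x. A (c *\<^sub>C x) = c *\<^sub>C A x)"

lemma clinear_mapD:
  assumes "clinear_map A"
  shows "A (x + y) = A x + A y" "A (c *\<^sub>C x) = c *\<^sub>C A x" "A 0 = 0" "A (x - y) = A x - A y"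
    "A (\<Sum>i\<in>I. f i) = (\<Sum>i\<in>I. A (f i))"
proof -
  show 1: "A (x + y) = A x + A y" and 2: "A (c *\<^sub>C x) = c *\<^sub>C A x" for x y c
    using assms by (auto simp: clinear_map_def)
  show 0: "A 0 = 0" using 1[of 0 0] by simp
  show "A (x - y) = A x - A y"
    using 1[of x "(-1) *\<^sub>C y"] 2[of "-1" y] by (simp add: scaleC_minus1)
  show "A (\<Sum>i\<in>I. f i) = (\<Sum>i\<in>I. A (f i))"
    by (induction I rule: infinite_finite_induct) (simp_all add: 0 1)
qed

lemma clinear_map_span:
  assumes "clinear_map A" "x \<in> cspan B"
  shows "A x \<in> cspan (A ` B)"
  using assms(2)
  by (induction rule: complex_vector.span_induct_alt)
    (auto simp: clinear_mapD[OF assms(1)] complex_vector.span_zero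
      intro!: complex_vector.span_add complex_vector.span_scale intro: complex_vector.span_base)

text \<open>After a Cholesky decomposition along an orthonormal basis \<open>B\<close> of \<open>E\<close> nothing is left, so
  \<open>S = (\<Sum>e\<in>B. v e \<otimes> v e)\<close>. Sending \<open>x\<close> to the coordinates \<open>\<langle>x, v e\<rangle>\<close> in the basis \<open>B\<close> then replaces the square
  root of \<open>S\<close>.\<close>

lemma finite_rank_factorization:
  fixes S :: "'a::complex_hilbert \<Rightarrow> 'a"
  assumes S: "selfadjoint_op S" "positive_op S"
    and E: "complex_vector.subspace E" "finite_cdim E" "range S \<subseteq> E"
  obtains D where "clinear_map D" "range D \<subseteq> E" "\<And>x y. cinner (D x) (D y) = cinner (S x) y"
proof -
  obtain B where B: "finite B" "orthonormal B" "cspan B = E"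
    using finite_cdim_orthonormal_basis[OF E(1,2)] by blast
  obtain v where v: "selfadjoint_op (\<lambda>x. S x - (\<Sum>e\<in>B. cinner x (v e) *\<^sub>C v e))"
      "\<And>b. b \<in> B \<Longrightarrow> S b - (\<Sum>e\<in>B. cinner b (v e) *\<^sub>C v e) = 0"
      "\<And>e. e \<in> B \<Longrightarrow> v e \<in> cspan (range S)"
    using cholesky_along_family[OF S B(1)] by blast
  have SE: "cspan (range S) \<subseteq> E"
    using E by (intro complex_vector.span_minimal) auto
  have Sx: "S x = (\<Sum>e\<in>B. cinner x (v e) *\<^sub>C v e)" for x
  proof -
    let ?R = "\<lambda>x. S x - (\<Sum>e\<in>B. cinner x (v e) *\<^sub>C v e)"
    have "?R x \<in> cspan B"
      unfolding B(3) using E v(3) SE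
      by (intro complex_vector.subspace_diff complex_vector.subspace_sum complex_vector.subspace_scale) auto
    moreover have "cinner (?R x) e = 0" if "e \<in> B" for e
      using selfadjoint_opD(3)[OF v(1), of x e] v(2)[OF that] by simp
    ultimately have "cinner (?R x) (?R x) = 0"
      using cinner_span_zero by blast
    then show ?thesis by (simp add: cinner_self)
  qed
  define D where "D x = (\<Sum>e\<in>B. cinner x (v e) *\<^sub>C e)" for x
  show ?thesis
  proof (rule that[of D])
    show "clinear_map D"
      by (auto simp: clinear_map_def D_def cinner_simps scaleC_add_left sum.distrib
          complex_vector.scale_sum_right scaleC_scaleC)
    show "range D \<subseteq> E"
      unfolding B(3)[symmetric] D_def
      by (auto intro!: complex_vector.span_sum complex_vector.span_scale intro: complex_vector.span_base)
    show "cinner (D x) (D y) = cinner (S x) y" for x y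
    proof -
      have "cinner e (D y) = cnj (cinner y (v e))" if "e \<in> B" for e
      proof -
        have "cinner e (D y) = (\<Sum>b\<in>B. cnj (cinner y (v b)) * (if e = b then 1 else 0))"
          unfolding D_def cinner_sum_right using B(2) that
          by (intro sum.cong) (auto simp: cinner_simps orthonormal_def)
        also have "\<dots> = cnj (cinner y (v e))"
          using B(1) that by (simp add: if_distrib[of "(*) _"] sum.delta cong: if_cong)
        finally show ?thesis .
      qed
      then have "cinner (D x) (D y) = (\<Sum>e\<in>B. cinner x (v e) * cnj (cinner y (v e)))"
        by (subst D_def) (simp add: cinner_sum_left cinner_simps)
      also have "\<dots> = cinner (S x) y"
        unfolding Sx cinner_sum_left cinner_scaleC_left
        by (intro sum.cong refl) (metis cinner_commute)
      finally show ?thesis .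
    qed
  qed
qed

section \<open>Extending isometries\<close>

instantiation prod :: (complex_vector, complex_vector) complex_vector
begin

definition scaleC_prod :: "complex \<Rightarrow> 'a \<times> 'b \<Rightarrow> 'a \<times> 'b"
  where "scaleC_prod c p = (c *\<^sub>C fst p, c *\<^sub>C snd p)"

instance
  by standard (simp_all add: scaleC_prod_def scaleC_add_right scaleC_add_left scaleC_scaleC scaleC_one)

end

instantiation prod :: (complex_hilbert, complex_hilbert) complex_hilbert
begin

definition cinner_prod :: "'a \<times> 'b \<Rightarrow> 'a \<times> 'b \<Rightarrow> complex"
  where "cinner_prod p q = cinner (fst p) (fst q) + cinner (snd p) (snd q)"

instance
proof
  fix p q :: "'a \<times> 'b"
  show "cinner q p = cnj (cinner p q)"
    using cinner_commute[of "fst q" "fst p"] cinner_commute[of "snd q" "snd p"]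
    by (simp add: cinner_prod_def)
qed (simp_all add: scaleC_prod_def cinner_prod_def scaleR_prod_def scaleR_scaleC cinner_simps
    inner_prod_def inner_eq_Re_cinner algebra_simps)

end

lemma scaleC_Pair: "c *\<^sub>C (x, y) = (c *\<^sub>C x, c *\<^sub>C y)"
  by (simp add: scaleC_prod_def)

lemma cinner_Pair: "cinner (x, y) (x', y') = cinner x x' + cinner y y'"
  by (simp add: cinner_prod_def)

lemma norm_Pair_squared: "(norm (p :: 'a::complex_hilbert \<times> 'b::complex_hilbert))\<^sup>2 = (norm (fst p))\<^sup>2 + (norm (snd p))\<^sup>2"
  by (simp add: norm_prod_def)

definition linear_isometry :: "('a::complex_hilbert \<Rightarrow> 'b::complex_hilbert) \<Rightarrow> bool"
  where "linear_isometry V \<longleftrightarrow> clinear_map V \<and> (\<forall>x. norm (V x) = norm x)"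

lemma linear_isometry_cinner:
  assumes "linear_isometry V"
  shows "cinner (V x) (V y) = cinner x y"
proof -
  have V: "clinear_map V" "\<And>x. norm (V x) = norm x"
    using assms by (auto simp: linear_isometry_def)
  have "4 * cinner (V x) (V y) = 4 * cinner x y"
    unfolding polarization_identity
    by (simp only: clinear_mapD(1,2,4)[OF V(1), symmetric] V(2))
  then show ?thesis by simp
qed

text \<open>A complex Householder reflection. The coefficient is determined by \<open>W b = a\<close>, and it gives an
  isometry because \<open>\<langle>a, u\<rangle>\<close> and \<open>\<langle>b, u\<rangle>\<close> have the same modulus for \<open>u = a - b\<close>.\<close>

lemma householder:
  fixes a b :: "'a::complex_hilbert"
  assumes ab: "norm a = norm b"
  obtains W where "linear_isometry W" "W b = a" "\<And>x. cinner x (a - b) = 0 \<Longrightarrow> W x = x"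
    "\<And>x. \<exists>c. W x = x + c *\<^sub>C (a - b)"
proof -
  define u where "u = a - b"
  define s where "s = cinner b u"
  have aa: "cinner a a = cinner b b"
    by (simp add: cinner_self ab)
  have su: "cinner u u = - s - cnj s"
    using cinner_commute[of a b] cinner_commute[of b a]
    by (simp add: s_def u_def cinner_simps aa cinner_commute[of b b, symmetric])
  show ?thesis
  proof (cases "s = 0")
    case True
    then have "a = b"
      using su by (simp add: cinner_self u_def)
    then show ?thesis
      by (intro that[of id]) (auto simp: linear_isometry_def clinear_map_def intro!: exI[of _ 0])
  next
    case False
    define W where "W x = x + (cinner x u / s) *\<^sub>C u" for x
    have "linear_isometry W"
      unfolding linear_isometry_def clinear_map_def
    proof (intro conjI allI)
      show "W (x + y) = W x + W y" for x y
        by (simp add: W_def cinner_simps add_divide_distrib scaleC_add_left)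
      show "W (c *\<^sub>C x) = c *\<^sub>C W x" for c x
        by (simp add: W_def cinner_simps scaleC_add_right scaleC_scaleC)
      show "norm (W x) = norm x" for x
      proof -
        define z where "z = cinner x u"
        have zc: "cinner u x = cnj z"
          unfolding z_def by (rule cinner_commute)
        have "cinner (W x) (W x) = cinner x x + (cnj (z / s) * z + (z / s) * cnj z + (z / s) * cnj (z / s) * cinner u u)"
          by (simp add: W_def cinner_simps zc z_def[symmetric] algebra_simps)
        also have "cnj (z / s) * z + (z / s) * cnj z + (z / s) * cnj (z / s) * cinner u u = 0"
          unfolding su using False by (simp add: field_simps)
        finally have "cinner (W x) (W x) = cinner x x" by simp
        then have "(norm (W x))\<^sup>2 = (norm x)\<^sup>2"
          by (metis Re_cinner_self)
        then show ?thesis by simp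
      qed
    qed
    moreover have "W b = b + u"
      using False by (simp add: W_def s_def[symmetric] scaleC_one)
    then have "W b = a"
      by (simp add: u_def)
    ultimately show ?thesis
      by (intro that[of W]) (auto simp: W_def u_def[symmetric])
  qed
qed

text \<open>Each vector is moved to its place by a reflection fixing the vectors already placed; equality of
  the Gram matrices says that they are orthogonal to the mirror direction.\<close>

lemma finite_gram_isometry:
  fixes f g :: "'i \<Rightarrow> 'a::complex_hilbert"
  assumes "finite I" and M: "complex_vector.subspace M"
    and "\<And>i. i \<in> I \<Longrightarrow> f i \<in> M" "\<And>i. i \<in> I \<Longrightarrow> g i \<in> M"
    and "\<And>i j. i \<in> I \<Longrightarrow> j \<in> I \<Longrightarrow> cinner (f i) (f j) = cinner (g i) (g j)"
  shows "\<exists>V. linear_isometry V \<and> (\<forall>i\<in>I. V (f i) = g i) \<and> (\<forall>x\<in>M. V x \<in> M)"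
  using assms(1,3-)
proof (induction I)
  case empty
  show ?case
    by (intro exI[of _ id]) (simp add: linear_isometry_def clinear_map_def)
next
  case (insert k I)
  then obtain V where V: "linear_isometry V" "\<And>i. i \<in> I \<Longrightarrow> V (f i) = g i" "\<And>x. x \<in> M \<Longrightarrow> V x \<in> M"
    by auto
  define a where "a = g k"
  define b where "b = V (f k)"
  have "cinner (f k) (f k) = cinner (g k) (g k)"
    using insert.prems(3) by blast
  then have "(norm (f k))\<^sup>2 = (norm a)\<^sup>2"
    unfolding a_def by (metis Re_cinner_self)
  then have "norm a = norm b"
    using V(1) by (simp add: b_def linear_isometry_def)
  then obtain W where W: "linear_isometry W" "W b = a" "\<And>x. cinner x (a - b) = 0 \<Longrightarrow> W x = x"
      "\<And>x. \<exists>c. W x = x + c *\<^sub>C (a - b)"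
    using householder by blast
  have abM: "a - b \<in> M"
    using insert.prems V(3) M by (auto simp: a_def b_def intro!: complex_vector.subspace_diff)
  show ?case
  proof (intro exI[of _ "W \<circ> V"] conjI ballI)
    show "linear_isometry (W \<circ> V)"
      using V(1) W(1) by (simp add: linear_isometry_def clinear_map_def)
    show "(W \<circ> V) x \<in> M" if "x \<in> M" for x
    proof -
      obtain c where c: "W (V x) = V x + c *\<^sub>C (a - b)"
        using W(4) by blast
      show ?thesis
        unfolding o_def c
        using V(3)[OF that] abM M complex_vector.subspace_add complex_vector.subspace_scale by blast
    qed
    show "(W \<circ> V) (f i) = g i" if "i \<in> insert k I" for i
    proof (cases "i = k")
      case True
      then show ?thesis using W(2) by (simp add: a_def b_def)
    next
      case False
      then have i: "i \<in> I" using that by blast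
      have "cinner (g i) b = cinner (f i) (f k)"
        unfolding b_def V(2)[OF i, symmetric] by (rule linear_isometry_cinner[OF V(1)])
      also have "\<dots> = cinner (g i) a"
        using insert.prems(3)[of i k] i by (simp add: a_def)
      finally have "cinner (g i) (a - b) = 0"
        by (simp add: cinner_simps)
      then show ?thesis
        using W(3) V(2)[OF i] by simp
    qed
  qed
qed

text \<open>A basis of the range of \<open>f\<close> has a finite Gram matrix, which \<open>g\<close> preserves; equal norms make the
  value of \<open>g\<close> depend on that of \<open>f\<close> only.\<close>

lemma isometry_extension:
  fixes f g :: "'h::complex_vector \<Rightarrow> 'a::complex_hilbert"
  assumes f: "clinear_map f" and g: "clinear_map g"
    and M: "complex_vector.subspace M" "finite_cdim M" "range f \<subseteq> M" "range g \<subseteq> M"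
    and norm: "\<And>x. norm (f x) = norm (g x)"
  obtains V where "linear_isometry V" "\<And>x. V (f x) = g x" "\<And>x. x \<in> M \<Longrightarrow> V x \<in> M"
proof -
  have "complex_vector.subspace (range f)"
    unfolding complex_vector.subspace_def
    by (auto simp: image_iff) (metis clinear_mapD(1-3)[OF f])+
  moreover have "finite_cdim (range f)"
    using M(2,3) unfolding finite_cdim_def by blast
  ultimately obtain B where B: "finite B" "B \<subseteq> range f" "cspan B = range f"
    using finite_cdim_basis by metis
  obtain p where p: "\<And>b. b \<in> B \<Longrightarrow> f (p b) = b"
    using B(2) by (metis f_inv_into_f subset_iff)
  have gram: "cinner (f x) (f y) = cinner (g x) (g y)" for x y
  proof -
    have "4 * cinner (f x) (f y) = 4 * cinner (g x) (g y)"
      unfolding polarization_identity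
      by (simp only: clinear_mapD(1,2,4)[OF f, symmetric] clinear_mapD(1,2,4)[OF g, symmetric] norm)
    then show ?thesis by simp
  qed
  have "\<exists>V. linear_isometry V \<and> (\<forall>b\<in>B. V (f (p b)) = g (p b)) \<and> (\<forall>x\<in>M. V x \<in> M)"
    using M(3,4) by (intro finite_gram_isometry B(1) M(1)) (auto simp: gram)
  then obtain V where V: "linear_isometry V" "\<And>b. b \<in> B \<Longrightarrow> V b = g (p b)" "\<And>x. x \<in> M \<Longrightarrow> V x \<in> M"
    using p by metis
  have lin: "clinear_map V"
    using V(1) by (simp add: linear_isometry_def)
  have "\<exists>h. f h = y \<and> V y = g h" if "y \<in> cspan B" for y
    using that
  proof (induction rule: complex_vector.span_induct_alt)
    case base
    show ?case
      by (intro exI[of _ 0]) (simp add: clinear_mapD[OF f] clinear_mapD[OF g] clinear_mapD[OF lin])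
  next
    case (step c x y)
    then obtain h where "f h = y" "V y = g h" by blast
    then show ?case
      using p[OF step(1)] V(2)[OF step(1)]
      by (intro exI[of _ "c *\<^sub>C p x + h"])
        (simp add: clinear_mapD[OF f] clinear_mapD[OF g] clinear_mapD[OF lin])
  qed
  moreover have "g h = g x" if "f h = f x" for h x
    using norm[of "h - x"] that by (simp add: clinear_mapD[OF f] clinear_mapD[OF g])
  ultimately have "V (f x) = g x" for x
    by (metis B(3) rangeI)
  then show ?thesis
    using that V by blast
qed

lemma subspace_Times:
  assumes "complex_vector.subspace E" "complex_vector.subspace F"
  shows "complex_vector.subspace (E \<times> F)"
  using assms by (auto simp: complex_vector.subspace_def scaleC_Pair zero_prod_def)

lemma finite_cdim_Times:
  fixes E :: "'a::complex_vector set" and F :: "'b::complex_vector set"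
  assumes "finite_cdim E" "finite_cdim F"
  shows "finite_cdim (E \<times> F)"
proof -
  obtain B C where BC: "finite B" "E \<subseteq> cspan B" "finite C" "F \<subseteq> cspan C"
    using assms by (auto simp: finite_cdim_def)
  let ?G = "(\<lambda>x. (x, 0)) ` B \<union> (\<lambda>y. (0, y)) ` C"
  have lin: "clinear_map (\<lambda>x :: 'a. (x, 0 :: 'b))" "clinear_map (\<lambda>y :: 'b. (0 :: 'a, y))"
    by (simp_all add: clinear_map_def scaleC_Pair)
  have 1: "(x, 0) \<in> cspan ?G" if "x \<in> cspan B" for x
    using clinear_map_span[OF lin(1) that] complex_vector.span_mono[of _ ?G] by blast
  have 2: "(0, y) \<in> cspan ?G" if "y \<in> cspan C" for y
    using clinear_map_span[OF lin(2) that] complex_vector.span_mono[of _ ?G] by blast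
  have "E \<times> F \<subseteq> cspan ?G"
  proof clarify
    fix x y assume "x \<in> E" "y \<in> F"
    then have "(x, 0) + (0, y) \<in> cspan ?G"
      using BC by (intro complex_vector.span_add 1 2) auto
    then show "(x, y) \<in> cspan ?G" by simp
  qed
  then show ?thesis
    using BC(1,3) unfolding finite_cdim_def by (intro exI[of _ ?G]) simp
qed

section \<open>Isometric colligations and their transfer functions\<close>

text \<open>An isometry of \<open>E \<times> F\<close> is one time step of a system with input and output in \<open>E\<close> and state in \<open>F\<close>:
  \<open>V (x\<^sub>j, y\<^sub>j) = (w\<^sub>j, y\<^sub>j\<^sub>+\<^sub>1)\<close>. Letting \<open>V\<close> act on the ambient space makes the maps derived from it total.\<close>

locale isometric_colligation =
  fixes V :: "'a::complex_hilbert \<times> 'a \<Rightarrow> 'a \<times> 'a" and E F B :: "'a set"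
  assumes isometry: "linear_isometry V"
    and basis: "finite B" "orthonormal B" "cspan B = E"
    and F: "complex_vector.subspace F" "finite_cdim F"
    and invariant: "p \<in> E \<times> F \<Longrightarrow> V p \<in> E \<times> F"
begin

lemma subspace_E: "complex_vector.subspace E"
  using basis(3) complex_vector.subspace_span by blast

lemma zero_in: "0 \<in> E" "0 \<in> F"
  using subspace_E F(1) by (auto simp: complex_vector.subspace_def)

lemma V_clinear: "clinear_map V"
  using isometry by (simp add: linear_isometry_def)

lemma V_norm: "(norm (fst (V (x, y))))\<^sup>2 + (norm (snd (V (x, y))))\<^sup>2 = (norm x)\<^sup>2 + (norm y)\<^sup>2"
  using isometry norm_Pair_squared[of "V (x, y)"] norm_Pair_squared[of "(x, y)"]
  by (simp add: linear_isometry_def)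

lemma V_contracts:
  "norm (fst (V (x, 0))) \<le> norm x" "norm (snd (V (x, 0))) \<le> norm x"
  "norm (fst (V (0, y))) \<le> norm y" "norm (snd (V (0, y))) \<le> norm y"
proof -
  have "a \<le> c" "b \<le> c" if "a\<^sup>2 + b\<^sup>2 = c\<^sup>2" "0 \<le> c" for a b c :: real
  proof -
    have "a\<^sup>2 \<le> c\<^sup>2" "b\<^sup>2 \<le> c\<^sup>2"
      using that(1) zero_le_power2[of a] zero_le_power2[of b] by linarith+
    then show "a \<le> c" "b \<le> c"
      using that(2) power2_le_imp_le by blast+
  qed
  note * = this
  show "norm (fst (V (x, 0))) \<le> norm x" "norm (snd (V (x, 0))) \<le> norm x"
    using V_norm[of x 0] by (auto intro: *)
  show "norm (fst (V (0, y))) \<le> norm y" "norm (snd (V (0, y))) \<le> norm y"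
    using V_norm[of 0 y] by (auto intro: *)
qed

lemma V_add: "V (x + x', y + y') = V (x, y) + V (x', y')"
  using clinear_mapD(1)[OF V_clinear, of "(x, y)" "(x', y')"] by simp

lemma V_scaleC: "V (c *\<^sub>C x, c *\<^sub>C y) = c *\<^sub>C V (x, y)"
  using clinear_mapD(2)[OF V_clinear, of c "(x, y)"] by (simp add: scaleC_Pair)

lemma V_split: "V (x, y) = V (x, 0) + V (0, y)"
  using V_add[of x 0 0 y] by simp

definition trans :: "'a \<Rightarrow> 'a" where "trans y = snd (V (0, y))"

definition inject :: "'a \<Rightarrow> 'a" where "inject x = snd (V (x, 0))"

primrec state :: "(nat \<Rightarrow> 'a) \<Rightarrow> nat \<Rightarrow> 'a" where
  "state x 0 = 0"
| "state x (Suc j) = snd (V (x j, state x j))"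

definition response :: "(nat \<Rightarrow> 'a) \<Rightarrow> nat \<Rightarrow> 'a"
  where "response x j = fst (V (x j, state x j))"

text \<open>The output at time \<open>n\<close> after the impulse \<open>x\<close> at time \<open>0\<close>.\<close>

definition markov :: "nat \<Rightarrow> 'a \<Rightarrow> 'a"
  where "markov n x = (case n of 0 \<Rightarrow> fst (V (x, 0)) | Suc i \<Rightarrow> fst (V (0, (trans ^^ i) (inject x))))"

lemma V_state: "V (x j, state x j) = (response x j, state x (Suc j))"
  by (simp add: response_def)

lemma contraction_trans: "contraction_op trans"
  unfolding contraction_op_def
proof (intro conjI allI)
  show "trans (x + y) = trans x + trans y" for x y
    using V_add[of 0 0 x y] by (simp add: trans_def)
  show "trans (c *\<^sub>C x) = c *\<^sub>C trans x" for c x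
    using V_scaleC[of c 0 x] by (simp add: trans_def scaleC_prod_def)
  show "norm (trans x) \<le> norm x" for x
    unfolding trans_def by (rule V_contracts)
qed

lemma contraction_inject: "contraction_op inject"
  unfolding contraction_op_def
proof (intro conjI allI)
  show "inject (x + y) = inject x + inject y" for x y
    using V_add[of x y 0 0] by (simp add: inject_def)
  show "inject (c *\<^sub>C x) = c *\<^sub>C inject x" for c x
    using V_scaleC[of c x 0] by (simp add: inject_def scaleC_prod_def)
  show "norm (inject x) \<le> norm x" for x
    unfolding inject_def by (rule V_contracts)
qed

lemma contraction_readout: "contraction_op (\<lambda>y. fst (V (0, y)))"
  using V_contracts(3) V_add[of 0 0] V_scaleC[of _ 0] by (simp add: contraction_op_def scaleC_prod_def)

lemma contraction_markov: "contraction_op (markov n)"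
proof (cases n)
  case 0
  have "norm (fst (V (x, 0))) \<le> norm x" for x
    by (rule V_contracts)
  then show ?thesis
    using V_add[of _ _ 0 0] V_scaleC[of _ _ 0]
    by (simp add: 0 markov_def contraction_op_def scaleC_prod_def)
next
  case (Suc i)
  have "contraction_op ((\<lambda>y. fst (V (0, y))) \<circ> ((trans ^^ i) \<circ> inject))"
    by (intro contraction_readout contraction_op_comp contraction_op_funpow contraction_trans contraction_inject)
  moreover have "markov n = (\<lambda>y. fst (V (0, y))) \<circ> ((trans ^^ i) \<circ> inject)"
    by (simp add: Suc markov_def fun_eq_iff)
  ultimately show ?thesis
    by simp
qed

lemma inject_in_F: "x \<in> E \<Longrightarrow> inject x \<in> F"
  using invariant[of "(x, 0)"] zero_in by (auto simp: inject_def mem_Times_iff)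

lemma trans_in_F: "y \<in> F \<Longrightarrow> trans y \<in> F"
  using invariant[of "(0, y)"] zero_in by (auto simp: trans_def mem_Times_iff)

lemma trans_pow_in_F: "y \<in> F \<Longrightarrow> (trans ^^ n) y \<in> F"
  by (induction n) (auto intro: trans_in_F)

lemma markov_in_E: "x \<in> E \<Longrightarrow> markov n x \<in> E"
  using invariant[of "(x, 0)"] invariant[of "(0, (trans ^^ (n - 1)) (inject x))"] zero_in
    trans_pow_in_F[OF inject_in_F, of x "n - 1"]
  by (cases n) (auto simp: markov_def mem_Times_iff)

text \<open>The isometry of \<open>V\<close>, summed over the first \<open>n\<close> steps.\<close>

lemma energy_balance: "(\<Sum>j<n. (norm (response x j))\<^sup>2) + (norm (state x n))\<^sup>2 = (\<Sum>j<n. (norm (x j))\<^sup>2)"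
proof (induction n)
  case (Suc n)
  then show ?case
    using V_norm[of "x n" "state x n"] by (simp add: response_def)
qed simp

lemma state_add: "state (\<lambda>j. x j + y j) n = state x n + state y n"
  by (induction n) (simp_all add: V_add)

lemma state_cong: "(\<And>j. j < n \<Longrightarrow> x j = y j) \<Longrightarrow> state x n = state y n"
  by (induction n) auto

lemma state_convolution: "state x n = (\<Sum>i<n. (trans ^^ i) (inject (x (n - Suc i))))"
proof (induction n)
  case (Suc n)
  have "state x (Suc n) = inject (x n) + trans (state x n)"
    using V_split[of "x n" "state x n"] by (simp add: inject_def trans_def)
  also have "\<dots> = inject (x n) + (\<Sum>i<n. (trans ^^ Suc i) (inject (x (n - Suc i))))"
    unfolding Suc.IH by (simp add: contraction_op_sum[OF contraction_trans])
  also have "\<dots> = (\<Sum>i<Suc n. (trans ^^ i) (inject (x (Suc n - Suc i))))"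
    by (subst sum.lessThan_Suc_shift) simp
  finally show ?case .
qed simp

lemma response_convolution: "response x n = (\<Sum>i\<le>n. markov i (x (n - i)))"
proof -
  note lin = contraction_op_sum[OF contraction_readout]
  have "response x n = fst (V (x n, 0)) + fst (V (0, state x n))"
    using V_split[of "x n" "state x n"] by (simp add: response_def)
  also have "\<dots> = markov 0 (x n) + (\<Sum>i<n. markov (Suc i) (x (n - Suc i)))"
    unfolding state_convolution by (simp add: lin markov_def)
  also have "\<dots> = (\<Sum>i<Suc n. markov i (x (n - i)))"
    by (subst sum.lessThan_Suc_shift) simp
  finally show ?thesis
    by (simp add: lessThan_Suc_atMost)
qed

text \<open>A vector on which \<open>trans\<close> is isometric produces no output, and the isometry then makes it
  orthogonal to whatever is injected later. Applied to a limit point \<open>l\<close> of \<open>trans\<^sup>n (inject x)\<close>, which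
  recurs up to a small error, this gives \<open>l \<bottom> l\<close>: no energy stays in the state forever.\<close>

lemma trans_isometric_orthogonal:
  assumes v: "\<And>k. norm ((trans ^^ k) v) = norm v" and "m < j"
  shows "cinner ((trans ^^ j) v) ((trans ^^ m) (inject x)) = 0"
proof -
  have step: "cinner (trans w) (snd (V (x', y))) = cinner w y" if "norm (trans w) = norm w" for w x' y
  proof -
    have "fst (V (0, w)) = 0"
      using V_norm[of 0 w] that by (simp add: trans_def)
    then have "cinner (V (0, w)) (V (x', y)) = cinner (trans w) (snd (V (x', y)))"
      by (simp add: cinner_prod_def trans_def)
    then show ?thesis
      using linear_isometry_cinner[OF isometry, of "(0, w)" "(x', y)"] by (simp add: cinner_Pair)
  qed
  have nrm: "norm (trans ((trans ^^ k) v)) = norm ((trans ^^ k) v)" for k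
    using v[of "Suc k"] v[of k] by simp
  show ?thesis
    using \<open>m < j\<close>
  proof (induction m arbitrary: j)
    case 0
    then obtain k where k: "j = Suc k" by (cases j) auto
    have "cinner (trans ((trans ^^ k) v)) (snd (V (x, 0))) = cinner ((trans ^^ k) v) 0"
      by (rule step[OF nrm])
    then show ?case
      by (simp add: k inject_def)
  next
    case (Suc m)
    then obtain k where k: "j = Suc k" by (cases j) auto
    have "cinner (trans ((trans ^^ k) v)) (trans ((trans ^^ m) (inject x)))
        = cinner ((trans ^^ k) v) ((trans ^^ m) (inject x))"
      unfolding trans_def[of "(trans ^^ m) (inject x)"] by (rule step[OF nrm])
    then show ?case
      using Suc by (simp add: k)
  qed
qed

lemma impulse_state_tendsto_0:
  assumes x: "x \<in> E"
  shows "(\<lambda>n. (trans ^^ n) (inject x)) \<longlonglongrightarrow> 0"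
proof -
  define s where "s n = (trans ^^ n) (inject x)" for n
  have con: "contraction_op (trans ^^ n)" for n
    by (intro contraction_op_funpow contraction_trans)
  have s_add: "s (j + n) = (trans ^^ j) (s n)" for j n
    by (simp add: s_def funpow_add)
  have bound: "norm (s n) \<le> norm x" for n
    using contraction_opD(3)[OF con, of n "inject x"] contraction_opD(3)[OF contraction_inject, of x]
    by (simp add: s_def)
  have "s n \<in> F" for n
    using trans_pow_in_F[OF inject_in_F[OF x]] by (simp add: s_def)
  then obtain r l where r: "strict_mono r" "(s \<circ> r) \<longlonglongrightarrow> l"
    using bounded_sequence_has_limit_point[OF F(2), of s "norm x"] bound by blast
  have "decseq (\<lambda>n. norm (s n))"
    using s_add[of 1] contraction_opD(3)[OF contraction_trans] by (intro decseq_SucI) simp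
  then obtain L where L: "(\<lambda>n. norm (s n)) \<longlonglongrightarrow> L"
    using decseq_convergent[of "\<lambda>n. norm (s n)" 0] by auto
  \<comment> \<open>The norms of \<open>s n\<close> decrease to \<open>L\<close> along every subsequence, so \<open>trans\<close> is isometric on the orbit of \<open>l\<close>.\<close>
  have lim_shift: "norm ((trans ^^ k) l) = L" for k
  proof (rule LIMSEQ_unique)
    have "(\<lambda>n. (trans ^^ k) (s (r n))) \<longlonglongrightarrow> (trans ^^ k) l"
      using r(2) by (intro bounded_linear.tendsto[OF contraction_op_bounded_linear[OF con]]) (simp add: o_def)
    then show "(\<lambda>n. norm (s (k + r n))) \<longlonglongrightarrow> norm ((trans ^^ k) l)"
      unfolding s_add by (rule tendsto_norm)
    have "filterlim (\<lambda>n. k + r n) at_top sequentially"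
      by (rule filterlim_at_top_mono[OF filterlim_subseq[OF r(1)]]) simp
    then show "(\<lambda>n. norm (s (k + r n))) \<longlonglongrightarrow> L"
      by (rule filterlim_compose[OF L])
  qed
  have lk: "norm ((trans ^^ k) l) = norm l" for k
    using lim_shift[of k] lim_shift[of 0] by simp
  have small: "cmod (cinner l (s (r n))) \<le> norm (s (r n) - l) * norm x" for n
  proof (rule LIMSEQ_le_const2)
    show "(\<lambda>i. cmod (cinner (s (r i)) (s (r n)))) \<longlonglongrightarrow> cmod (cinner l (s (r n)))"
      using r(2) by (intro tendsto_intros) (simp_all add: o_def)
    \<comment> \<open>The gap \<open>r i - r n\<close> has to exceed \<open>r n\<close> for the orthogonality lemma to apply.\<close>
    have "cmod (cinner (s (r i)) (s (r n))) \<le> norm (s (r n) - l) * norm x" if "i > 2 * r n" for i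
    proof -
      define j where "j = r i - r n"
      have "r i > 2 * r n"
        using that seq_suble[OF r(1), of i] by simp
      then have j: "r i = j + r n" "r n < j"
        by (auto simp: j_def)
      have "cinner ((trans ^^ j) l) (s (r n)) = 0"
        unfolding s_def by (rule trans_isometric_orthogonal[OF lk j(2)])
      then have "cinner (s (r i)) (s (r n)) = cinner ((trans ^^ j) (s (r n) - l)) (s (r n))"
        by (simp add: j(1) s_add contraction_opD[OF con] cinner_simps)
      also have "cmod \<dots> \<le> norm ((trans ^^ j) (s (r n) - l)) * norm (s (r n))"
        by (rule cinner_cauchy_schwarz)
      also have "\<dots> \<le> norm (s (r n) - l) * norm x"
        by (intro mult_mono contraction_opD(3)[OF con] bound) auto
      finally show ?thesis .
    qed
    then show "\<exists>N. \<forall>i\<ge>N. cmod (cinner (s (r i)) (s (r n))) \<le> norm (s (r n) - l) * norm x"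
      by (intro exI[of _ "Suc (2 * r n)"]) auto
  qed
  have "cmod (cinner l l) \<le> norm (l - l) * norm x"
  proof (rule LIMSEQ_le)
    show "(\<lambda>n. cmod (cinner l (s (r n)))) \<longlonglongrightarrow> cmod (cinner l l)"
      "(\<lambda>n. norm (s (r n) - l) * norm x) \<longlonglongrightarrow> norm (l - l) * norm x"
      using r(2) unfolding o_def by (intro tendsto_intros; assumption)+
    show "\<exists>N. \<forall>n\<ge>N. cmod (cinner l (s (r n))) \<le> norm (s (r n) - l) * norm x"
      using small by blast
  qed
  then have "l = 0"
    by (simp add: cinner_self)
  then have "(\<lambda>n. norm (s n)) \<longlonglongrightarrow> 0"
    using L lim_shift[of 0] by simp
  then show ?thesis
    using tendsto_norm_zero_iff unfolding s_def by blast
qed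

text \<open>Cut the input at a time \<open>M\<close> after which little energy arrives. What arrives later contributes little
  to the state, and what arrived before is a finite sum of decaying impulse responses.\<close>

lemma state_tendsto_0:
  assumes x: "\<And>j. x j \<in> E" and summable: "summable (\<lambda>j. (norm (x j))\<^sup>2)"
  shows "state x \<longlonglongrightarrow> 0"
proof (rule LIMSEQ_I)
  fix e :: real assume e: "0 < e"
  obtain M where M: "\<And>n. (\<Sum>j=M..<n. (norm (x j))\<^sup>2) < (e/2)\<^sup>2"
  proof -
    obtain M where "\<forall>m\<ge>M. \<forall>n. norm (\<Sum>j=m..<n. (norm (x j))\<^sup>2) < (e/2)\<^sup>2"
      using summable e unfolding summable_Cauchy by (meson half_gt_zero zero_less_power)
    then have "norm (\<Sum>j=M..<n. (norm (x j))\<^sup>2) < (e/2)\<^sup>2" for n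
      by blast
    then have "(\<Sum>j=M..<n. (norm (x j))\<^sup>2) < (e/2)\<^sup>2" for n
      unfolding real_norm_def using abs_ge_self le_less_trans by blast
    then show ?thesis
      using that by blast
  qed
  define u where "u j = (if j < M then x j else 0)" for j
  define w where "w j = (if j < M then 0 else x j)" for j
  have split: "state x n = state u n + state w n" for n
    unfolding state_add[symmetric] by (rule state_cong) (simp add: u_def w_def)
  have w: "norm (state w n) < e/2" for n
  proof -
    have "(norm (state w n))\<^sup>2 \<le> (\<Sum>j<n. (norm (w j))\<^sup>2)"
      using energy_balance[of w n] sum_nonneg[of "{..<n}" "\<lambda>j. (norm (response w j))\<^sup>2"] by simp
    also have "\<dots> = (\<Sum>j\<in>{M..<n}. (norm (x j))\<^sup>2)"
      by (rule sum.mono_neutral_cong_right) (auto simp: w_def)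
    finally have "(norm (state w n))\<^sup>2 < (e/2)\<^sup>2"
      using M[of n] by simp
    then show ?thesis
      by (rule power2_less_imp_less) (use e in simp)
  qed
  have u: "state u (k + M) = (\<Sum>i<M. (trans ^^ (k + i)) (inject (x (M - Suc i))))" for k
  proof (induction k)
    case 0
    show ?case
      unfolding state_convolution by (auto simp: u_def intro!: sum.cong)
  next
    case (Suc k)
    have "state u (Suc k + M) = trans (state u (k + M))"
      by (simp add: u_def trans_def)
    then show ?case
      unfolding Suc.IH by (simp add: contraction_op_sum[OF contraction_trans])
  qed
  have "(\<lambda>k. \<Sum>i<M. (trans ^^ (k + i)) (inject (x (M - Suc i)))) \<longlonglongrightarrow> (\<Sum>i<M. 0)"
    by (intro tendsto_sum LIMSEQ_ignore_initial_segment impulse_state_tendsto_0 x)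
  then have "(\<lambda>k. state u (k + M)) \<longlonglongrightarrow> 0"
    unfolding u by simp
  then have "state u \<longlonglongrightarrow> 0"
    by (rule LIMSEQ_offset)
  then obtain N where N: "\<And>n. n \<ge> N \<Longrightarrow> norm (state u n) < e/2"
    using e LIMSEQ_D[of "state u" 0 "e/2"] by auto
  have "norm (state x n - 0) < e" if "n \<ge> N" for n
    using norm_triangle_ineq[of "state u n" "state w n"] N[OF that] w[of n] by (simp add: split)
  then show "\<exists>N. \<forall>n\<ge>N. norm (state x n - 0) < e" by blast
qed

lemma response_norm_has_sum:
  assumes x: "\<And>j. x j \<in> E" and "((\<lambda>j. (norm (x j))\<^sup>2) has_sum s) UNIV"
  shows "((\<lambda>j. (norm (response x j))\<^sup>2) has_sum s) UNIV"
proof (rule sums_nonneg_imp_has_sum)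
  have s: "(\<lambda>j. (norm (x j))\<^sup>2) sums s"
    using assms(2) by (rule has_sum_imp_sums)
  have "state x \<longlonglongrightarrow> 0"
    using state_tendsto_0[OF x] s by (simp add: sums_iff)
  then have "(\<lambda>n. (norm (state x n))\<^sup>2) \<longlonglongrightarrow> 0"
    using tendsto_power[of "\<lambda>n. norm (state x n)" 0 sequentially 2] by (simp add: tendsto_norm_zero)
  moreover have "(\<Sum>j<n. (norm (response x j))\<^sup>2) = (\<Sum>j<n. (norm (x j))\<^sup>2) - (norm (state x n))\<^sup>2" for n
    using energy_balance[of x n] by simp
  ultimately show "(\<lambda>j. (norm (response x j))\<^sup>2) sums s"
    using s tendsto_diff[of "\<lambda>n. \<Sum>j<n. (norm (x j))\<^sup>2" s sequentially "\<lambda>n. (norm (state x n))\<^sup>2" 0]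
    by (simp add: sums_def)
qed simp

text \<open>If \<open>V\<close> also carries \<open>(f\<^sub>j, k\<^sub>j)\<close> to \<open>(g\<^sub>j, k\<^sub>j\<^sub>+\<^sub>1)\<close>, then preservation of inner products telescopes over time. So
  the adjoint of the input-output map sends \<open>g\<close> to \<open>f\<close>.\<close>

lemma response_pairing:
  assumes x: "\<And>j. x j \<in> E" "summable (\<lambda>j. (norm (x j))\<^sup>2)"
    and V: "\<And>j. V (f j, k j) = (g j, k (Suc j))" and k: "\<And>j. norm (k j) \<le> C"
    and sums: "(\<lambda>j. cinner (response x j) (g j)) sums s" "(\<lambda>j. cinner (x j) (f j)) sums t"
  shows "s = t"
proof -
  have partial: "(\<Sum>j<n. cinner (response x j) (g j)) + cinner (state x n) (k n) = (\<Sum>j<n. cinner (x j) (f j))" for n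
  proof (induction n)
    case (Suc n)
    have "cinner (response x n) (g n) + cinner (state x (Suc n)) (k (Suc n))
        = cinner (x n) (f n) + cinner (state x n) (k n)"
      using linear_isometry_cinner[OF isometry, of "(x n, state x n)" "(f n, k n)"]
      unfolding V_state V cinner_Pair .
    then have "(\<Sum>j<Suc n. cinner (response x j) (g j)) + cinner (state x (Suc n)) (k (Suc n))
        = (\<Sum>j<n. cinner (response x j) (g j)) + (cinner (x n) (f n) + cinner (state x n) (k n))"
      by (simp only: sum.lessThan_Suc add.assoc)
    also have "\<dots> = (\<Sum>j<Suc n. cinner (x j) (f j))"
      using Suc.IH by (simp add: algebra_simps)
    finally show ?case .
  qed simp
  have "(\<lambda>n. cinner (state x n) (k n)) \<longlonglongrightarrow> 0"
  proof (rule Lim_null_comparison)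
    have "norm (cinner (state x n) (k n)) \<le> norm (state x n) * C" for n
      using cinner_cauchy_schwarz[of "state x n" "k n"] mult_left_mono[OF k[of n], of "norm (state x n)"]
      by simp
    then show "\<forall>\<^sub>F n in sequentially. norm (cinner (state x n) (k n)) \<le> norm (state x n) * C"
      by simp
    have "(\<lambda>n. norm (state x n)) \<longlonglongrightarrow> 0"
      using state_tendsto_0[OF x] by (rule tendsto_norm_zero)
    then show "(\<lambda>n. norm (state x n) * C) \<longlonglongrightarrow> 0"
      by (rule tendsto_mult_left_zero)
  qed
  then have "(\<lambda>n. (\<Sum>j<n. cinner (response x j) (g j)) + cinner (state x n) (k n)) \<longlonglongrightarrow> s + 0"
    using sums(1) by (intro tendsto_add) (simp_all add: sums_def)
  then show ?thesis
    unfolding partial using sums(2) by (simp add: sums_def LIMSEQ_unique)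
qed

text \<open>The Markov parameters, extended by \<open>0\<close> to the orthogonal complement of \<open>E\<close>, as Taylor coefficients.\<close>

definition coeff :: "nat \<Rightarrow> 'a \<Rightarrow>\<^sub>L 'a"
  where "coeff n = Blinfun (\<lambda>x. markov n (fourier_sum B x))"

definition transfer :: "complex \<Rightarrow> 'a \<Rightarrow>\<^sub>L 'a"
  where "transfer z = (\<Sum>\<^sub>\<infinity>n. z ^ n *\<^sub>C coeff n)"

lemma contraction_op_fourier_sum: "contraction_op (fourier_sum B)"
  using norm_fourier_sum_le[OF basis(1,2)]
  by (simp add: contraction_op_def fourier_sum_def cinner_simps scaleC_add_left sum.distrib
      complex_vector.scale_sum_right scaleC_scaleC)

lemma contraction_op_coeff: "contraction_op (\<lambda>x. markov n (fourier_sum B x))"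
  using contraction_op_comp[OF contraction_markov[of n] contraction_op_fourier_sum] by (simp add: o_def)

lemma coeff_apply: "blinfun_apply (coeff n) x = markov n (fourier_sum B x)"
  unfolding coeff_def
  by (simp add: bounded_linear_Blinfun_apply[OF contraction_op_bounded_linear[OF contraction_op_coeff]])

lemma coeff_apply_E: "x \<in> E \<Longrightarrow> blinfun_apply (coeff n) x = markov n x"
  using fourier_sum_eq[OF basis(1,2)] by (simp add: coeff_apply basis(3))

lemma coeff_in_bounded_ops: "coeff n \<in> bounded_ops E"
proof -
  have "markov n (fourier_sum B x) \<in> E" for x
    using fourier_sum_in_span[of B x] by (intro markov_in_E) (simp add: basis(3))
  moreover have "fourier_sum B x = 0" if "\<forall>y\<in>E. cinner x y = 0" for x
  proof -
    have "B \<subseteq> E"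
      using basis(3) complex_vector.span_superset by blast
    then show ?thesis
      using that by (auto simp: fourier_sum_def intro!: sum.neutral)
  qed
  ultimately show ?thesis
    using contraction_opD(2)[OF contraction_op_coeff] contraction_opD(4)[OF contraction_markov]
    by (auto simp: bounded_ops_def coeff_apply)
qed

lemma norm_coeff_le: "norm (coeff n) \<le> 1"
  by (rule norm_blinfun_bound) (simp_all add: coeff_apply contraction_opD(3)[OF contraction_op_coeff])

lemma norm_scaleC_blinfun_le: "norm (c *\<^sub>C A) \<le> cmod c * norm A" for A :: "'a \<Rightarrow>\<^sub>L 'a"
proof (rule norm_blinfun_bound)
  show "norm (blinfun_apply (c *\<^sub>C A) x) \<le> cmod c * norm A * norm x" for x
    using mult_left_mono[OF norm_blinfun[of A x], of "cmod c"]
    by (simp add: scaleC_blinfun.rep_eq norm_scaleC mult.assoc)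
qed simp

lemma transfer_has_sum:
  assumes "cmod z < 1"
  shows "((\<lambda>n. z ^ n *\<^sub>C coeff n) has_sum transfer z) UNIV"
proof -
  have "norm (z ^ n *\<^sub>C coeff n) \<le> cmod z ^ n" for n
    using norm_scaleC_blinfun_le[of "z ^ n" "coeff n"]
      mult_left_mono[OF norm_coeff_le[of n], of "cmod z ^ n"] by (simp add: norm_power)
  moreover have "(\<lambda>n. cmod z ^ n) summable_on UNIV"
    using assms by (intro norm_summable_imp_summable_on) (simp add: norm_power)
  ultimately have "(\<lambda>n. norm (z ^ n *\<^sub>C coeff n)) summable_on UNIV"
    by (intro Infinite_Sum.abs_summable_on_comparison_test'[where g = "\<lambda>n. cmod z ^ n"])
  then have "(\<lambda>n. z ^ n *\<^sub>C coeff n) summable_on UNIV"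
    by (rule abs_summable_summable)
  then show ?thesis
    unfolding transfer_def by (rule has_sum_infsum)
qed

lemma transfer_apply_has_sum:
  assumes "cmod z < 1"
  shows "((\<lambda>n. z ^ n *\<^sub>C markov n (fourier_sum B x)) has_sum blinfun_apply (transfer z) x) UNIV"
  using has_sum_bounded_linear[OF blinfun.bounded_linear_left transfer_has_sum[OF assms], of x]
  by (simp add: scaleC_blinfun.rep_eq coeff_apply o_def)

lemma transfer_in_bounded_ops:
  assumes z: "cmod z < 1"
  shows "transfer z \<in> bounded_ops E"
  unfolding bounded_ops_def
proof (intro CollectI conjI allI impI subsetI)
  show "blinfun_apply (transfer z) (c *\<^sub>C x) = c *\<^sub>C blinfun_apply (transfer z) x" for c x
  proof (rule has_sum_unique[OF transfer_apply_has_sum[OF z]])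
    show "((\<lambda>n. z ^ n *\<^sub>C markov n (fourier_sum B (c *\<^sub>C x))) has_sum c *\<^sub>C blinfun_apply (transfer z) x) UNIV"
      using has_sum_bounded_linear[OF bounded_linear_scaleC transfer_apply_has_sum[OF z], of c x]
      by (simp add: contraction_opD(2)[OF contraction_op_coeff] scaleC_scaleC mult.commute o_def)
  qed
  show "y \<in> E" if y: "y \<in> range (blinfun_apply (transfer z))" for y
  proof -
    obtain x where x: "y = blinfun_apply (transfer z) x"
      using y by blast
    from has_sum_bounded_linear[OF contraction_op_bounded_linear[OF contraction_op_fourier_sum] transfer_apply_has_sum[OF z], of x]
    have "((\<lambda>n. fourier_sum B (z ^ n *\<^sub>C markov n (fourier_sum B x))) has_sum fourier_sum B y) UNIV"
      by (simp add: x o_def)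
    moreover have "fourier_sum B (z ^ n *\<^sub>C markov n (fourier_sum B x)) = z ^ n *\<^sub>C markov n (fourier_sum B x)" for n
      using fourier_sum_in_span[of B x] markov_in_E[of "fourier_sum B x" n]
      by (intro fourier_sum_eq basis complex_vector.span_scale) (simp add: basis(3))
    ultimately have "((\<lambda>n. z ^ n *\<^sub>C markov n (fourier_sum B x)) has_sum fourier_sum B y) UNIV"
      by simp
    then have "fourier_sum B y = y"
      unfolding x by (rule has_sum_unique[OF _ transfer_apply_has_sum[OF z, of x]])
    then show ?thesis
      using fourier_sum_in_span[of B y] by (simp add: basis(3))
  qed
  show "blinfun_apply (transfer z) x = 0" if "\<forall>y\<in>E. cinner x y = 0" for x
  proof (rule has_sum_unique[OF transfer_apply_has_sum[OF z]])
    have "markov n (fourier_sum B x) = 0" for n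
      using coeff_in_bounded_ops[of n] that by (simp add: bounded_ops_def coeff_apply)
    then show "((\<lambda>n. z ^ n *\<^sub>C markov n (fourier_sum B x)) has_sum 0) UNIV"
      by simp
  qed
qed

text \<open>For \<open>x \<in> E\<close>, in the limit \<open>V (x, z y) = (\<phi>(z) x, y)\<close> with \<open>y = (\<Sum>i. z\<^sup>i trans\<^sup>i (inject x))\<close>, and the isometry of \<open>V\<close>
  gives \<open>\<parallel>\<phi>(z) x\<parallel>\<^sup>2 + \<parallel>y\<parallel>\<^sup>2 = \<parallel>x\<parallel>\<^sup>2 + |z|\<^sup>2 \<parallel>y\<parallel>\<^sup>2\<close>. The partial sums \<open>w\<close> and \<open>y\<close> satisfy this up to a shift.\<close>

lemma norm_transfer_le:
  assumes z: "cmod z < 1"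
  shows "norm (transfer z) \<le> 1"
proof (rule norm_blinfun_bound)
  fix x0
  define x where "x = fourier_sum B x0"
  define y where "y n = (\<Sum>i<n. z ^ i *\<^sub>C (trans ^^ i) (inject x))" for n
  define w where "w n = (\<Sum>i<n. z ^ i *\<^sub>C markov i x)" for n
  have V: "V (x, z *\<^sub>C y n) = (w (Suc n), y (Suc n))" for n
  proof (rule prod_eqI)
    have "V (x, z *\<^sub>C y n) = V (x, 0) + z *\<^sub>C V (0, y n)"
      using V_split[of x "z *\<^sub>C y n"] V_scaleC[of z 0 "y n"] by simp
    moreover have "V (0, y n) = (\<Sum>i<n. z ^ i *\<^sub>C V (0, (trans ^^ i) (inject x)))"
    proof (induction n)
      case (Suc n)
      have "V (0, y (Suc n)) = V (0, y n) + z ^ n *\<^sub>C V (0, (trans ^^ n) (inject x))"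
        using V_add[of 0 0 "y n" "z ^ n *\<^sub>C (trans ^^ n) (inject x)"]
          V_scaleC[of "z ^ n" 0 "(trans ^^ n) (inject x)"] by (simp add: y_def)
      then show ?case
        using Suc by simp
    qed (use V_scaleC[of 0 0 0] in \<open>simp add: y_def zero_prod_def\<close>)
    ultimately have *: "V (x, z *\<^sub>C y n)
        = V (x, 0) + (\<Sum>i<n. z ^ Suc i *\<^sub>C V (0, (trans ^^ i) (inject x)))"
      by (simp add: complex_vector.scale_sum_right scaleC_scaleC)
    show "fst (V (x, z *\<^sub>C y n)) = fst (w (Suc n), y (Suc n))"
      unfolding * w_def fst_conv
      by (subst sum.lessThan_Suc_shift) (simp add: fst_sum scaleC_prod_def markov_def scaleC_one)
    show "snd (V (x, z *\<^sub>C y n)) = snd (w (Suc n), y (Suc n))"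
      unfolding * snd_conv unfolding y_def
      by (subst sum.lessThan_Suc_shift)
        (simp add: snd_sum scaleC_prod_def inject_def[symmetric] trans_def[symmetric] scaleC_one)
  qed
  have "summable (\<lambda>i. norm (z ^ i *\<^sub>C (trans ^^ i) (inject x)))"
  proof (rule summable_comparison_test')
    show "summable (\<lambda>i. cmod z ^ i * norm x)"
      using z by (intro summable_mult2 summable_geometric) simp
    show "norm (norm (z ^ i *\<^sub>C (trans ^^ i) (inject x))) \<le> cmod z ^ i * norm x" for i
      using order_trans[OF contraction_opD(3)[OF contraction_op_funpow[OF contraction_trans], of i "inject x"]
          contraction_opD(3)[OF contraction_inject, of x]]
      by (simp add: norm_scaleC norm_power mult_left_mono)
  qed
  from summable_sums[OF summable_norm_cancel[OF this]]
  obtain l where "(\<lambda>i. z ^ i *\<^sub>C (trans ^^ i) (inject x)) sums l"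
    by blast
  then have y: "y \<longlonglongrightarrow> l"
    by (simp add: sums_def y_def[abs_def])
  have w: "w \<longlonglongrightarrow> blinfun_apply (transfer z) x0"
    using has_sum_imp_sums[OF transfer_apply_has_sum[OF z, of x0]]
    by (simp add: sums_def w_def[abs_def] x_def)
  have "(\<lambda>n. (norm (w (Suc n)))\<^sup>2 + (norm (y (Suc n)))\<^sup>2)
      \<longlonglongrightarrow> (norm (blinfun_apply (transfer z) x0))\<^sup>2 + (norm l)\<^sup>2"
    by (intro tendsto_intros LIMSEQ_Suc y w)
  moreover have "(norm (w (Suc n)))\<^sup>2 + (norm (y (Suc n)))\<^sup>2 = (norm x)\<^sup>2 + (cmod z)\<^sup>2 * (norm (y n))\<^sup>2" for n
    using V_norm[of x "z *\<^sub>C y n"] by (simp add: V norm_scaleC power_mult_distrib)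
  moreover have "(\<lambda>n. (norm x)\<^sup>2 + (cmod z)\<^sup>2 * (norm (y n))\<^sup>2) \<longlonglongrightarrow> (norm x)\<^sup>2 + (cmod z)\<^sup>2 * (norm l)\<^sup>2"
    by (intro tendsto_intros y)
  ultimately have "(norm (blinfun_apply (transfer z) x0))\<^sup>2 + (norm l)\<^sup>2 = (norm x)\<^sup>2 + (cmod z)\<^sup>2 * (norm l)\<^sup>2"
    using LIMSEQ_unique by simp
  also have "\<dots> \<le> (norm x)\<^sup>2 + 1 * (norm l)\<^sup>2"
    using z by (intro add_left_mono mult_right_mono) (simp_all add: power_le_one)
  finally have "(norm (blinfun_apply (transfer z) x0))\<^sup>2 \<le> (norm x)\<^sup>2"
    by simp
  then have "norm (blinfun_apply (transfer z) x0) \<le> norm x"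
    by (rule power2_le_imp_le) simp
  also have "\<dots> \<le> norm x0"
    unfolding x_def by (rule norm_fourier_sum_le[OF basis(1,2)])
  finally show "norm (blinfun_apply (transfer z) x0) \<le> 1 * norm x0"
    by simp
qed simp

end

section \<open>Hardy spaces as spaces of square-summable coefficients\<close>

lemma multi_power_fun_upd:
  assumes "l \<in> {1..m}"
  shows "multi_power m z (k(l := j)) = z l ^ j * (\<Prod>i\<in>{1..m} - {l}. z i ^ k i)"
  unfolding multi_power_def
  by (subst prod.remove[OF _ assms]) (auto intro!: prod.cong)

lemma geometric_multi_series_summable:
  fixes r :: "nat \<Rightarrow> real"
  assumes "\<And>i. i \<in> {1..m} \<Longrightarrow> 0 \<le> r i \<and> r i < 1"
  shows "(\<lambda>k. \<Prod>i=1..m. r i ^ k i) summable_on multi_indices m"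
  using assms
proof (induction m)
  case 0
  show ?case by (simp add: multi_indices_def)
next
  case (Suc m)
  then obtain s where s: "((\<lambda>k. \<Prod>i=1..m. r i ^ k i) has_sum s) (multi_indices m)"
    unfolding summable_on_def by fastforce
  let ?r = "r (Suc m)"
  have r: "0 \<le> ?r" "?r < 1" using Suc.prems[of "Suc m"] by auto
  have geo: "((\<lambda>j. ?r ^ j) has_sum (1 / (1 - ?r))) UNIV"
    using geometric_sums[of ?r] r by (intro sums_nonneg_imp_has_sum) auto
  have "((\<lambda>(g, j). (\<Prod>i=1..m. r i ^ g i) * ?r ^ j) has_sum (s * (1 / (1 - ?r)))) (multi_indices m \<times> UNIV)"
  proof (rule has_sum_Sigma_nonneg)
    fix g
    show "((\<lambda>j. case (g, j) of (g, j) \<Rightarrow> (\<Prod>i=1..m. r i ^ g i) * ?r ^ j) has_sum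
        (\<Prod>i=1..m. r i ^ g i) * (1 / (1 - ?r))) UNIV"
      using has_sum_cmult_right[OF geo] by simp
  next
    show "((\<lambda>g. (\<Prod>i=1..m. r i ^ g i) * (1 / (1 - ?r))) has_sum (s * (1 / (1 - ?r)))) (multi_indices m)"
      by (rule has_sum_cmult_left[OF s])
  next
    fix g j
    show "0 \<le> (case (g, j) of (g, j) \<Rightarrow> (\<Prod>i=1..m. r i ^ g i) * ?r ^ j)"
      using Suc.prems r by (auto intro!: mult_nonneg_nonneg prod_nonneg)
  qed
  moreover have "(\<Prod>i=1..Suc m. r i ^ (g(Suc m := j)) i) = (\<Prod>i=1..m. r i ^ g i) * ?r ^ j" for g j
    by (simp add: prod.cl_ivl_Suc)
  moreover have "{1..Suc m} - {Suc m} = {1..m}" by auto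
  ultimately have "((\<lambda>k. \<Prod>i=1..Suc m. r i ^ k i) has_sum (s * (1 / (1 - ?r)))) (multi_indices (Suc m))"
    by (subst has_sum_fibres[of "Suc m"]) (auto simp: multi_indices_def)
  then show ?case
    by (rule has_sum_imp_summable)
qed

lemma multi_power_summable:
  assumes "z \<in> polydisc m"
  shows "(\<lambda>k. norm (multi_power m z k)) summable_on multi_indices m"
proof -
  have "norm (multi_power m z k) = (\<Prod>i=1..m. cmod (z i) ^ k i)" for k
    by (simp add: multi_power_def prod_norm[symmetric] norm_power)
  moreover have "0 \<le> cmod (z i) \<and> cmod (z i) < 1" if "i \<in> {1..m}" for i
    using assms that by (auto simp: polydisc_def PiE_def Pi_def)
  ultimately show ?thesis
    using geometric_multi_series_summable[of m "\<lambda>i. cmod (z i)"] by simp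
qed

lemma norm_multi_power_le:
  assumes "z \<in> polydisc m"
  shows "norm (multi_power m z k) \<le> 1"
proof -
  have "cmod (z i ^ k i) \<le> 1" if "i \<in> {1..m}" for i
  proof -
    have "cmod (z i) < 1"
      using assms that by (auto simp: polydisc_def PiE_def Pi_def)
    then show ?thesis
      by (simp add: norm_power power_le_one)
  qed
  then show ?thesis
    unfolding multi_power_def prod_norm[symmetric] by (intro prod_le_1) auto
qed

text \<open>Both \<open>|z\<^sup>k|\<close> and \<open>\<parallel>a\<^sub>k\<parallel>\<^sup>2\<close> are summable, and \<open>t \<le> 1\<close> gives \<open>t s \<le> t + s\<^sup>2\<close>.\<close>

lemma square_summable_imp_power_series_summable:
  fixes a :: "(nat \<Rightarrow> nat) \<Rightarrow> 'a::complex_hilbert"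
  assumes "(\<lambda>k. (norm (a k))\<^sup>2) summable_on multi_indices m" "z \<in> polydisc m"
  shows "(\<lambda>k. norm (multi_power m z k *\<^sub>C a k)) summable_on multi_indices m"
proof (rule Infinite_Sum.abs_summable_on_comparison_test')
  show "(\<lambda>k. norm (multi_power m z k) + (norm (a k))\<^sup>2) summable_on multi_indices m"
    by (intro summable_on_add multi_power_summable assms)
  show "norm (multi_power m z k *\<^sub>C a k) \<le> norm (multi_power m z k) + (norm (a k))\<^sup>2" for k
  proof (cases "norm (a k) \<le> 1")
    case True
    then have "norm (multi_power m z k) * norm (a k) \<le> norm (multi_power m z k) * 1"
      by (intro mult_left_mono) auto
    then show ?thesis
      using zero_le_power2[of "norm (a k)"] unfolding norm_scaleC by linarith
  next
    case False
    then have "norm (multi_power m z k) * norm (a k) \<le> norm (a k) * norm (a k)"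
      using norm_multi_power_le[OF assms(2), of k] by (intro mult_right_mono) auto
    then show ?thesis
      by (simp add: norm_scaleC power2_eq_square add_increasing)
  qed
qed

lemma power_series_zero_coeffs:
  fixes b :: "nat \<Rightarrow> complex"
  assumes "\<And>t. cmod t < 1 \<Longrightarrow> ((\<lambda>j. t ^ j * b j) has_sum 0) UNIV"
  shows "b j = 0"
proof (rule ccontr)
  assume nz: "b j \<noteq> 0"
  have sums: "(\<lambda>j. b j * (t - 0) ^ j) sums 0" if "norm (t - 0) < 1" for t
    using has_sum_imp_sums[OF assms[of t]] that by (simp add: mult.commute)
  show False
  proof (cases "j = 0")
    case True
    then show False
      using sums[of 0] nz by simp
  next
    case False
    then obtain s where s: "0 < s" "\<And>z::complex. z \<in> cball 0 s - {0} \<Longrightarrow> (0::complex) \<noteq> 0"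
      using powser_0_nonzero[of 1 0 b "\<lambda>_. 0" j] sums nz by auto
    then show False
      using s(2)[of "of_real s"] by auto
  qed
qed

text \<open>One variable at a time: freezing all but the last variable gives a power series in that variable,
  whose coefficients vanish and are themselves power series in the remaining variables.\<close>

lemma multi_power_series_zero_coeffs:
  fixes c :: "(nat \<Rightarrow> nat) \<Rightarrow> complex"
  assumes "\<And>z. z \<in> polydisc m \<Longrightarrow> ((\<lambda>k. multi_power m z k * c k) has_sum 0) (multi_indices m)"
    and "k \<in> multi_indices m"
  shows "c k = 0"
  using assms
proof (induction m arbitrary: c k)
  case 0
  have "((\<lambda>k. multi_power 0 (\<lambda>_. undefined) k * c k) has_sum 0) (multi_indices 0)"
    by (rule 0(1)) (simp add: polydisc_def)
  then have "((\<lambda>k. c k) has_sum 0) {\<lambda>_. undefined}"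
    by (simp add: multi_indices_def multi_power_def)
  then have "c (\<lambda>_. undefined) = 0"
    using has_sum_finiteI[of "{\<lambda>_. undefined}" _ c] has_sum_unique by fastforce
  then show ?case
    using 0(2) by (simp add: multi_indices_def)
next
  case (Suc m)
  have D: "{1..Suc m} - {Suc m} = {1..m}" by auto
  have last: "Suc m \<in> {1..Suc m}" by simp
  have mp: "multi_power (Suc m) (z(Suc m := t)) (g(Suc m := j)) = t ^ j * multi_power m z g" for z g t j
  proof -
    have "multi_power (Suc m) (z(Suc m := t)) (g(Suc m := j)) = t ^ j * (\<Prod>i=1..m. (z(Suc m := t)) i ^ g i)"
      using multi_power_fun_upd[of "Suc m" "Suc m" "z(Suc m := t)" g j] unfolding D by simp
    also have "(\<Prod>i=1..m. (z(Suc m := t)) i ^ g i) = multi_power m z g"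
      unfolding multi_power_def by (intro prod.cong) auto
    finally show ?thesis .
  qed
  have sum2: "((\<lambda>(g, j). t ^ j * multi_power m z g * c (g(Suc m := j))) has_sum 0) (multi_indices m \<times> UNIV)"
    if "z \<in> polydisc m" "cmod t < 1" for z t
  proof -
    have "z(Suc m := t) \<in> polydisc (Suc m)"
      using that by (auto simp: polydisc_def PiE_def Pi_def extensional_def le_Suc_eq)
    from Suc.prems(1)[OF this] show ?thesis
      using has_sum_fibres[OF last, of "\<lambda>k. multi_power (Suc m) (z(Suc m := t)) k * c k" 0]
      unfolding mp D multi_indices_def[of m] by blast
  qed
  have zero: "c (g(Suc m := j)) = 0" if "g \<in> multi_indices m" for g j
  proof (rule Suc.IH[OF _ that])
    fix z assume z: "z \<in> polydisc m"
    have swap: "((\<lambda>(j, g). t ^ j * multi_power m z g * c (g(Suc m := j))) has_sum 0) (UNIV \<times> multi_indices m)"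
      if "cmod t < 1" for t
      using sum2[OF z that]
        has_sum_swap[of "\<lambda>(g, j). t ^ j * multi_power m z g * c (g(Suc m := j))" "multi_indices m" UNIV 0]
      by (simp only: prod.case)
    define b where "b j = (\<Sum>\<^sub>\<infinity>g\<in>multi_indices m. multi_power m z g * c (g(Suc m := j)))" for j
    have b: "((\<lambda>g. multi_power m z g * c (g(Suc m := j))) has_sum b j) (multi_indices m)" for j
    proof -
      have "(\<lambda>g. (1/2) ^ j * multi_power m z g * c (g(Suc m := j))) summable_on multi_indices m"
        using summable_on_SigmaD1[OF has_sum_imp_summable[OF swap[of "1/2"]], of j] by simp
      then have "(\<lambda>g. 2 ^ j * ((1/2) ^ j * multi_power m z g * c (g(Suc m := j)))) summable_on multi_indices m"
        by (rule summable_on_cmult_right)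
      then show ?thesis
        unfolding b_def by (intro has_sum_infsum) (simp add: power_one_over)
    qed
    have "((\<lambda>j. t ^ j * b j) has_sum 0) UNIV" if "cmod t < 1" for t
    proof (rule has_sum_SigmaD[OF swap[OF that]])
      show "((\<lambda>g. case (j, g) of (j, g) \<Rightarrow> t ^ j * multi_power m z g * c (g(Suc m := j))) has_sum t ^ j * b j)
          (multi_indices m)" for j
        using has_sum_cmult_right[OF b[of j], of "t ^ j"] by (simp add: mult.assoc)
    qed
    then have "b j = 0"
      by (rule power_series_zero_coeffs)
    then show "((\<lambda>g. multi_power m z g * c (g(Suc m := j))) has_sum 0) (multi_indices m)"
      using b[of j] by simp
  qed
  have "k(Suc m := undefined) \<in> multi_indices m"
    using Suc.prems(2) by (auto simp: multi_indices_def PiE_def extensional_def)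
  from zero[OF this, of "k (Suc m)"] show ?case by simp
qed

lemma scaleC_fun_apply: "(c *\<^sub>C f) z = c *\<^sub>C f z"
  by (simp add: scaleC_fun_def)

lemma power_series_add:
  fixes a b :: "(nat \<Rightarrow> nat) \<Rightarrow> 'a::complex_hilbert"
  assumes "power_series m a f" "power_series m b g"
  shows "power_series m (\<lambda>k. a k + b k) (f + g)"
  using assms unfolding power_series_def by (auto simp: scaleC_add_right intro!: has_sum_add)

lemma power_series_scaleC:
  fixes a :: "(nat \<Rightarrow> nat) \<Rightarrow> 'a::complex_hilbert"
  assumes "power_series m a f"
  shows "power_series m (\<lambda>k. c *\<^sub>C a k) (c *\<^sub>C f)"
  unfolding power_series_def
proof
  fix z assume "z \<in> polydisc m"
  then have "((\<lambda>k. multi_power m z k *\<^sub>C a k) has_sum f z) (multi_indices m)"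
    using assms by (simp add: power_series_def)
  from has_sum_bounded_linear[OF bounded_linear_scaleC this, of c]
  show "((\<lambda>k. multi_power m z k *\<^sub>C c *\<^sub>C a k) has_sum (c *\<^sub>C f) z) (multi_indices m)"
    by (simp add: o_def scaleC_scaleC scaleC_fun_apply mult.commute)
qed

lemma power_series_diff:
  fixes a b :: "(nat \<Rightarrow> nat) \<Rightarrow> 'a::complex_hilbert"
  assumes "power_series m a f" "power_series m b g"
  shows "power_series m (\<lambda>k. a k - b k) (f - g)"
  using power_series_add[OF assms(1) power_series_scaleC[OF assms(2), of "-1"]]
  by (simp add: scaleC_minus1)

lemma power_series_unique:
  fixes a b :: "(nat \<Rightarrow> nat) \<Rightarrow> 'a::complex_hilbert"
  assumes "power_series m a f" "power_series m b f" "k \<in> multi_indices m"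
  shows "a k = b k"
proof (rule cinner_eqI)
  fix u
  have "cinner (a k - b k) u = 0"
  proof (rule multi_power_series_zero_coeffs[OF _ assms(3)])
    fix z assume z: "z \<in> polydisc m"
    have "((\<lambda>k. multi_power m z k *\<^sub>C (a k - b k)) has_sum 0) (multi_indices m)"
      using power_series_diff[OF assms(1,2)] z by (simp add: power_series_def)
    from has_sum_bounded_linear[OF bounded_linear_cinner_left this, of u]
    show "((\<lambda>k. multi_power m z k * cinner (a k - b k) u) has_sum 0) (multi_indices m)"
      by (simp add: cinner_scaleC_left o_def)
  qed
  then show "cinner u (a k) = cinner u (b k)"
    using cinner_commute[of u "a k"] cinner_commute[of u "b k"] by (simp add: cinner_simps)
qed

lemma taylor_coeff_eq:
  assumes "power_series m a f" "k \<in> multi_indices m"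
  shows "taylor_coeff m f k = a k"
proof -
  define a' where "a' = restrict a (multi_indices m)"
  have a': "power_series m a' f"
    using assms(1) unfolding power_series_def a'_def
    by (auto cong: has_sum_cong)
  have "taylor_coeff m f = a'"
    unfolding taylor_coeff_def
  proof (rule the_equality)
    show "a' \<in> multi_indices m \<rightarrow>\<^sub>E UNIV \<and> power_series m a' f"
      using a' by (simp add: a'_def)
    show "b = a'" if "b \<in> multi_indices m \<rightarrow>\<^sub>E UNIV \<and> power_series m b f" for b
    proof
      show "b k = a' k" for k
        using that power_series_unique[of m b f a' k] a'
        by (cases "k \<in> multi_indices m") (auto simp: a'_def PiE_def extensional_def)
    qed
  qed
  then show ?thesis
    using assms(2) by (simp add: a'_def)
qed

text \<open>Together with \<open>hardyD\<close> this replaces elements of the Hardy space by square-summable families of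
  Taylor coefficients.\<close>

lemma hardyI:
  assumes "\<And>z. z \<notin> polydisc m \<Longrightarrow> f z = 0"
    and "\<And>k. k \<in> multi_indices m \<Longrightarrow> a k \<in> E"
    and "(\<lambda>k. (norm (a k))\<^sup>2) summable_on multi_indices m"
    and ps: "power_series m a f"
  shows "f \<in> hardy_set m E" "\<And>k. k \<in> multi_indices m \<Longrightarrow> taylor_coeff m f k = a k"
proof -
  have "power_series m (restrict a (multi_indices m)) f"
    using ps unfolding power_series_def by (auto cong: has_sum_cong)
  moreover have "(\<lambda>k. (norm (restrict a (multi_indices m) k))\<^sup>2) summable_on multi_indices m"
    using assms(3) by (auto cong: summable_on_cong)
  ultimately show "f \<in> hardy_set m E"
    using assms(1,2) unfolding hardy_set_def
    by (intro CollectI conjI allI impI bexI[of _ "restrict a (multi_indices m)"]) auto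
qed (rule taylor_coeff_eq[OF ps])

lemma hardyD:
  assumes "f \<in> hardy_set m E"
  shows "z \<notin> polydisc m \<Longrightarrow> f z = 0" "k \<in> multi_indices m \<Longrightarrow> taylor_coeff m f k \<in> E"
    "(\<lambda>k. (norm (taylor_coeff m f k))\<^sup>2) summable_on multi_indices m"
    "power_series m (taylor_coeff m f) f"
proof -
  obtain a where a: "a \<in> multi_indices m \<rightarrow>\<^sub>E E" "power_series m a f"
      "(\<lambda>k. (norm (a k))\<^sup>2) summable_on multi_indices m"
    using assms by (auto simp: hardy_set_def)
  have t: "taylor_coeff m f k = a k" if "k \<in> multi_indices m" for k
    by (rule taylor_coeff_eq[OF a(2) that])
  show "z \<notin> polydisc m \<Longrightarrow> f z = 0"
    using assms by (simp add: hardy_set_def)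
  show "k \<in> multi_indices m \<Longrightarrow> taylor_coeff m f k \<in> E"
    using a(1) by (auto simp: t)
  show "(\<lambda>k. (norm (taylor_coeff m f k))\<^sup>2) summable_on multi_indices m"
    using a(3) by (simp add: t cong: summable_on_cong)
  show "power_series m (taylor_coeff m f) f"
    using a(2) by (simp add: power_series_def t cong: has_sum_cong)
qed

lemma square_summable_add:
  fixes a b :: "'i \<Rightarrow> 'a::real_normed_vector"
  assumes "(\<lambda>k. (norm (a k))\<^sup>2) summable_on I" "(\<lambda>k. (norm (b k))\<^sup>2) summable_on I"
  shows "(\<lambda>k. (norm (a k + b k))\<^sup>2) summable_on I"
proof (rule summable_on_comparison_test)
  show "(\<lambda>k. 2 * (norm (a k))\<^sup>2 + 2 * (norm (b k))\<^sup>2) summable_on I"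
    by (intro summable_on_add summable_on_cmult_right assms)
  show "(norm (a k + b k))\<^sup>2 \<le> 2 * (norm (a k))\<^sup>2 + 2 * (norm (b k))\<^sup>2" for k
  proof -
    have "(norm (a k + b k))\<^sup>2 \<le> (norm (a k) + norm (b k))\<^sup>2"
      by (intro power_mono norm_triangle_ineq) simp
    also have "\<dots> \<le> 2 * (norm (a k))\<^sup>2 + 2 * (norm (b k))\<^sup>2"
      using sum_squares_bound[of "norm (a k)" "norm (b k)"] by (simp add: power2_sum)
    finally show ?thesis .
  qed
qed simp

lemma square_summable_scaleC:
  fixes a :: "'i \<Rightarrow> 'a::complex_hilbert"
  assumes "(\<lambda>k. (norm (a k))\<^sup>2) summable_on I"
  shows "(\<lambda>k. (norm (c *\<^sub>C a k))\<^sup>2) summable_on I"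
  using summable_on_cmult_right[OF assms, of "(cmod c)\<^sup>2"] by (simp add: norm_scaleC power_mult_distrib)

lemma cinner_summable:
  fixes a b :: "'i \<Rightarrow> 'a::complex_hilbert"
  assumes "(\<lambda>k. (norm (a k))\<^sup>2) summable_on I" "(\<lambda>k. (norm (b k))\<^sup>2) summable_on I"
  shows "(\<lambda>k. cinner (a k) (b k)) summable_on I"
proof (rule abs_summable_summable, rule Infinite_Sum.abs_summable_on_comparison_test')
  show "(\<lambda>k. (norm (a k))\<^sup>2 + (norm (b k))\<^sup>2) summable_on I"
    by (intro summable_on_add assms)
  show "norm (cinner (a k) (b k)) \<le> (norm (a k))\<^sup>2 + (norm (b k))\<^sup>2" for k
  proof -
    have "0 \<le> norm (a k) * norm (b k)" by simp
    then show ?thesis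
      using cinner_cauchy_schwarz[of "a k" "b k"] sum_squares_bound[of "norm (a k)" "norm (b k)"]
      by linarith
  qed
qed

lemma hardy_add:
  assumes E: "complex_vector.subspace E" and f: "f \<in> hardy_set m E" and g: "g \<in> hardy_set m E"
  shows "f + g \<in> hardy_set m E"
    "k \<in> multi_indices m \<Longrightarrow> taylor_coeff m (f + g) k = taylor_coeff m f k + taylor_coeff m g k"
proof -
  note * = hardyI[of m "f + g" "\<lambda>k. taylor_coeff m f k + taylor_coeff m g k" E]
  have 1: "(f + g) z = 0" if "z \<notin> polydisc m" for z
    using hardyD(1)[OF f that] hardyD(1)[OF g that] by simp
  have 2: "taylor_coeff m f k + taylor_coeff m g k \<in> E" if "k \<in> multi_indices m" for k
    by (intro complex_vector.subspace_add E hardyD(2)[OF f that] hardyD(2)[OF g that])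
  note 3 = square_summable_add[OF hardyD(3)[OF f] hardyD(3)[OF g]]
  note 4 = power_series_add[OF hardyD(4)[OF f] hardyD(4)[OF g]]
  show "f + g \<in> hardy_set m E"
    by (rule *(1)[OF 1 2 3 4])
  show "k \<in> multi_indices m \<Longrightarrow> taylor_coeff m (f + g) k = taylor_coeff m f k + taylor_coeff m g k"
    by (rule *(2)[OF 1 2 3 4])
qed

lemma hardy_scaleC:
  assumes E: "complex_vector.subspace E" and f: "f \<in> hardy_set m E"
  shows "c *\<^sub>C f \<in> hardy_set m E"
    "k \<in> multi_indices m \<Longrightarrow> taylor_coeff m (c *\<^sub>C f) k = c *\<^sub>C taylor_coeff m f k"
proof -
  note * = hardyI[of m "c *\<^sub>C f" "\<lambda>k. c *\<^sub>C taylor_coeff m f k" E]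
  have 1: "(c *\<^sub>C f) z = 0" if "z \<notin> polydisc m" for z
    using hardyD(1)[OF f that] by (simp add: scaleC_fun_apply)
  have 2: "c *\<^sub>C taylor_coeff m f k \<in> E" if "k \<in> multi_indices m" for k
    by (intro complex_vector.subspace_scale E hardyD(2)[OF f that])
  note 3 = square_summable_scaleC[OF hardyD(3)[OF f]]
  note 4 = power_series_scaleC[OF hardyD(4)[OF f]]
  show "c *\<^sub>C f \<in> hardy_set m E"
    by (rule *(1)[OF 1 2 3 4])
  show "k \<in> multi_indices m \<Longrightarrow> taylor_coeff m (c *\<^sub>C f) k = c *\<^sub>C taylor_coeff m f k"
    by (rule *(2)[OF 1 2 3 4])
qed

lemma hardy_zero:
  assumes "complex_vector.subspace E"
  shows "0 \<in> hardy_set m E"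
  by (rule hardyI(1)[where a = "\<lambda>_. 0"]) (simp_all add: complex_vector.subspace_0 assms power_series_def)

lemma hardy_subspace:
  "complex_vector.subspace E \<Longrightarrow> complex_vector.subspace (hardy_set m E)"
  unfolding complex_vector.subspace_def[of "hardy_set m E"]
  using hardy_add(1) hardy_scaleC(1) hardy_zero by blast

lemma hardy_diff:
  assumes "complex_vector.subspace E" "f \<in> hardy_set m E" "g \<in> hardy_set m E"
  shows "f - g \<in> hardy_set m E"
    "k \<in> multi_indices m \<Longrightarrow> taylor_coeff m (f - g) k = taylor_coeff m f k - taylor_coeff m g k"
proof -
  note * = hardy_add[OF assms(1,2) hardy_scaleC(1)[OF assms(1,3), of "-1"]]
  have eq: "f + (-1) *\<^sub>C g = f - g"
    by (simp only: scaleC_minus1 diff_conv_add_uminus)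
  show "f - g \<in> hardy_set m E"
    using *(1) unfolding eq .
  show "taylor_coeff m (f - g) k = taylor_coeff m f k - taylor_coeff m g k" if "k \<in> multi_indices m"
    using *(2)[OF that] hardy_scaleC(2)[OF assms(1,3) that, of "-1"] unfolding eq
    by (simp add: scaleC_minus1)
qed

lemma pts_hardy [simp]: "pts (hardy m E) = hardy_set m E"
  by (simp add: hardy_def)

lemma ip_hardy_has_sum:
  assumes "f \<in> hardy_set m E" "g \<in> hardy_set m E"
  shows "((\<lambda>k. cinner (taylor_coeff m f k) (taylor_coeff m g k)) has_sum ip (hardy m E) f g) (multi_indices m)"
  unfolding hardy_def hspace.simps
  by (intro has_sum_infsum cinner_summable hardyD(3)[OF assms(1)] hardyD(3)[OF assms(2)])

lemma hnorm_hardy_has_sum: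
  assumes "f \<in> hardy_set m E"
  shows "((\<lambda>k. (norm (taylor_coeff m f k))\<^sup>2) has_sum (hnorm (hardy m E) f)\<^sup>2) (multi_indices m)"
    and "ip (hardy m E) f f = of_real ((hnorm (hardy m E) f)\<^sup>2)"
proof -
  let ?s = "\<Sum>\<^sub>\<infinity>k\<in>multi_indices m. (norm (taylor_coeff m f k))\<^sup>2"
  have s: "((\<lambda>k. (norm (taylor_coeff m f k))\<^sup>2) has_sum ?s) (multi_indices m)"
    by (rule has_sum_infsum[OF hardyD(3)[OF assms]])
  have "((\<lambda>k. cinner (taylor_coeff m f k) (taylor_coeff m f k)) has_sum of_real ?s) (multi_indices m)"
    unfolding cinner_self by (rule has_sum_of_real[OF s])
  then have ip: "ip (hardy m E) f f = of_real ?s"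
    using has_sum_unique ip_hardy_has_sum[OF assms assms] by blast
  have "?s \<ge> 0"
    by (rule infsum_nonneg) simp
  then have "(hnorm (hardy m E) f)\<^sup>2 = ?s"
    by (simp add: hnorm_def ip)
  then show "((\<lambda>k. (norm (taylor_coeff m f k))\<^sup>2) has_sum (hnorm (hardy m E) f)\<^sup>2) (multi_indices m)"
    "ip (hardy m E) f f = of_real ((hnorm (hardy m E) f)\<^sup>2)"
    using s ip by simp_all
qed

lemma hnorm_hardy_nonneg:
  assumes "f \<in> hardy_set m E"
  shows "hnorm (hardy m E) f \<ge> 0"
proof -
  have "0 \<le> Re (ip (hardy m E) f f)"
    using hnorm_hardy_has_sum(2)[OF assms] by simp
  then show ?thesis
    unfolding hnorm_def by simp
qed

lemma hnorm_hardyI: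
  assumes "f \<in> hardy_set m E" "((\<lambda>k. (norm (taylor_coeff m f k))\<^sup>2) has_sum s\<^sup>2) (multi_indices m)" "0 \<le> s"
  shows "hnorm (hardy m E) f = s"
  using has_sum_unique[OF hnorm_hardy_has_sum(1)[OF assms(1)] assms(2)] hnorm_hardy_nonneg[OF assms(1)] assms(3)
  by (metis power2_eq_imp_eq)

lemma hardy_eqI:
  assumes "f \<in> hardy_set m E" "g \<in> hardy_set m E"
    and "\<And>k. k \<in> multi_indices m \<Longrightarrow> taylor_coeff m f k = taylor_coeff m g k"
  shows "f = g"
proof
  fix z
  show "f z = g z"
  proof (cases "z \<in> polydisc m")
    case True
    have "((\<lambda>k. multi_power m z k *\<^sub>C taylor_coeff m g k) has_sum f z) (multi_indices m)"
      using hardyD(4)[OF assms(1)] True assms(3) unfolding power_series_def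
      by (metis (no_types, lifting) has_sum_cong)
    then show ?thesis
      using hardyD(4)[OF assms(2)] True has_sum_unique unfolding power_series_def by blast
  qed (simp add: hardyD(1)[OF assms(1)] hardyD(1)[OF assms(2)])
qed

text \<open>Coefficients converge one by one. The Cauchy estimate holds on every finite set of indices, where it
  passes to the limit, and hence for the whole family.\<close>

lemma hardy_complete:
  fixes E :: "'a::complex_hilbert set" and s :: "nat \<Rightarrow> (nat \<Rightarrow> complex) \<Rightarrow> 'a"
  assumes E: "complex_vector.subspace E" "closed E"
    and s: "\<And>i. s i \<in> hardy_set m E"
    and cauchy: "\<And>e. e > 0 \<Longrightarrow> \<exists>N. \<forall>i\<ge>N. \<forall>j\<ge>N. hnorm (hardy m E) (s i - s j) < e"
  shows "\<exists>f\<in>hardy_set m E. (\<lambda>i. hnorm (hardy m E) (s i - f)) \<longlonglongrightarrow> 0"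
proof -
  let ?I = "multi_indices m"
  define a where "a i = taylor_coeff m (s i)" for i
  have aE: "a i k \<in> E" if "k \<in> ?I" for i k
    unfolding a_def by (rule hardyD(2)[OF s that])
  have a_sq: "(\<lambda>k. (norm (a i k))\<^sup>2) summable_on ?I" for i
    unfolding a_def by (rule hardyD(3)[OF s])
  have diff_in: "s i - s j \<in> hardy_set m E" for i j
    by (rule hardy_diff(1)[OF E(1) s s])
  have fin: "(\<Sum>k\<in>F. (norm (a i k - a j k))\<^sup>2) \<le> (hnorm (hardy m E) (s i - s j))\<^sup>2"
    if "finite F" "F \<subseteq> ?I" for F i j
  proof -
    have "(\<Sum>k\<in>F. (norm (taylor_coeff m (s i - s j) k))\<^sup>2) \<le> (hnorm (hardy m E) (s i - s j))\<^sup>2"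
      using hnorm_hardy_has_sum(1)[OF diff_in] that
      by (intro has_sum_mono2[OF has_sum_finite[OF that(1)]]) auto
    moreover have "(\<Sum>k\<in>F. (norm (taylor_coeff m (s i - s j) k))\<^sup>2) = (\<Sum>k\<in>F. (norm (a i k - a j k))\<^sup>2)"
      using that(2) by (intro sum.cong refl) (auto simp: hardy_diff(2)[OF E(1) s s] a_def)
    ultimately show ?thesis by simp
  qed
  have "\<exists>l. (\<lambda>i. a i k) \<longlonglongrightarrow> l" if k: "k \<in> ?I" for k
  proof -
    have "Cauchy (\<lambda>i. a i k)"
    proof (rule CauchyI)
      fix e :: real assume "0 < e"
      then obtain N where N: "\<And>i j. i \<ge> N \<Longrightarrow> j \<ge> N \<Longrightarrow> hnorm (hardy m E) (s i - s j) < e"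
        using cauchy by blast
      have "norm (a i k - a j k) < e" if "i \<ge> N" "j \<ge> N" for i j
      proof -
        have "(norm (a i k - a j k))\<^sup>2 \<le> (hnorm (hardy m E) (s i - s j))\<^sup>2"
          using fin[of "{k}" i j] k by simp
        then have "norm (a i k - a j k) \<le> hnorm (hardy m E) (s i - s j)"
          by (rule power2_le_imp_le) (rule hnorm_hardy_nonneg[OF diff_in])
        then show ?thesis
          using N[OF that] by simp
      qed
      then show "\<exists>M. \<forall>i\<ge>M. \<forall>j\<ge>M. norm (a i k - a j k) < e" by blast
    qed
    then show ?thesis
      using Cauchy_convergent convergent_def by blast
  qed
  then obtain b where b: "\<And>k. k \<in> ?I \<Longrightarrow> (\<lambda>i. a i k) \<longlonglongrightarrow> b k"
    by metis
  have bE: "b k \<in> E" if "k \<in> ?I" for k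
    using closed_sequentially[OF E(2) _ b[OF that]] aE[OF that] by blast
  have fin_lim: "(\<Sum>k\<in>F. (norm (a i k - b k))\<^sup>2) \<le> e\<^sup>2"
    if N: "\<And>j. j \<ge> N \<Longrightarrow> hnorm (hardy m E) (s i - s j) < e" and F: "finite F" "F \<subseteq> ?I" for F i e and N :: nat
  proof (rule LIMSEQ_le_const2)
    show "(\<lambda>j. \<Sum>k\<in>F. (norm (a i k - a j k))\<^sup>2) \<longlonglongrightarrow> (\<Sum>k\<in>F. (norm (a i k - b k))\<^sup>2)"
      using F(2) by (intro tendsto_intros b) auto
    have "(\<Sum>k\<in>F. (norm (a i k - a j k))\<^sup>2) \<le> e\<^sup>2" if "j \<ge> N" for j
    proof -
      have "(hnorm (hardy m E) (s i - s j))\<^sup>2 \<le> e\<^sup>2"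
        using N[OF that] by (intro power_mono hnorm_hardy_nonneg[OF diff_in]) simp
      then show ?thesis
        using fin[OF F, of i j] by simp
    qed
    then show "\<exists>N. \<forall>j\<ge>N. (\<Sum>k\<in>F. (norm (a i k - a j k))\<^sup>2) \<le> e\<^sup>2" by blast
  qed
  have sq_lim: "(\<lambda>k. (norm (a i k - b k))\<^sup>2) summable_on ?I"
    "(\<Sum>\<^sub>\<infinity>k\<in>?I. (norm (a i k - b k))\<^sup>2) \<le> e\<^sup>2"
    if N: "\<And>j. j \<ge> N \<Longrightarrow> hnorm (hardy m E) (s i - s j) < e" for i e and N :: nat
  proof -
    have fl: "(\<Sum>k\<in>F. (norm (a i k - b k))\<^sup>2) \<le> e\<^sup>2" if "finite F" "F \<subseteq> ?I" for F
      using N by (rule fin_lim[OF _ that])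
    show su: "(\<lambda>k. (norm (a i k - b k))\<^sup>2) summable_on ?I"
      using fl by (intro nonneg_bdd_above_summable_on) (auto intro!: bdd_aboveI2)
    show "(\<Sum>\<^sub>\<infinity>k\<in>?I. (norm (a i k - b k))\<^sup>2) \<le> e\<^sup>2"
      by (rule infsum_le_finite_sums[OF su]) (rule fl)
  qed
  obtain N0 where N0: "\<And>j. j \<ge> N0 \<Longrightarrow> hnorm (hardy m E) (s N0 - s j) < 1"
    using cauchy[of 1] by auto
  have "(\<lambda>k. (norm ((-1) *\<^sub>C (a N0 k - b k)))\<^sup>2) summable_on ?I"
    by (rule square_summable_scaleC[OF sq_lim(1)[OF N0]])
  from square_summable_add[OF a_sq[of N0] this]
  have b_sq: "(\<lambda>k. (norm (b k))\<^sup>2) summable_on ?I"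
    by (simp add: scaleC_minus1)
  define f where "f z = (if z \<in> polydisc m then \<Sum>\<^sub>\<infinity>k\<in>?I. multi_power m z k *\<^sub>C b k else 0)" for z
  have ps: "power_series m b f"
    unfolding power_series_def f_def
    using has_sum_infsum[OF abs_summable_summable[OF square_summable_imp_power_series_summable[OF b_sq]]]
    by simp
  have f: "f \<in> hardy_set m E" "\<And>k. k \<in> ?I \<Longrightarrow> taylor_coeff m f k = b k"
    by (rule hardyI[OF _ bE b_sq ps]; simp add: f_def)+
  have "(\<lambda>i. hnorm (hardy m E) (s i - f)) \<longlonglongrightarrow> 0"
  proof (rule LIMSEQ_I)
    fix e :: real assume e: "0 < e"
    then obtain N where N: "\<And>i j. i \<ge> N \<Longrightarrow> j \<ge> N \<Longrightarrow> hnorm (hardy m E) (s i - s j) < e/2"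
      using cauchy[of "e/2"] by auto
    have "norm (hnorm (hardy m E) (s i - f) - 0) < e" if i: "i \<ge> N" for i
    proof -
      have d: "s i - f \<in> hardy_set m E"
        by (rule hardy_diff(1)[OF E(1) s f(1)])
      have "((\<lambda>k. (norm (a i k - b k))\<^sup>2) has_sum (hnorm (hardy m E) (s i - f))\<^sup>2) ?I"
        using hnorm_hardy_has_sum(1)[OF d]
        by (rule iffD1[OF has_sum_cong, rotated]) (simp add: hardy_diff(2)[OF E(1) s f(1)] f(2) a_def)
      then have "(hnorm (hardy m E) (s i - f))\<^sup>2 \<le> (e/2)\<^sup>2"
        using sq_lim(2)[OF N[OF i]] by (simp add: infsumI)
      then have "hnorm (hardy m E) (s i - f) \<le> e/2"
        by (rule power2_le_imp_le) (use e in simp)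
      then show ?thesis
        using e hnorm_hardy_nonneg[OF d] by simp
    qed
    then show "\<exists>N. \<forall>i\<ge>N. norm (hnorm (hardy m E) (s i - f) - 0) < e" by blast
  qed
  then show ?thesis
    using f(1) by blast
qed

lemma hilbert_space_hardy:
  fixes E :: "'a::complex_hilbert set"
  assumes E: "complex_vector.subspace E" "closed E"
  shows "hilbert_space (hardy m E)"
  unfolding hilbert_space_def pts_hardy
proof (intro conjI ballI allI impI)
  let ?K = "hardy m E" and ?I = "multi_indices m"
  show "complex_vector.subspace (hardy_set m E)"
    by (rule hardy_subspace[OF E(1)])
  show "ip ?K (f + g) h = ip ?K f h + ip ?K g h"
    if f: "f \<in> hardy_set m E" and g: "g \<in> hardy_set m E" and h: "h \<in> hardy_set m E" for f g h
  proof (rule has_sum_unique[OF ip_hardy_has_sum[OF hardy_add(1)[OF E(1) f g] h]])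
    have "((\<lambda>k. cinner (taylor_coeff m f k) (taylor_coeff m h k) + cinner (taylor_coeff m g k) (taylor_coeff m h k))
        has_sum ip ?K f h + ip ?K g h) ?I"
      by (intro has_sum_add ip_hardy_has_sum f g h)
    then show "((\<lambda>k. cinner (taylor_coeff m (f + g) k) (taylor_coeff m h k)) has_sum ip ?K f h + ip ?K g h) ?I"
      by (rule iffD1[OF has_sum_cong, rotated]) (simp add: hardy_add(2)[OF E(1) f g] cinner_simps)
  qed
  show "ip ?K (c *\<^sub>C f) g = c * ip ?K f g"
    if f: "f \<in> hardy_set m E" and g: "g \<in> hardy_set m E" for f g c
  proof (rule has_sum_unique[OF ip_hardy_has_sum[OF hardy_scaleC(1)[OF E(1) f] g]])
    have "((\<lambda>k. c * cinner (taylor_coeff m f k) (taylor_coeff m g k)) has_sum c * ip ?K f g) ?I"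
      by (intro has_sum_cmult_right ip_hardy_has_sum f g)
    then show "((\<lambda>k. cinner (taylor_coeff m (c *\<^sub>C f) k) (taylor_coeff m g k)) has_sum c * ip ?K f g) ?I"
      by (rule iffD1[OF has_sum_cong, rotated]) (simp add: hardy_scaleC(2)[OF E(1) f] cinner_simps)
  qed
  show "ip ?K g f = cnj (ip ?K f g)"
    if f: "f \<in> hardy_set m E" and g: "g \<in> hardy_set m E" for f g
  proof (rule has_sum_unique[OF ip_hardy_has_sum[OF g f]])
    have "((\<lambda>k. cnj (cinner (taylor_coeff m f k) (taylor_coeff m g k))) has_sum cnj (ip ?K f g)) ?I"
      unfolding has_sum_cnj_iff by (rule ip_hardy_has_sum[OF f g])
    then show "((\<lambda>k. cinner (taylor_coeff m g k) (taylor_coeff m f k)) has_sum cnj (ip ?K f g)) ?I"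
      unfolding cinner_commute[symmetric] .
  qed
  show "0 \<le> Re (ip ?K f f)" if "f \<in> hardy_set m E" for f
    using hnorm_hardy_has_sum(2)[OF that] by simp
  show "f = 0" if f: "f \<in> hardy_set m E" and zero: "ip ?K f f = 0" for f
  proof (rule hardy_eqI[OF f hardy_zero[OF E(1)]])
    fix k assume k: "k \<in> ?I"
    have "((\<lambda>k. (norm (taylor_coeff m f k))\<^sup>2) has_sum 0) ?I"
      using hnorm_hardy_has_sum[OF f] zero by simp
    then have "(norm (taylor_coeff m f k))\<^sup>2 = 0"
      by (rule nonneg_has_sum_le_0D[OF _ order_refl _ k]) simp
    moreover have "taylor_coeff m (0 :: (nat \<Rightarrow> complex) \<Rightarrow> 'a) k = 0"
      by (rule taylor_coeff_eq[OF _ k]) (simp add: power_series_def)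
    ultimately show "taylor_coeff m f k = taylor_coeff m 0 k" by simp
  qed
  show "\<exists>f\<in>hardy_set m E. (\<lambda>i. hnorm ?K (\<sigma> i - f)) \<longlonglongrightarrow> 0"
    if "range \<sigma> \<subseteq> hardy_set m E \<and> (\<forall>e>0. \<exists>N. \<forall>i\<ge>N. \<forall>j\<ge>N. hnorm ?K (\<sigma> i - \<sigma> j) < e)" for \<sigma>
    by (rule hardy_complete[OF E]) (use that in blast)+
qed

lemma hadj_eqI:
  assumes K: "hilbert_space K" and x: "x \<in> pts K"
    and adj: "\<And>u. u \<in> pts K \<Longrightarrow> ip K (A u) y = ip K u x"
  shows "hadj K A y = x"
  unfolding hadj_def
proof (rule the_equality)
  show "x \<in> pts K \<and> (\<forall>u\<in>pts K. ip K (A u) y = ip K u x)"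
    using x adj by blast
  fix x' assume x': "x' \<in> pts K \<and> (\<forall>u\<in>pts K. ip K (A u) y = ip K u x')"
  note K' = K[unfolded hilbert_space_def]
  have sub: "complex_vector.subspace (pts K)"
    by (rule conjunct1[OF K'])
  have add: "ip K (u + v) w = ip K u w + ip K v w" if "u \<in> pts K" "v \<in> pts K" "w \<in> pts K" for u v w
    using conjunct1[OF conjunct2[OF K']] that by blast
  have scale: "ip K (c *\<^sub>C u) v = c * ip K u v" if "u \<in> pts K" "v \<in> pts K" for c u v
    using conjunct1[OF conjunct2[OF conjunct2[OF K']]] that by blast
  have comm: "ip K v u = cnj (ip K u v)" if "u \<in> pts K" "v \<in> pts K" for u v
    using conjunct1[OF conjunct2[OF conjunct2[OF conjunct2[OF K']]]] that by blast
  have def: "u = 0" if "u \<in> pts K" "ip K u u = 0" for u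
    using conjunct1[OF conjunct2[OF conjunct2[OF conjunct2[OF conjunct2[OF K']]]]] that by blast
  have nx: "(-1) *\<^sub>C x \<in> pts K"
    by (rule complex_vector.subspace_scale[OF sub x])
  define d where "d = x' + (-1) *\<^sub>C x"
  have d: "d \<in> pts K"
    unfolding d_def using x' nx by (intro complex_vector.subspace_add[OF sub]) auto
  have "ip K d x' = ip K d x"
    using x' adj[OF d] d by simp
  then have "ip K x' d = ip K x d"
    using comm[OF d] x' x by simp
  then have "ip K d d = 0"
    using add[of x' "(-1) *\<^sub>C x" d] scale[OF x d, of "-1"] x' nx d by (simp add: d_def)
  then have "d = 0"
    by (rule def[OF d])
  then show "x' = x"
    by (simp add: d_def scaleC_minus1)
qed

section \<open>Multiplication by transfer functions\<close>

lemma fun_upd_in_multi_indices: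
  assumes "l \<in> {1..m}" "g \<in> ({1..m} - {l}) \<rightarrow>\<^sub>E UNIV"
  shows "g(l := j) \<in> multi_indices m"
  using assms by (auto simp: multi_indices_def PiE_def extensional_def)

lemma polydisc_norm_less: "z \<in> polydisc m \<Longrightarrow> l \<in> {1..m} \<Longrightarrow> cmod (z l) < 1"
  by (auto simp: polydisc_def PiE_def Pi_def)

lemma multi_power_shift:
  assumes "l \<in> {1..m}"
  shows "multi_power m z (k(l := k l + i)) = z l ^ i * multi_power m z k"
  using multi_power_fun_upd[OF assms, of z k "k l + i"] multi_power_fun_upd[OF assms, of z k "k l"]
  by (simp add: power_add mult_ac)

context isometric_colligation
begin

lemma response_in_E:
  assumes "\<And>j. j \<le> n \<Longrightarrow> x j \<in> E"
  shows "response x n \<in> E"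
  unfolding response_convolution
  by (intro complex_vector.subspace_sum[OF subspace_E] markov_in_E assms) simp

text \<open>The coefficients are fed into the system along the coordinate \<open>l\<close>, the other exponents being
  parameters.\<close>

definition fibre_response :: "nat \<Rightarrow> ((nat \<Rightarrow> nat) \<Rightarrow> 'a) \<Rightarrow> (nat \<Rightarrow> nat) \<Rightarrow> 'a"
  where "fibre_response l a k = response (\<lambda>j. a (k(l := j))) (k l)"

lemma fibre_response_fun_upd: "fibre_response l a (g(l := j)) = response (\<lambda>i. a (g(l := i))) j"
  by (simp add: fibre_response_def)

lemma fibre_response_norm_has_sum:
  assumes l: "l \<in> {1..m}" and a: "\<And>k. k \<in> multi_indices m \<Longrightarrow> a k \<in> E"
    and sum: "((\<lambda>k. (norm (a k))\<^sup>2) has_sum s) (multi_indices m)"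
  shows "((\<lambda>k. (norm (fibre_response l a k))\<^sup>2) has_sum s) (multi_indices m)"
proof -
  let ?G = "({1..m} - {l}) \<rightarrow>\<^sub>E (UNIV :: nat set)"
  have sum': "((\<lambda>(g, j). (norm (a (g(l := j))))\<^sup>2) has_sum s) (?G \<times> UNIV)"
    using sum has_sum_fibres[OF l, of "\<lambda>k. (norm (a k))\<^sup>2" s] by blast
  define N where "N g = (\<Sum>\<^sub>\<infinity>j. (norm (a (g(l := j))))\<^sup>2)" for g
  have row: "((\<lambda>j. (norm (a (g(l := j))))\<^sup>2) has_sum N g) UNIV" if "g \<in> ?G" for g
    unfolding N_def using summable_on_SigmaD1[OF has_sum_imp_summable[OF sum'] that]
    by (intro has_sum_infsum) simp
  have "(N has_sum s) ?G"
    by (rule has_sum_SigmaD[OF sum']) (simp add: row)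
  moreover have "((\<lambda>j. (norm (response (\<lambda>i. a (g(l := i))) j))\<^sup>2) has_sum N g) UNIV" if "g \<in> ?G" for g
    by (rule response_norm_has_sum[OF a[OF fun_upd_in_multi_indices[OF l that]] row[OF that]])
  ultimately have "((\<lambda>(g, j). (norm (response (\<lambda>i. a (g(l := i))) j))\<^sup>2) has_sum s) (?G \<times> UNIV)"
    by (intro has_sum_Sigma_nonneg[where g = N]) auto
  then show ?thesis
    using has_sum_fibres[OF l, of "\<lambda>k. (norm (fibre_response l a k))\<^sup>2" s]
    unfolding fibre_response_fun_upd by blast
qed

text \<open>The double sum of \<open>z\<^sub>l\<^sup>i z\<^sup>k \<phi>\<^sub>i a\<^sub>k\<close> over \<open>i\<close> and \<open>k\<close> converges absolutely. Collecting the terms in which \<open>k\<close>,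
  shifted by \<open>i\<close> at \<open>l\<close>, is a given multi-index produces the convolution that computes the response.\<close>

lemma power_series_mult_transfer:
  assumes l: "l \<in> {1..m}" and a: "\<And>k. k \<in> multi_indices m \<Longrightarrow> a k \<in> E"
    and sq: "(\<lambda>k. (norm (a k))\<^sup>2) summable_on multi_indices m"
    and ps: "power_series m a f"
  shows "power_series m (fibre_response l a) (mult_op (at_coord l transfer) f)"
  unfolding power_series_def
proof
  let ?I = "multi_indices m"
  fix z assume z: "z \<in> polydisc m"
  define t where "t = z l"
  have t: "cmod t < 1"
    unfolding t_def by (rule polydisc_norm_less[OF z l])
  define P where "P = (\<lambda>(i::nat, k). (t ^ i * multi_power m z k) *\<^sub>C markov i (a k))"
  have fz: "((\<lambda>k. multi_power m z k *\<^sub>C a k) has_sum f z) ?I"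
    using ps z by (simp add: power_series_def)
  have row: "((\<lambda>k. P (i, k)) has_sum t ^ i *\<^sub>C blinfun_apply (coeff i) (f z)) ?I" for i
  proof -
    have "((\<lambda>k. t ^ i *\<^sub>C blinfun_apply (coeff i) (multi_power m z k *\<^sub>C a k))
        has_sum t ^ i *\<^sub>C blinfun_apply (coeff i) (f z)) ?I"
      using has_sum_bounded_linear[OF bounded_linear_scaleC
          has_sum_bounded_linear[OF blinfun.bounded_linear_right[of "coeff i"] fz], of "t ^ i"]
      by (simp add: o_def)
    moreover have "t ^ i *\<^sub>C blinfun_apply (coeff i) (multi_power m z k *\<^sub>C a k) = P (i, k)" if "k \<in> ?I" for k
    proof -
      have "multi_power m z k *\<^sub>C a k \<in> E"
        by (intro complex_vector.subspace_scale[OF subspace_E] a that)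
      then show ?thesis
        by (simp add: coeff_apply_E contraction_opD(2)[OF contraction_markov] P_def scaleC_scaleC)
    qed
    ultimately show ?thesis
      by (rule iffD1[OF has_sum_cong, rotated])
  qed
  have "(\<lambda>(i, k). norm (P (i, k))) summable_on UNIV \<times> ?I"
  proof (rule summable_on_comparison_test)
    define s where "s = (\<Sum>\<^sub>\<infinity>k\<in>?I. norm (multi_power m z k *\<^sub>C a k))"
    have s: "((\<lambda>k. norm (multi_power m z k *\<^sub>C a k)) has_sum s) ?I"
      unfolding s_def by (rule has_sum_infsum[OF square_summable_imp_power_series_summable[OF sq z]])
    have geo: "((\<lambda>i. cmod t ^ i) has_sum (1 / (1 - cmod t))) UNIV"
      using geometric_sums[of "cmod t"] t by (intro sums_nonneg_imp_has_sum) auto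
    have "((\<lambda>(i, k). cmod t ^ i * norm (multi_power m z k *\<^sub>C a k)) has_sum (1 / (1 - cmod t)) * s) (UNIV \<times> ?I)"
    proof (rule has_sum_Sigma_nonneg)
      show "((\<lambda>k. case (i, k) of (i, k) \<Rightarrow> cmod t ^ i * norm (multi_power m z k *\<^sub>C a k)) has_sum cmod t ^ i * s) ?I" for i
        unfolding prod.case by (rule has_sum_cmult_right[OF s])
      show "((\<lambda>i. cmod t ^ i * s) has_sum (1 / (1 - cmod t)) * s) UNIV"
        by (rule has_sum_cmult_left[OF geo])
    qed auto
    then show "(\<lambda>(i, k). cmod t ^ i * norm (multi_power m z k *\<^sub>C a k)) summable_on UNIV \<times> ?I"
      by (rule has_sum_imp_summable)
    show "(case x of (i, k) \<Rightarrow> norm (P (i, k))) \<le> (case x of (i, k) \<Rightarrow> cmod t ^ i * norm (multi_power m z k *\<^sub>C a k))" for x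
    proof (cases x)
      case (Pair i k)
      have "cmod t ^ i * cmod (multi_power m z k) * norm (markov i (a k)) \<le> cmod t ^ i * cmod (multi_power m z k) * norm (a k)"
        by (intro mult_left_mono contraction_opD(3)[OF contraction_markov]) auto
      then show ?thesis
        by (simp add: Pair P_def norm_scaleC norm_mult norm_power mult.assoc)
    qed
  qed (auto simp: case_prod_unfold)
  then have "(\<lambda>x. norm (P x)) summable_on UNIV \<times> ?I"
    by (simp add: case_prod_unfold)
  then have "P summable_on UNIV \<times> ?I"
    by (rule abs_summable_summable)
  moreover have "((\<lambda>i. t ^ i *\<^sub>C blinfun_apply (coeff i) (f z)) has_sum blinfun_apply (transfer t) (f z)) UNIV"
    using transfer_apply_has_sum[OF t] by (simp add: coeff_apply)
  ultimately have total: "(P has_sum blinfun_apply (transfer t) (f z)) (UNIV \<times> ?I)"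
    by (intro has_sum_SigmaI[where g = "\<lambda>i. t ^ i *\<^sub>C blinfun_apply (coeff i) (f z)"] row)
  define Q where "Q = (\<lambda>(k, i). multi_power m z k *\<^sub>C markov i (a (k(l := k l - i))))"
  have upd: "k(l := j) \<in> ?I" if "k \<in> ?I" for k j
    using that l by (auto simp: multi_indices_def PiE_def extensional_def)
  have "(P has_sum blinfun_apply (transfer t) (f z)) (UNIV \<times> ?I)
      \<longleftrightarrow> (Q has_sum blinfun_apply (transfer t) (f z)) (Sigma ?I (\<lambda>k. {..k l}))"
  proof (rule has_sum_reindex_bij_witness[where i = "\<lambda>(k, i). (i, k(l := k l - i))" and j = "\<lambda>(i, k). (k(l := k l + i), i)"])
    fix x :: "nat \<times> (nat \<Rightarrow> nat)" assume x: "x \<in> UNIV \<times> ?I"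
    then obtain i k where ik: "x = (i, k)" "k \<in> ?I" by auto
    show "(case case x of (i, k) \<Rightarrow> (k(l := k l + i), i) of (k, i) \<Rightarrow> (i, k(l := k l - i))) = x"
      by (simp add: ik(1))
    show "(case x of (i, k) \<Rightarrow> (k(l := k l + i), i)) \<in> Sigma ?I (\<lambda>k. {..k l})"
      using upd[OF ik(2)] by (simp add: ik(1))
    show "Q (case x of (i, k) \<Rightarrow> (k(l := k l + i), i)) = P x"
      by (simp add: ik(1) Q_def P_def multi_power_shift[OF l] t_def)
  next
    fix y :: "(nat \<Rightarrow> nat) \<times> nat" assume y: "y \<in> Sigma ?I (\<lambda>k. {..k l})"
    then obtain k i where ki: "y = (k, i)" "k \<in> ?I" "i \<le> k l" by auto
    show "(case case y of (k, i) \<Rightarrow> (i, k(l := k l - i)) of (i, k) \<Rightarrow> (k(l := k l + i), i)) = y"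
      using ki(3) by (simp add: ki(1))
    show "(case y of (k, i) \<Rightarrow> (i, k(l := k l - i))) \<in> UNIV \<times> ?I"
      using upd[OF ki(2)] by (simp add: ki(1))
  qed simp
  with total have "(Q has_sum blinfun_apply (transfer t) (f z)) (Sigma ?I (\<lambda>k. {..k l}))"
    by blast
  then have "((\<lambda>k. multi_power m z k *\<^sub>C fibre_response l a k) has_sum blinfun_apply (transfer t) (f z)) ?I"
  proof (rule has_sum_SigmaD)
    show "((\<lambda>i. Q (k, i)) has_sum multi_power m z k *\<^sub>C fibre_response l a k) {..k l}" for k
      by (rule has_sum_finiteI) (auto simp: Q_def fibre_response_def response_convolution complex_vector.scale_sum_right)
  qed
  then show "((\<lambda>k. multi_power m z k *\<^sub>C fibre_response l a k) has_sum mult_op (at_coord l transfer) f z) ?I"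
    by (simp add: mult_op_def at_coord_def t_def)
qed

lemma mult_transfer_hardy:
  assumes l: "l \<in> {1..m}" and f: "f \<in> hardy_set m E"
  shows "mult_op (at_coord l transfer) f \<in> hardy_set m E"
    "k \<in> multi_indices m \<Longrightarrow>
      taylor_coeff m (mult_op (at_coord l transfer) f) k = fibre_response l (taylor_coeff m f) k"
    "hnorm (hardy m E) (mult_op (at_coord l transfer) f) = hnorm (hardy m E) f"
proof -
  let ?a = "taylor_coeff m f" and ?g = "mult_op (at_coord l transfer) f"
  note ps = power_series_mult_transfer[OF l hardyD(2)[OF f] hardyD(3)[OF f] hardyD(4)[OF f]]
  note sum = fibre_response_norm_has_sum[OF l hardyD(2)[OF f] hnorm_hardy_has_sum(1)[OF f]]
  have vanish: "?g z = 0" if "z \<notin> polydisc m" for z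
    using hardyD(1)[OF f that] by (simp add: mult_op_def)
  have inE: "fibre_response l ?a k \<in> E" if "k \<in> multi_indices m" for k
    unfolding fibre_response_def using that l
    by (intro response_in_E hardyD(2)[OF f]) (auto simp: multi_indices_def PiE_def extensional_def)
  show 1: "?g \<in> hardy_set m E"
    by (rule hardyI(1)[OF vanish inE has_sum_imp_summable[OF sum] ps])
  have 2: "taylor_coeff m ?g k = fibre_response l ?a k" if "k \<in> multi_indices m" for k
    by (rule taylor_coeff_eq[OF ps that])
  then show "k \<in> multi_indices m \<Longrightarrow> taylor_coeff m ?g k = fibre_response l ?a k" .
  have eq: "(norm (taylor_coeff m ?g k))\<^sup>2 = (norm (fibre_response l ?a k))\<^sup>2" if "k \<in> multi_indices m" for k
    by (simp only: 2[OF that])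
  have "((\<lambda>k. (norm (taylor_coeff m ?g k))\<^sup>2) has_sum (hnorm (hardy m E) f)\<^sup>2) (multi_indices m)"
    by (subst has_sum_cong[OF eq], assumption, rule sum)
  then show "hnorm (hardy m E) ?g = hnorm (hardy m E) f"
    by (rule hnorm_hardyI[OF 1 _ hnorm_hardy_nonneg[OF f]])
qed

lemma mult_transfer_hisometry:
  assumes l: "l \<in> {1..m}"
  shows "hisometry (hardy m E) (hardy m E) (mult_op (at_coord l transfer))"
  unfolding hisometry_def linear_between_def pts_hardy
proof (intro conjI ballI allI funcsetI)
  let ?M = "mult_op (at_coord l transfer)"
  show "?M f \<in> hardy_set m E" "hnorm (hardy m E) (?M f) = hnorm (hardy m E) f" if "f \<in> hardy_set m E" for f
    using mult_transfer_hardy[OF l that] by auto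
  show "?M (f + g) = ?M f + ?M g" for f g
    by (simp add: mult_op_def fun_eq_iff blinfun.add_right)
  show "?M (c *\<^sub>C f) = c *\<^sub>C ?M f" if f: "f \<in> hardy_set m E" for c f
  proof
    fix z
    show "?M (c *\<^sub>C f) z = (c *\<^sub>C ?M f) z"
    proof (cases "z \<in> polydisc m")
      case True
      then show ?thesis
        using transfer_in_bounded_ops[OF polydisc_norm_less[OF True l]]
        by (simp add: mult_op_def scaleC_fun_apply at_coord_def bounded_ops_def)
    qed (simp add: mult_op_def scaleC_fun_apply hardyD(1)[OF f])
  qed
qed

text \<open>\<open>response_pairing\<close> on every fibre; \<open>\<kappa> g\<close> is the sequence of states that the orbit of coefficients of \<open>f\<close>
  and \<open>h\<close> passes through.\<close>

lemma mult_transfer_adjoint: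
  assumes l: "l \<in> {1..m}" and u: "u \<in> hardy_set m E" and f: "f \<in> hardy_set m E" and h: "h \<in> hardy_set m E"
    and V: "\<And>g j. g \<in> ({1..m} - {l}) \<rightarrow>\<^sub>E UNIV \<Longrightarrow>
      V (taylor_coeff m f (g(l := j)), \<kappa> g j) = (taylor_coeff m h (g(l := j)), \<kappa> g (Suc j))"
    and \<kappa>: "\<And>g j. norm (\<kappa> g j) \<le> C"
  shows "ip (hardy m E) (mult_op (at_coord l transfer) u) h = ip (hardy m E) u f"
proof -
  let ?G = "({1..m} - {l}) \<rightarrow>\<^sub>E (UNIV :: nat set)" and ?K = "hardy m E"
  let ?M = "mult_op (at_coord l transfer)" and ?t = "taylor_coeff m"
  note Mu = mult_transfer_hardy(1)[OF l u]
  have 1: "((\<lambda>(g, j). cinner (?t (?M u) (g(l := j))) (?t h (g(l := j)))) has_sum ip ?K (?M u) h) (?G \<times> UNIV)"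
    using has_sum_fibres[OF l, of "\<lambda>k. cinner (?t (?M u) k) (?t h k)"] ip_hardy_has_sum[OF Mu h] by blast
  have 2: "((\<lambda>(g, j). cinner (?t u (g(l := j))) (?t f (g(l := j)))) has_sum ip ?K u f) (?G \<times> UNIV)"
    using has_sum_fibres[OF l, of "\<lambda>k. cinner (?t u k) (?t f k)"] ip_hardy_has_sum[OF u f] by blast
  have 3: "((\<lambda>(g, j). (norm (?t u (g(l := j))))\<^sup>2) has_sum (hnorm ?K u)\<^sup>2) (?G \<times> UNIV)"
    using has_sum_fibres[OF l, of "\<lambda>k. (norm (?t u k))\<^sup>2"] hnorm_hardy_has_sum(1)[OF u] by blast
  define r1 where "r1 g = (\<Sum>\<^sub>\<infinity>j. cinner (?t (?M u) (g(l := j))) (?t h (g(l := j))))" for g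
  define r2 where "r2 g = (\<Sum>\<^sub>\<infinity>j. cinner (?t u (g(l := j))) (?t f (g(l := j))))" for g
  have r1: "((\<lambda>j. cinner (?t (?M u) (g(l := j))) (?t h (g(l := j)))) has_sum r1 g) UNIV" if "g \<in> ?G" for g
    unfolding r1_def using summable_on_SigmaD1[OF has_sum_imp_summable[OF 1] that]
    by (intro has_sum_infsum) simp
  have r2: "((\<lambda>j. cinner (?t u (g(l := j))) (?t f (g(l := j)))) has_sum r2 g) UNIV" if "g \<in> ?G" for g
    unfolding r2_def using summable_on_SigmaD1[OF has_sum_imp_summable[OF 2] that]
    by (intro has_sum_infsum) simp
  have eq: "r1 g = r2 g" if g: "g \<in> ?G" for g
  proof (rule response_pairing[where x = "\<lambda>j. ?t u (g(l := j))" and f = "\<lambda>j. ?t f (g(l := j))"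
        and g = "\<lambda>j. ?t h (g(l := j))" and k = "\<kappa> g" and C = C])
    note I = fun_upd_in_multi_indices[OF l g]
    show "?t u (g(l := j)) \<in> E" for j
      by (rule hardyD(2)[OF u I])
    have "(\<lambda>j. (norm (?t u (g(l := j))))\<^sup>2) summable_on UNIV"
      using summable_on_SigmaD1[OF has_sum_imp_summable[OF 3] g] by simp
    then show "summable (\<lambda>j. (norm (?t u (g(l := j))))\<^sup>2)"
      using has_sum_imp_sums has_sum_infsum sums_summable by blast
    show "V (?t f (g(l := j)), \<kappa> g j) = (?t h (g(l := j)), \<kappa> g (Suc j))" for j
      by (rule V[OF g])
    show "norm (\<kappa> g j) \<le> C" for j
      by (rule \<kappa>)
    show "(\<lambda>j. cinner (response (\<lambda>j. ?t u (g(l := j))) j) (?t h (g(l := j)))) sums r1 g"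
      using has_sum_imp_sums[OF r1[OF g]]
      by (simp only: mult_transfer_hardy(2)[OF l u I] fibre_response_fun_upd)
    show "(\<lambda>j. cinner (?t u (g(l := j))) (?t f (g(l := j)))) sums r2 g"
      by (rule has_sum_imp_sums[OF r2[OF g]])
  qed
  have "(r1 has_sum ip ?K (?M u) h) ?G"
    by (rule has_sum_SigmaD[OF 1]) (simp add: r1)
  moreover have "(r2 has_sum ip ?K u f) ?G"
    by (rule has_sum_SigmaD[OF 2]) (simp add: r2)
  then have "(r1 has_sum ip ?K u f) ?G"
    by (rule iffD1[OF has_sum_cong, rotated]) (simp add: eq)
  ultimately show ?thesis
    by (rule has_sum_unique)
qed

lemma inner_function_transfer: "inner_function 1 E (at_coord 1 transfer)"
proof -
  have 1: "(1::nat) \<in> {1..1}" by simp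
  have "at_coord 1 transfer \<in> H_infty 1 E"
    unfolding H_infty_def
  proof (intro CollectI conjI funcsetI)
    show "at_coord 1 transfer z \<in> bounded_ops E" if "z \<in> polydisc 1" for z
      using transfer_in_bounded_ops[OF polydisc_norm_less[OF that 1]] by (simp add: at_coord_def)
    show "bounded (at_coord 1 transfer ` polydisc 1)"
      using norm_transfer_le[OF polydisc_norm_less[OF _ 1]] by (auto simp: bounded_iff at_coord_def)
    show "\<exists>A\<in>multi_indices 1 \<rightarrow> bounded_ops E. power_series 1 A (at_coord 1 transfer)"
    proof (rule bexI[of _ "\<lambda>k. coeff (k 1)"])
      show "(\<lambda>k. coeff (k 1)) \<in> multi_indices 1 \<rightarrow> bounded_ops E"
        by (auto intro: coeff_in_bounded_ops)
      show "power_series 1 (\<lambda>k. coeff (k 1)) (at_coord 1 transfer)"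
        unfolding power_series_def
      proof
        fix z assume "z \<in> polydisc 1"
        then have "((\<lambda>n. z 1 ^ n *\<^sub>C coeff n) has_sum transfer (z 1)) UNIV"
          by (intro transfer_has_sum polydisc_norm_less[OF _ 1])
        also have "?this \<longleftrightarrow> ((\<lambda>k. multi_power 1 z k *\<^sub>C coeff (k 1)) has_sum transfer (z 1)) (multi_indices 1)"
          by (rule has_sum_reindex_bij_witness[where i = "\<lambda>k. k 1" and j = "\<lambda>n. (\<lambda>_. undefined)(1 := n)"])
            (auto simp: multi_indices_def multi_power_def PiE_def extensional_def fun_eq_iff)
        finally show "((\<lambda>k. multi_power 1 z k *\<^sub>C coeff (k 1)) has_sum at_coord 1 transfer z) (multi_indices 1)"
          by (simp add: at_coord_def)
      qed
    qed
  qed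
  then show ?thesis
    using mult_transfer_hisometry[OF 1] by (simp add: inner_function_def)
qed

end

section \<open>Coordinate multipliers\<close>

text \<open>Interchanging the two components is the colligation of the transfer function \<open>z \<mapsto> z\<close>: it delays
  its input by one step.\<close>

lemma swap_colligation:
  fixes B :: "'a::complex_hilbert set"
  assumes "finite B" "orthonormal B"
  shows "isometric_colligation prod.swap (cspan B) (cspan B) B"
proof
  show "linear_isometry (prod.swap :: 'a \<times> 'a \<Rightarrow> 'a \<times> 'a)"
    by (simp add: linear_isometry_def clinear_map_def scaleC_prod_def norm_prod_def add.commute prod_eq_iff)
  show "finite_cdim (cspan B)"
    using assms(1) unfolding finite_cdim_def by blast
qed (use assms complex_vector.subspace_span in auto)

lemma swap_transfer:
  fixes B :: "'a::complex_hilbert set"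
  assumes B: "finite B" "orthonormal B" and z: "cmod z < 1"
  shows "blinfun_apply (isometric_colligation.transfer prod.swap B z) x = z *\<^sub>C fourier_sum B x"
proof -
  interpret W: isometric_colligation prod.swap "cspan B" "cspan B" B
    by (rule swap_colligation[OF B])
  have pow: "(W.trans ^^ i) y = (if i = 0 then y else 0)" for i y
    by (induction i) (auto simp: W.trans_def)
  have "W.markov n y = (if n = 1 then y else 0)" for n y
    by (cases n) (auto simp: W.markov_def pow W.inject_def)
  then have eq: "z ^ n *\<^sub>C W.markov n (fourier_sum B x) = (if n = 1 then z *\<^sub>C fourier_sum B x else 0)" for n
    by simp
  have "((\<lambda>n::nat. if n = 1 then z *\<^sub>C fourier_sum B x else 0) has_sum blinfun_apply (W.transfer z) x) UNIV"
    using W.transfer_apply_has_sum[OF z, of x] unfolding eq .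
  moreover have "((\<lambda>n::nat. if n = 1 then z *\<^sub>C fourier_sum B x else 0) has_sum z *\<^sub>C fourier_sum B x) (UNIV :: nat set)"
    by (rule has_sum_finite_neutralI[of "{1}"]) auto
  ultimately show ?thesis
    by (rule has_sum_unique)
qed

lemma hardy_fourier_sum:
  assumes B: "finite B" "orthonormal B" and f: "f \<in> hardy_set m (cspan B)" and z: "z \<in> polydisc m"
  shows "fourier_sum B (f z) = f z"
proof -
  have lin: "contraction_op (fourier_sum B)"
    using isometric_colligation.contraction_op_fourier_sum[OF swap_colligation[OF B]] .
  have s: "((\<lambda>k. multi_power m z k *\<^sub>C taylor_coeff m f k) has_sum f z) (multi_indices m)"
    using hardyD(4)[OF f] z by (simp add: power_series_def)
  have "((\<lambda>k. fourier_sum B (multi_power m z k *\<^sub>C taylor_coeff m f k)) has_sum fourier_sum B (f z)) (multi_indices m)"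
    using has_sum_bounded_linear[OF contraction_op_bounded_linear[OF lin] s] by (simp add: o_def)
  moreover have "fourier_sum B (multi_power m z k *\<^sub>C taylor_coeff m f k) = multi_power m z k *\<^sub>C taylor_coeff m f k"
    if "k \<in> multi_indices m" for k
    by (intro fourier_sum_eq B complex_vector.span_scale hardyD(2)[OF f that])
  ultimately have "((\<lambda>k. multi_power m z k *\<^sub>C taylor_coeff m f k) has_sum fourier_sum B (f z)) (multi_indices m)"
    by (rule iffD1[OF has_sum_cong, rotated])
  then show ?thesis
    using s by (rule has_sum_unique)
qed

lemma mult_coord_eq_mult_op:
  assumes B: "finite B" "orthonormal B" and l: "l \<in> {1..m}" and f: "f \<in> hardy_set m (cspan B)"
  shows "mult_coord l f = mult_op (at_coord l (isometric_colligation.transfer prod.swap B)) f"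
proof
  fix z
  show "mult_coord l f z = mult_op (at_coord l (isometric_colligation.transfer prod.swap B)) f z"
  proof (cases "z \<in> polydisc m")
    case True
    then show ?thesis
      using swap_transfer[OF B polydisc_norm_less[OF True l]] hardy_fourier_sum[OF B f True]
      by (simp add: mult_coord_def mult_op_def at_coord_def)
  qed (simp add: mult_coord_def mult_op_def hardyD(1)[OF f])
qed

lemma mult_coord_hisometry:
  assumes B: "finite B" "orthonormal B" and l: "l \<in> {1..m}"
  shows "hisometry (hardy m (cspan B)) (hardy m (cspan B)) (mult_coord l)"
proof -
  interpret W: isometric_colligation prod.swap "cspan B" "cspan B" B
    by (rule swap_colligation[OF B])
  note eq = mult_coord_eq_mult_op[OF B l]
  show ?thesis
    unfolding hisometry_def linear_between_def pts_hardy
  proof (intro conjI ballI allI funcsetI)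
    show "mult_coord l f \<in> hardy_set m (cspan B)" "hnorm (hardy m (cspan B)) (mult_coord l f) = hnorm (hardy m (cspan B)) f"
      if "f \<in> hardy_set m (cspan B)" for f
      unfolding eq[OF that] by (rule W.mult_transfer_hardy[OF l that])+
    show "mult_coord l (f + g) = mult_coord l f + mult_coord l g" for f g :: "(nat \<Rightarrow> complex) \<Rightarrow> 'a"
      by (simp add: mult_coord_def fun_eq_iff scaleC_add_right)
    show "mult_coord l (c *\<^sub>C f) = c *\<^sub>C mult_coord l f" for c and f :: "(nat \<Rightarrow> complex) \<Rightarrow> 'a"
      by (simp add: mult_coord_def fun_eq_iff scaleC_fun_apply scaleC_scaleC mult.commute)
  qed
qed

section \<open>The canonical isometry of a pure Szego tuple\<close>

lemma tuple_power_fun_upd: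
  assumes "\<And>i j x. i \<in> {1..m} \<Longrightarrow> j \<in> {1..m} \<Longrightarrow> U i (U j x) = U j (U i x)" and "l \<in> {1..m}"
  shows "tuple_power m U (g(l := r)) x = (U l ^^ r) (tuple_power m U (g(l := 0)) x)"
  using assms
proof (induction m arbitrary: x)
  case (Suc m)
  show ?case
  proof (cases "l = Suc m")
    case True
    have "tuple_power m U (g(l := s)) = tuple_power m U g" for s
      by (rule tuple_power_cong) (auto simp: True)
    moreover have "tuple_power m U g ((U l ^^ r) y) = (U l ^^ r) (tuple_power m U g y)" for y
    proof (rule tuple_power_commute)
      fix i y assume "i \<in> {1..m}"
      then have "U i (U l w) = U l (U i w)" for w
        using Suc.prems by simp
      then show "U i ((U l ^^ r) y) = (U l ^^ r) (U i y)"
        by (induction r) simp_all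
    qed
    ultimately show ?thesis
      by (simp add: True del: fun_upd_apply) (simp add: fun_upd_same)
  next
    case False
    then have "l \<in> {1..m}" using Suc.prems(2) by auto
    then show ?thesis
      using Suc.IH[of "(U (Suc m) ^^ g (Suc m)) x"] Suc.prems(1) False by simp
  qed
qed simp

text \<open>Here \<open>D\<close> plays the role of the square root of the defect operator.\<close>

locale szego_dilation =
  fixes m :: nat and R :: "nat \<Rightarrow> 'a::complex_hilbert \<Rightarrow> 'a" and D :: "'a \<Rightarrow> 'a" and B :: "'a set"
  assumes commuting: "R \<in> commuting_contractions m whole"
    and pure: "pure_tuple m R" and positive: "positive_op (szego_inv m R)"
    and basis: "finite B" "orthonormal B"
    and D: "clinear_map D" "range D \<subseteq> cspan B" "\<And>x y. cinner (D x) (D y) = cinner (szego_inv m R x) y"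
begin

abbreviation adj_power :: "(nat \<Rightarrow> nat) \<Rightarrow> 'a \<Rightarrow> 'a"
  where "adj_power \<equiv> tuple_power m (\<lambda>i. hadj whole (R i))"

definition dilation :: "'a \<Rightarrow> (nat \<Rightarrow> complex) \<Rightarrow> 'a"
  where "dilation h z =
    (if z \<in> polydisc m then \<Sum>\<^sub>\<infinity>k\<in>multi_indices m. multi_power m z k *\<^sub>C D (adj_power k h) else 0)"

lemma contraction_R: "i \<in> {1..m} \<Longrightarrow> contraction_op (R i)"
  using commuting by (simp add: commuting_contractions_whole)

lemma adj_commute: "i \<in> {1..m} \<Longrightarrow> j \<in> {1..m} \<Longrightarrow>
    hadj whole (R i) (hadj whole (R j) x) = hadj whole (R j) (hadj whole (R i) x)"
  using commuting by (intro hadj_commute) (auto simp: commuting_contractions_whole)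

lemma norm_D: "(norm (D x))\<^sup>2 = Re (cinner (szego_inv m R x) x)"
  using Re_cinner_self[of "D x"] by (simp add: D(3))

lemma dilation_hardy:
  shows "dilation h \<in> hardy_set m (cspan B)"
    "k \<in> multi_indices m \<Longrightarrow> taylor_coeff m (dilation h) k = D (adj_power k h)"
    "hnorm (hardy m (cspan B)) (dilation h) = norm h"
proof -
  have sum: "((\<lambda>k. (norm (D (adj_power k h)))\<^sup>2) has_sum (norm h)\<^sup>2) (multi_indices m)"
    unfolding norm_D by (rule szego_inv_has_sum[OF commuting pure positive])
  have ps: "power_series m (\<lambda>k. D (adj_power k h)) (dilation h)"
    unfolding power_series_def dilation_def
    using has_sum_infsum[OF abs_summable_summable[OF
        square_summable_imp_power_series_summable[OF has_sum_imp_summable[OF sum]]]]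
    by simp
  have DE: "D x \<in> cspan B" for x
    using D(2) by blast
  show 1: "dilation h \<in> hardy_set m (cspan B)"
    by (rule hardyI(1)[OF _ DE has_sum_imp_summable[OF sum] ps]) (simp add: dilation_def)
  have 2: "taylor_coeff m (dilation h) k = D (adj_power k h)" if "k \<in> multi_indices m" for k
    by (rule taylor_coeff_eq[OF ps that])
  then show "k \<in> multi_indices m \<Longrightarrow> taylor_coeff m (dilation h) k = D (adj_power k h)" .
  have eq: "(norm (taylor_coeff m (dilation h) k))\<^sup>2 = (norm (D (adj_power k h)))\<^sup>2" if "k \<in> multi_indices m" for k
    by (simp only: 2[OF that])
  have "((\<lambda>k. (norm (taylor_coeff m (dilation h) k))\<^sup>2) has_sum (norm h)\<^sup>2) (multi_indices m)"
    by (subst has_sum_cong[OF eq], assumption, rule sum)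
  then show "hnorm (hardy m (cspan B)) (dilation h) = norm h"
    by (rule hnorm_hardyI[OF 1]) simp
qed

lemma contraction_adj_power: "contraction_op (adj_power k)"
  by (intro contraction_op_tuple_power contraction_op_hadj contraction_R)

lemma dilation_hisometry: "hisometry whole (hardy m (cspan B)) dilation"
  unfolding hisometry_def linear_between_def pts_hardy
proof (intro conjI ballI allI funcsetI)
  have sub: "complex_vector.subspace (cspan B)"
    by (rule complex_vector.subspace_span)
  show "dilation x \<in> hardy_set m (cspan B)" for x
    by (rule dilation_hardy(1))
  show "hnorm (hardy m (cspan B)) (dilation x) = hnorm whole x" for x
    unfolding dilation_hardy(3) by (simp add: hnorm_def whole_def Re_cinner_self)
  show "dilation (x + y) = dilation x + dilation y" for x y
    by (rule hardy_eqI[OF dilation_hardy(1) hardy_add(1)[OF sub dilation_hardy(1) dilation_hardy(1)]])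
      (simp add: hardy_add(2)[OF sub dilation_hardy(1) dilation_hardy(1)] dilation_hardy(2)
        contraction_opD(1)[OF contraction_adj_power] clinear_mapD(1)[OF D(1)])
  show "dilation (c *\<^sub>C x) = c *\<^sub>C dilation x" for c x
    by (rule hardy_eqI[OF dilation_hardy(1) hardy_scaleC(1)[OF sub dilation_hardy(1)]])
      (simp add: hardy_scaleC(2)[OF sub dilation_hardy(1)] dilation_hardy(2)
        contraction_opD(2)[OF contraction_adj_power] clinear_mapD(2)[OF D(1)])
qed

lemma hilbert_space_target: "hilbert_space (hardy m (cspan B))"
proof (rule hilbert_space_hardy)
  show "complex_vector.subspace (cspan B)"
    by (rule complex_vector.subspace_span)
  have "bounded_linear (fourier_sum B)"
    using isometric_colligation.contraction_op_fourier_sum[OF swap_colligation[OF basis]]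
    by (rule contraction_op_bounded_linear)
  then have "closed {x. fourier_sum B x = x}"
    by (intro closed_Collect_eq[OF linear_continuous_on continuous_on_id])
  moreover have "x \<in> cspan B \<longleftrightarrow> fourier_sum B x = x" for x
    using fourier_sum_eq[OF basis, of x] fourier_sum_in_span[of B x] by metis
  then have "cspan B = {x. fourier_sum B x = x}"
    by blast
  ultimately show "closed (cspan B)" by simp
qed

text \<open>The coefficients of \<open>\<Psi> h\<close> along the coordinate \<open>l\<close> are \<open>D\<close> applied to an orbit of \<open>R\<^sub>l\<^sup>*\<close>, and \<open>G\<close> applied to
  that orbit is the sequence of states which \<open>mult_transfer_adjoint\<close> asks for. Here \<open>A\<close> stands for the adjoint of
  the operator that is dilated.\<close>

lemma dilation_intertwines:
  assumes C: "isometric_colligation V (cspan B) F B" and l: "l \<in> {1..m}"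
    and A: "\<And>i x. i \<in> {1..m} \<Longrightarrow> hadj whole (R i) (A x) = A (hadj whole (R i) x)"
    and V: "\<And>x. V (D (A x), G x) = (D x, G (hadj whole (R l) x))"
    and G: "\<And>x. norm (G x) \<le> norm x * C"
  shows "hadj (hardy m (cspan B)) (mult_op (at_coord l (isometric_colligation.transfer V B))) (dilation h) = dilation (A h)"
proof (rule hadj_eqI[OF hilbert_space_target])
  interpret isometric_colligation V "cspan B" F B by fact
  show "dilation (A h) \<in> pts (hardy m (cspan B))"
    by (simp add: dilation_hardy(1))
  fix u assume "u \<in> pts (hardy m (cspan B))"
  then have u: "u \<in> hardy_set m (cspan B)" by simp
  let ?L = "hadj whole (R l)"
  have upd: "adj_power (g(l := j)) x = (?L ^^ j) (adj_power (g(l := 0)) x)" for g j x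
    by (rule tuple_power_fun_upd[where U = "\<lambda>i. hadj whole (R i)", OF adj_commute l])
  show "ip (hardy m (cspan B)) (mult_op (at_coord l transfer) u) (dilation h) = ip (hardy m (cspan B)) u (dilation (A h))"
  proof (rule mult_transfer_adjoint[OF l u dilation_hardy(1) dilation_hardy(1),
        where \<kappa> = "\<lambda>g j. G (adj_power (g(l := j)) h)" and C = "norm h * \<bar>C\<bar>"])
    fix g :: "nat \<Rightarrow> nat" and j assume g: "g \<in> ({1..m} - {l}) \<rightarrow>\<^sub>E UNIV"
    have "adj_power k (A h) = A (adj_power k h)" for k
      by (rule tuple_power_commute) (rule A)
    moreover have "adj_power (g(l := Suc j)) h = ?L (adj_power (g(l := j)) h)"
      using upd[of g "Suc j" h] upd[of g j h] by simp
    ultimately show "V (taylor_coeff m (dilation (A h)) (g(l := j)), G (adj_power (g(l := j)) h))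
        = (taylor_coeff m (dilation h) (g(l := j)), G (adj_power (g(l := Suc j)) h))"
      by (simp add: dilation_hardy(2) fun_upd_in_multi_indices[OF l g] V)
  next
    fix g :: "nat \<Rightarrow> nat" and j
    let ?y = "adj_power (g(l := j)) h"
    have "norm (G ?y) \<le> norm ?y * C"
      by (rule G)
    also have "\<dots> \<le> norm ?y * \<bar>C\<bar>"
      by (intro mult_left_mono) auto
    also have "\<dots> \<le> norm h * \<bar>C\<bar>"
      by (intro mult_right_mono contraction_opD(3)[OF contraction_adj_power]) auto
    finally show "norm (G ?y) \<le> norm h * \<bar>C\<bar>" .
  qed
qed

end

lemma factor_norm_bound:
  assumes "selfadjoint_op S" "\<And>x y. cinner (D x) (D y) = cinner (S x) y"
  obtains C where "\<And>x. norm (D x) \<le> norm x * C"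
proof -
  obtain K where K: "\<And>x. norm (S x) \<le> norm x * K"
    using assms(1) by (auto simp: selfadjoint_op_def)
  have "norm (D x) \<le> norm x * sqrt \<bar>K\<bar>" for x
  proof (rule power2_le_imp_le)
    have "(norm (D x))\<^sup>2 = Re (cinner (S x) x)"
      using Re_cinner_self[of "D x"] by (simp add: assms(2))
    also have "\<dots> \<le> norm (S x) * norm x"
      using complex_Re_le_cmod cinner_cauchy_schwarz order_trans by blast
    also have "\<dots> \<le> norm x * \<bar>K\<bar> * norm x"
      using K[of x] mult_left_mono[OF abs_ge_self[of K] norm_ge_zero[of x]]
      by (intro mult_right_mono) auto
    also have "\<dots> = (norm x * sqrt \<bar>K\<bar>)\<^sup>2"
      by (simp add: power_mult_distrib power2_eq_square)
    finally show "(norm (D x))\<^sup>2 \<le> (norm x * sqrt \<bar>K\<bar>)\<^sup>2" .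
  qed simp
  then show ?thesis
    using that by blast
qed

lemma closure_complex_subspace:
  assumes "complex_vector.subspace (E :: 'a::complex_hilbert set)"
  shows "complex_vector.subspace (closure E)"
  unfolding complex_vector.subspace_def
proof (intro conjI ballI allI)
  show "0 \<in> closure E"
    using closure_subset complex_vector.subspace_0[OF assms] by blast
  show "x + y \<in> closure E" if xy: "x \<in> closure E" "y \<in> closure E" for x y
  proof -
    obtain s t where "\<And>n. s n \<in> E" "s \<longlonglongrightarrow> x" "\<And>n. t n \<in> E" "t \<longlonglongrightarrow> y"
      using xy unfolding closure_sequential by blast
    then show ?thesis
      using complex_vector.subspace_add[OF assms] tendsto_add[of s x sequentially t y]
      unfolding closure_sequential by (intro exI[of _ "\<lambda>n. s n + t n"]) auto
  qed
  show "c *\<^sub>C x \<in> closure E" if x: "x \<in> closure E" for c x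
  proof -
    obtain s where "\<And>n. s n \<in> E" "s \<longlonglongrightarrow> x"
      using x unfolding closure_sequential by blast
    then show ?thesis
      using complex_vector.subspace_scale[OF assms] bounded_linear.tendsto[OF bounded_linear_scaleC[of c], of s x sequentially]
      unfolding closure_sequential by (intro exI[of _ "\<lambda>n. c *\<^sub>C s n"]) auto
  qed
qed

lemma defect_space_subspace:
  assumes "T \<in> commuting_contractions m whole"
  shows "complex_vector.subspace (defect_space m T)" "range (szego_inv m T) \<subseteq> defect_space m T"
proof -
  note S = selfadjoint_op_szego_inv[OF assms]
  have "complex_vector.subspace (range (szego_inv m T))"
    unfolding complex_vector.subspace_def
  proof (intro conjI ballI allI)
    show "0 \<in> range (szego_inv m T)"
      using selfadjoint_opD(5)[OF S] by (metis rangeI)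
    show "x + y \<in> range (szego_inv m T)" if "x \<in> range (szego_inv m T)" "y \<in> range (szego_inv m T)" for x y
      using that selfadjoint_opD(1)[OF S, symmetric] by auto
    show "c *\<^sub>C x \<in> range (szego_inv m T)" if "x \<in> range (szego_inv m T)" for c x
      using that selfadjoint_opD(2)[OF S, symmetric] by auto
  qed
  then show "complex_vector.subspace (defect_space m T)"
    unfolding defect_space_def by (rule closure_complex_subspace)
  show "range (szego_inv m T) \<subseteq> defect_space m T"
    unfolding defect_space_def by (rule closure_subset)
qed

section \<open>The dilation theorem\<close>

text \<open>Both sides equal \<open>\<langle>X h, h\<rangle> - \<langle>X T\<^sub>q\<^sup>* T\<^sub>p\<^sup>* h, T\<^sub>q\<^sup>* T\<^sub>p\<^sup>* h\<rangle>\<close>, where \<open>X\<close> is the inverse Szego kernel of the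
  tuple with both entries removed.\<close>

lemma defect_exchange:
  assumes T: "T \<in> commuting_contractions (Suc (Suc m)) whole" and pq: "1 \<le> p" "p < q" "q \<le> Suc (Suc m)"
  defines "S \<equiv> szego_inv (Suc m) (remove_entry p T)" and "S' \<equiv> szego_inv (Suc m) (remove_entry q T)"
  shows "cinner (S h) h + cinner (S' (hadj whole (T q) h)) (hadj whole (T q) h)
    = cinner (S' h) h + cinner (S (hadj whole (T p) h)) (hadj whole (T p) h)"
proof -
  let ?P = "hadj whole (T p)" and ?Q = "hadj whole (T q)"
  define X where "X = szego_inv m (remove_entry p (remove_entry q T))"
  have cp: "contraction_op (T p)" and cq: "contraction_op (T q)" and com: "\<And>x. T p (T q x) = T q (T p x)"
    using T pq by (auto simp: commuting_contractions_whole)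
  have "remove_entry (q - 1) (remove_entry p T) = remove_entry p (remove_entry q T)"
    using pq by (auto simp: remove_entry_def fun_eq_iff)
  moreover have "remove_entry p T (q - 1) = T q" "remove_entry q T p = T p"
    using pq by (auto simp: remove_entry_def)
  moreover have "remove_entry p T \<in> commuting_contractions (Suc m) whole"
    "remove_entry q T \<in> commuting_contractions (Suc m) whole"
    using T pq by (auto intro!: remove_entry_commuting_contractions)
  moreover have "q - 1 \<in> {1..Suc m}" "p \<in> {1..Suc m}"
    using pq unfolding atLeastAtMost_iff by arith+
  ultimately have S: "S x = X x - T q (X (?Q x))" and S': "S' x = X x - T p (X (?P x))" for x
    using szego_inv_remove_entry[of "remove_entry p T" m "q - 1" x]
      szego_inv_remove_entry[of "remove_entry q T" m p x]
    unfolding S_def S'_def X_def by simp_all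
  have "?P (?Q h) = ?Q (?P h)"
    by (rule hadj_commute[OF cp cq com])
  then show ?thesis
    by (simp add: S S' cinner_diff cinner_hadj[OF cp] cinner_hadj[OF cq])
qed

text \<open>Coordinate functions are scalar, so they commute with multiplication by an operator-valued function.\<close>

lemma commuting_contractions_insert_multiplier:
  fixes B :: "'a::complex_hilbert set"
  assumes B: "finite B" "orthonormal B" and C: "isometric_colligation V (cspan B) F B" and l: "l \<in> {1..m}" and p: "p \<in> {1..Suc m}"
  defines "W \<equiv> \<lambda>i. if i < p then mult_coord i
    else if i = p then mult_op (at_coord l (isometric_colligation.transfer V B)) else mult_coord (i - 1)"
  shows "W \<in> commuting_contractions (Suc m) (hardy m (cspan B))"
    and "\<And>i. i \<in> {1..Suc m} \<Longrightarrow> hisometry (hardy m (cspan B)) (hardy m (cspan B)) (W i)"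
proof -
  interpret isometric_colligation V "cspan B" F B by fact
  let ?K = "hardy m (cspan B)" and ?M = "mult_op (at_coord l transfer)"
  show iso: "hisometry ?K ?K (W i)" if i: "i \<in> {1..Suc m}" for i
  proof -
    consider "i < p" | "i = p" | "i > p" by linarith
    then show ?thesis
    proof cases
      case 1
      then show ?thesis
        using i p mult_coord_hisometry[OF B, of i m] by (auto simp: W_def)
    next
      case 2
      then show ?thesis
        using mult_transfer_hisometry[OF l] by (simp add: W_def)
    next
      case 3
      then have "i - 1 \<in> {1..m}"
        using i p unfolding atLeastAtMost_iff by arith
      then show ?thesis
        using 3 mult_coord_hisometry[OF B, of "i - 1" m] by (simp add: W_def)
    qed
  qed
  have cc: "mult_coord i (mult_coord j f) = mult_coord j (mult_coord i f)" for i j and f :: "(nat \<Rightarrow> complex) \<Rightarrow> 'a"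
    by (simp add: mult_coord_def scaleC_scaleC mult.commute)
  have cm: "mult_coord i (?M f) = ?M (mult_coord i f)" if f: "f \<in> hardy_set m (cspan B)" for i f
  proof
    fix z
    show "mult_coord i (?M f) z = ?M (mult_coord i f) z"
    proof (cases "z \<in> polydisc m")
      case True
      then show ?thesis
        using transfer_in_bounded_ops[OF polydisc_norm_less[OF True l]]
        by (simp add: mult_coord_def mult_op_def at_coord_def bounded_ops_def)
    qed (simp add: mult_coord_def mult_op_def hardyD(1)[OF f])
  qed
  have "W i (W j f) = W j (W i f)" if f: "f \<in> hardy_set m (cspan B)" for i j f
    by (simp add: W_def cc cm[OF f])
  then show "W \<in> commuting_contractions (Suc m) ?K"
    unfolding commuting_contractions_def using iso by (auto simp: hisometry_def)
qed

theorem theorem3p3: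
  fixes n p q :: nat
    and T :: "nat \<Rightarrow> 'a::complex_hilbert \<Rightarrow> 'a"
  assumes "n \<ge> 3" and "1 \<le> p" and "p < q" and "q \<le> n"
    and "T \<in> tuples_pq n p q"
    and "finite_rank n p q T"
  shows "let E = defect_space (n - 1) (remove_entry p T); K = hardy (n - 1) E in
    \<exists>\<Psi> \<phi>. hisometry whole K \<Psi> \<and>
      inner_function 1 E (at_coord 1 \<phi>) \<and>
      (let \<Phi>\<^sub>p = at_coord (q - 1) \<phi> in
        (\<forall>i\<in>{1..n}. \<forall>h. \<Psi> (hadj whole (T i) h) =
          (if i < p then hadj K (mult_coord i) (\<Psi> h)
           else if i = p then hadj K (mult_op \<Phi>\<^sub>p) (\<Psi> h)
           else hadj K (mult_coord (i - 1)) (\<Psi> h))) \<and>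
        dilates n T K
          (\<lambda>i. if i < p then mult_coord i else if i = p then mult_op \<Phi>\<^sub>p else mult_coord (i - 1)))"
proof -
  define m where "m = n - 2"
  have n: "n = Suc (Suc m)"
    using assms(1) by (simp add: m_def)
  let ?m = "Suc m"
  define R where "R = remove_entry p T"
  define Q where "Q = remove_entry q T"
  define S where "S = szego_inv ?m R"
  define S' where "S' = szego_inv ?m Q"
  define E where "E = defect_space ?m R"
  define F where "F = defect_space ?m Q"
  define Tp where "Tp = hadj whole (T p)"
  define Tq where "Tq = hadj whole (T q)"
  have T: "T \<in> commuting_contractions n whole" and posS: "positive_op S" and posS': "positive_op S'"
    and R: "R \<in> commuting_contractions ?m whole" and Q: "Q \<in> commuting_contractions ?m whole"
    and pure: "pure_tuple ?m R"
    using assms(5) by (auto simp: tuples_pq_def szego_tuples_def R_def Q_def S_def S'_def n)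
  have fin: "finite_cdim E" "finite_cdim F"
    using assms(6) by (auto simp: finite_rank_def E_def F_def R_def Q_def n)
  have contr: "contraction_op (T i)" if "i \<in> {1..n}" for i
    using T that by (simp add: commuting_contractions_whole)
  have p: "p \<in> {1..n}" and q: "q \<in> {1..n}" and l: "q - 1 \<in> {1..?m}"
    using assms(1-4) unfolding n atLeastAtMost_iff by arith+
  note saS = selfadjoint_op_szego_inv[OF R, folded S_def]
  note saS' = selfadjoint_op_szego_inv[OF Q, folded S'_def]
  note E = defect_space_subspace[OF R, folded E_def S_def]
  note F = defect_space_subspace[OF Q, folded F_def S'_def]
  obtain D where D: "clinear_map D" "range D \<subseteq> E" "\<And>x y. cinner (D x) (D y) = cinner (S x) y"
    using finite_rank_factorization[OF saS posS E(1) fin(1) E(2)] by blast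
  obtain D' where D': "clinear_map D'" "range D' \<subseteq> F" "\<And>x y. cinner (D' x) (D' y) = cinner (S' x) y"
    using finite_rank_factorization[OF saS' posS' F(1) fin(2) F(2)] by blast
  obtain B where B: "finite B" "orthonormal B" "cspan B = E"
    using finite_cdim_orthonormal_basis[OF E(1) fin(1)] by blast
  have lin: "contraction_op Tp" "contraction_op Tq"
    unfolding Tp_def Tq_def by (intro contraction_op_hadj contr p q)+
  \<comment> \<open>The two sides of the energy exchange, as vectors of \<open>E \<times> F\<close>.\<close>
  define f where "f h = (D (Tp h), D' h)" for h
  define g where "g h = (D h, D' (Tq h))" for h
  have "clinear_map f" "clinear_map g"
    unfolding clinear_map_def f_def g_def
    by (auto simp: clinear_mapD[OF D(1)] clinear_mapD[OF D'(1)] contraction_opD[OF lin(1)]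
        contraction_opD[OF lin(2)] scaleC_Pair)
  moreover have "range f \<subseteq> E \<times> F" "range g \<subseteq> E \<times> F"
    using D(2) D'(2) by (auto simp: f_def g_def)
  moreover have "norm (f h) = norm (g h)" for h
  proof -
    have "cinner (S h) h + cinner (S' (Tq h)) (Tq h) = cinner (S' h) h + cinner (S (Tp h)) (Tp h)"
      unfolding S_def S'_def R_def Q_def Tp_def Tq_def
      using T assms(2-4) unfolding n by (intro defect_exchange) auto
    then have "cinner (g h) (g h) = cinner (f h) (f h)"
      by (simp add: f_def g_def cinner_Pair D(3) D'(3) add.commute)
    then have "(norm (g h))\<^sup>2 = (norm (f h))\<^sup>2"
      by (metis Re_cinner_self)
    then show ?thesis by simp
  qed
  ultimately obtain V where V: "linear_isometry V" "\<And>x. V (f x) = g x" "\<And>x. x \<in> E \<times> F \<Longrightarrow> V x \<in> E \<times> F"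
    using isometry_extension[of f g "E \<times> F"] subspace_Times[OF E(1) F(1)] finite_cdim_Times[OF fin] by blast
  interpret C: isometric_colligation V "cspan B" F B
    by standard (use V(1,3) B F(1) fin(2) in auto)
  interpret Z: szego_dilation ?m R D B
    by standard (use R pure posS B D in \<open>auto simp: S_def\<close>)
  let ?K = "hardy ?m E" and ?\<Phi> = "at_coord (q - 1) C.transfer"
  obtain c where c: "\<And>x. norm (D x) \<le> norm x * c"
    using factor_norm_bound[OF saS D(3)] by blast
  obtain c' where c': "\<And>x. norm (D' x) \<le> norm x * c'"
    using factor_norm_bound[OF saS' D'(3)] by blast
  have coord: "hadj ?K (mult_coord i) (Z.dilation h) = Z.dilation (hadj whole (R i) h)" if i: "i \<in> {1..?m}" for i h
  proof -
    have "hadj (hardy ?m (cspan B)) (mult_op (at_coord i (isometric_colligation.transfer prod.swap B))) (Z.dilation h)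
        = Z.dilation (hadj whole (R i) h)"
      by (rule Z.dilation_intertwines[OF swap_colligation[OF B(1,2)] i, where G = D and C = c])
        (use i in \<open>auto intro: Z.adj_commute c\<close>)
    moreover have "hadj (hardy ?m (cspan B)) (mult_coord i) y
        = hadj (hardy ?m (cspan B)) (mult_op (at_coord i (isometric_colligation.transfer prod.swap B))) y" for y
      unfolding hadj_def by (simp add: mult_coord_eq_mult_op[OF B(1,2) i] cong: conj_cong)
    ultimately show ?thesis
      by (simp add: B(3))
  qed
  have mult: "hadj ?K (mult_op ?\<Phi>) (Z.dilation h) = Z.dilation (Tp h)" for h
  proof -
    have Rq: "R (q - 1) = T q"
      using assms(2-4) by (auto simp: R_def remove_entry_def)
    have "hadj whole (R i) (Tp x) = Tp (hadj whole (R i) x)" if "i \<in> {1..?m}" for i x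
    proof -
      define j where "j = (if i < p then i else Suc i)"
      have "j \<in> {1..n}" "R i = T j"
        using \<open>i \<in> {1..?m}\<close> by (auto simp: R_def remove_entry_def n j_def)
      then show ?thesis
        unfolding Tp_def using T p by (simp add: commuting_contractions_whole hadj_commute)
    qed
    then have "hadj (hardy ?m (cspan B)) (mult_op ?\<Phi>) (Z.dilation h) = Z.dilation (Tp h)"
      using V(2) c' unfolding f_def g_def Tq_def Rq[symmetric]
      by (intro Z.dilation_intertwines[OF C.isometric_colligation_axioms l]) auto
    then show ?thesis
      by (simp add: B(3))
  qed
  define W where "W i = (if i < p then mult_coord i else if i = p then mult_op ?\<Phi> else mult_coord (i - 1))"
    for i :: nat
  have inter: "Z.dilation (hadj whole (T i) h) = hadj ?K (W i) (Z.dilation h)" if i: "i \<in> {1..n}" for i h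
  proof -
    consider "i < p" | "i = p" | "i > p" by linarith
    then show ?thesis
    proof cases
      case 1
      then have "i \<in> {1..?m}" "R i = T i"
        using i p by (auto simp: R_def remove_entry_def n)
      then show ?thesis
        using coord[of i h] 1 by (simp add: W_def)
    next
      case 2
      then show ?thesis
        using mult[of h] by (simp add: W_def Tp_def)
    next
      case 3
      then have "i - 1 \<in> {1..?m}" "R (i - 1) = T i"
        using i assms(2) by (auto simp: R_def remove_entry_def n)
      then show ?thesis
        using coord[of "i - 1" h] 3 by (simp add: W_def)
    qed
  qed
  have iso: "hisometry whole ?K Z.dilation"
    using Z.dilation_hisometry by (simp add: B(3))
  have "dilates n T ?K W"
    unfolding dilates_def
  proof (intro conjI exI[of _ Z.dilation] ballI allI iso inter)
    show "hilbert_space ?K"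
      using Z.hilbert_space_target by (simp add: B(3))
    note W = commuting_contractions_insert_multiplier[OF B(1,2) C.isometric_colligation_axioms l p[unfolded n], folded W_def[abs_def]]
    show "W \<in> commuting_contractions n ?K"
      using W(1) by (simp add: B(3) n)
    show "hisometry ?K ?K (W i)" if "i \<in> {1..n}" for i
      using W(2)[of i] that by (simp add: B(3) n W_def)
  qed
  moreover have "inner_function 1 E (at_coord 1 C.transfer)"
    using C.inner_function_transfer by (simp add: B(3))
  moreover have "E = defect_space (n - 1) (remove_entry p T)" "?K = hardy (n - 1) E"
    by (simp_all add: E_def R_def n)
  ultimately show ?thesis
    using iso inter unfolding Let_def W_def[abs_def]
    by (intro exI[of _ Z.dilation] exI[of _ C.transfer]) (auto simp: W_def[abs_def])
qed

end
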